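(* Let $n\in\mathbb{N}$ and let $V:\mathbb{R}^n\to\mathbb{R}$ be continuous and bounded below. Suppose that, as a multiplication operator with domain $D(V)=\{f\in L^2(\mathbb{R}^n): Vf\in L^2(\mathbb{R}^n)\}$, $V$ is relatively $(-\Delta)$-bounded with relative bound strictly less than one, so that $H=-\Delta+V$ is self-adjoint on the domain $H^2(\mathbb{R}^n)$. Assume moreover that $V\in C_b^k(\mathbb{R}^n)$ for some $k\in\mathbb{N}$ with $k>(n-4)/2$. Let $\psi\in L^2(\mathbb{R}^n)$ be an eigenfunction of $H$ with associated eigenvalue $E\in\mathbb{R}$ such that, for some function $\phi\in C^1([0,+\infty))$ with $\phi\ge 1$ and $$0<\sup_{t\in[0,\infty)}\left|\frac{\phi'(t)}{\phi(t)}\right|<\infty,$$ and some $0<\epsilon<1$, one has $$\phi\big((1-\epsilon)\rho_E\big)\,\psi\in L^2(\mathbb{R}^n),$$ where $\rho_E(x)$ is the Agmon distance of $x$ to the origin associated with $V$ and $E$. Then there exists a constant $0<C_\epsilon<\infty$ such that $$|\psi(x)|\le \frac{C_\epsilon}{\phi\big((1-\epsilon)\rho_E(x)\big)}\qquad\text{for all } x\in\mathbb{R}^n .$$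
   Context: $\mathbb{N}=\{1,2,3,\dots\}$. $-\Delta$ is the self-adjoint Laplacian on $L^2(\mathbb{R}^n)$ with domain $H^2(\mathbb{R}^n)$. $C_b^k(\mathbb{R}^n)$ denotes the $C^k$-functions all of whose partial derivatives up to order $k$ (including order $0$) are bounded. Under these assumptions every $L^2$-eigenfunction of $H$ has a continuous representative, and $\psi$ denotes that representative in the pointwise bound. For continuous $V:\mathbb{R}^n\to\mathbb{R}$ and $E\in\mathbb{R}$, the Agmon metric is the pseudo-metric $$\rho_E(x,y):=\inf_{\gamma\in P_{x,y}}\int_0^1 (V(\gamma(t))-E)_+^{1/2}\,|\dot\gamma(t)|\,\mathrm{d}t,$$ where $P_{x,y}$ is the set of absolutely continuous paths $\gamma:[0,1]\to\mathbb{R}^n$ with $\gamma(0)=x$, $\gamma(1)=y$, and $(V-E)_+:=\max\{V-E,0\}$. The Agmon distance to the origin is $\rho_E(x):=\rho_E(x,0)$. *)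

theory Defs
  imports "HOL-Analysis.Analysis"
begin

section \<open>Classical derivatives\<close>

definition partial_deriv :: "'n \<Rightarrow> (real^'n \<Rightarrow> real) \<Rightarrow> real^'n \<Rightarrow> real" where
  "partial_deriv i f x = deriv (\<lambda>t. f (x + t *\<^sub>R axis i 1)) 0"

primrec iter_partial :: "'n list \<Rightarrow> (real^'n \<Rightarrow> real) \<Rightarrow> real^'n \<Rightarrow> real" where
  "iter_partial [] f = f"
| "iter_partial (i # \<alpha>) f = partial_deriv i (iter_partial \<alpha> f)"

text \<open>
  Multi-indices are lists of coordinate directions, so \<open>length \<alpha>\<close> is the order.
  As \<^const>\<open>deriv\<close> is total, existence of the partial derivatives is required separately.
\<close>

definition C_k :: "nat \<Rightarrow> (real^'n \<Rightarrow> real) set" where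
  "C_k k = {f.
     (\<forall>\<alpha> i x. length \<alpha> < k \<longrightarrow>
        (\<lambda>t. iter_partial \<alpha> f (x + t *\<^sub>R axis i 1)) field_differentiable at 0) \<and>
     (\<forall>\<alpha>. length \<alpha> \<le> k \<longrightarrow> continuous_on UNIV (iter_partial \<alpha> f))}"

definition C_b :: "nat \<Rightarrow> (real^'n \<Rightarrow> real) set" where
  "C_b k = {f \<in> C_k k. \<forall>\<alpha>. length \<alpha> \<le> k \<longrightarrow> bounded (range (iter_partial \<alpha> f))}"

definition test_functions :: "(real^'n \<Rightarrow> real) set" where
  "test_functions = {\<eta>. (\<forall>k. \<eta> \<in> C_k k) \<and> compact (closure {x. \<eta> x \<noteq> 0})}"

section \<open>Square-integrable functions and Sobolev spaces\<close>

text \<open>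
  Elements of \<open>L\<^sup>2\<close> are represented by functions; all notions below that concern \<open>L\<^sup>2\<close> are
  invariant under modification on a Lebesgue null set.
\<close>

definition L2 :: "(real^'n \<Rightarrow> complex) set" where
  "L2 = {f \<in> borel_measurable lebesgue. integrable lebesgue (\<lambda>x. (norm (f x))\<^sup>2)}"

definition L2_norm :: "(real^'n \<Rightarrow> complex) \<Rightarrow> real" where
  "L2_norm f = sqrt (LINT x|lebesgue. (norm (f x))\<^sup>2)"

definition weak_partial ::
    "'n list \<Rightarrow> (real^'n \<Rightarrow> complex) \<Rightarrow> (real^'n \<Rightarrow> complex) \<Rightarrow> bool" where
  "weak_partial \<alpha> f g \<longleftrightarrow> (\<forall>\<eta>\<in>test_functions.
     (LINT x|lebesgue. iter_partial \<alpha> \<eta> x *\<^sub>R f x)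
       = (-1) ^ length \<alpha> * (LINT x|lebesgue. \<eta> x *\<^sub>R g x))"

definition sobolev_H :: "nat \<Rightarrow> (real^'n \<Rightarrow> complex) set" where
  "sobolev_H m = {f \<in> L2. \<forall>\<alpha>. length \<alpha> \<le> m \<longrightarrow> (\<exists>g\<in>L2. weak_partial \<alpha> f g)}"

section \<open>Unbounded operators\<close>

text \<open>
  An operator on \<open>L\<^sup>2\<close> is given by its graph, a set of pairs of representatives closed under
  almost-everywhere equality; its domain is \<^const>\<open>Domain\<close>.
\<close>

type_synonym 'n L2_operator = "((real^'n \<Rightarrow> complex) \<times> (real^'n \<Rightarrow> complex)) set"

definition neg_laplacian :: "'n::finite L2_operator" where
  "neg_laplacian = {(f, g). f \<in> sobolev_H 2 \<and> g \<in> L2 \<and>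
     (\<exists>d. (\<forall>i. d i \<in> L2 \<and> weak_partial [i, i] f (d i)) \<and>
          (AE x in lebesgue. g x = - (\<Sum>i\<in>UNIV. d i x)))}"

definition mult_op :: "(real^'n \<Rightarrow> real) \<Rightarrow> 'n::finite L2_operator" where
  "mult_op V = {(f, g). f \<in> L2 \<and> g \<in> L2 \<and> (AE x in lebesgue. g x = of_real (V x) * f x)}"

definition op_sum :: "'n::finite L2_operator \<Rightarrow> 'n L2_operator \<Rightarrow> 'n L2_operator" where
  "op_sum A B = {(f, g). g \<in> L2 \<and>
     (\<exists>u v. (f, u) \<in> A \<and> (f, v) \<in> B \<and> (AE x in lebesgue. g x = u x + v x))}"

definition schroedinger_op :: "(real^'n \<Rightarrow> real) \<Rightarrow> 'n::finite L2_operator" where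
  "schroedinger_op V = op_sum neg_laplacian (mult_op V)"

definition rel_bounds :: "'n::finite L2_operator \<Rightarrow> 'n L2_operator \<Rightarrow> real set" where
  "rel_bounds B A = {a. 0 \<le> a \<and> (\<exists>b\<ge>0. \<forall>f u v. (f, u) \<in> A \<longrightarrow> (f, v) \<in> B \<longrightarrow>
     L2_norm v \<le> a * L2_norm u + b * L2_norm f)}"

definition relatively_bounded :: "'n::finite L2_operator \<Rightarrow> 'n L2_operator \<Rightarrow> bool" where
  "relatively_bounded B A \<longleftrightarrow> Domain A \<subseteq> Domain B \<and> rel_bounds B A \<noteq> {}"

definition relative_bound :: "'n::finite L2_operator \<Rightarrow> 'n L2_operator \<Rightarrow> real" where
  "relative_bound B A = Inf (rel_bounds B A)"

definition eigenfunction :: "'n::finite L2_operator \<Rightarrow> real \<Rightarrow> (real^'n \<Rightarrow> complex) \<Rightarrow> bool" where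
  "eigenfunction A E \<psi> \<longleftrightarrow>
     (\<psi>, \<lambda>x. of_real E * \<psi> x) \<in> A \<and> \<not> (AE x in lebesgue. \<psi> x = 0)"

section \<open>The Agmon metric\<close>

text \<open>
  \<open>d division_of \<Union>d\<close> says that \<open>d\<close> is a finite set of compact intervals with pairwise disjoint
  interiors, so this is the usual \<open>\<epsilon>\<close>-\<open>\<delta>\<close> definition of absolute continuity.
\<close>

definition abs_continuous_on :: "real set \<Rightarrow> (real \<Rightarrow> 'a::real_normed_vector) \<Rightarrow> bool" where
  "abs_continuous_on S \<gamma> \<longleftrightarrow> (\<forall>\<epsilon>>0. \<exists>\<delta>>0. \<forall>d.
     d division_of \<Union>d \<and> \<Union>d \<subseteq> S \<and> (\<Sum>I\<in>d. Sup I - Inf I) < \<delta>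
       \<longrightarrow> (\<Sum>I\<in>d. norm (\<gamma> (Sup I) - \<gamma> (Inf I))) < \<epsilon>)"

definition ac_paths :: "real^'n \<Rightarrow> real^'n \<Rightarrow> (real \<Rightarrow> real^'n) set" where
  "ac_paths x y = {\<gamma>. abs_continuous_on {0..1} \<gamma> \<and> \<gamma> 0 = x \<and> \<gamma> 1 = y}"

text \<open>
  An absolutely continuous path is differentiable almost everywhere; the value of
  \<^const>\<open>vector_derivative\<close> on the remaining null set does not affect the integral.
\<close>

definition agmon_metric :: "(real^'n \<Rightarrow> real) \<Rightarrow> real \<Rightarrow> real^'n \<Rightarrow> real^'n \<Rightarrow> real" where
  "agmon_metric V E x y = (INF \<gamma>\<in>ac_paths x y.
     LINT t:{0..1}|lebesgue.
       sqrt (max (V (\<gamma> t) - E) 0) * norm (vector_derivative \<gamma> (at t within {0..1})))"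

definition agmon_dist :: "(real^'n \<Rightarrow> real) \<Rightarrow> real \<Rightarrow> real^'n \<Rightarrow> real" where
  "agmon_dist V E x = agmon_metric V E x 0"

end

theory Submission
  imports Defs "HOL-Computational_Algebra.Polynomial" "HOL-Probability.Distributions"
    "HOL-Real_Asymp.Real_Asymp"
begin

text \<open>
  Let \<open>W = V - E\<close>, which is bounded, say by \<open>M\<close>, and let \<open>P t\<close> be the heat semigroup. Testing
  \<open>\<Delta>\<psi> = W\<psi>\<close> against truncated heat kernels gives the Duhamel formula
  \<open>\<psi> = P T \<psi> - \<integral>\<^sub>0\<^sup>T P r (W\<psi>) dr\<close>, hence \<open>\<bar>\<psi>\<bar> \<le> P T \<bar>\<psi>\<bar> + M \<integral>\<^sub>0\<^sup>T P r \<bar>\<psi>\<bar> dr\<close> almost everywhere.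
  By the semigroup law the same right-hand side bounds \<open>P s \<bar>\<psi>\<bar>\<close> for all \<open>s \<le> T\<close>, so for
  \<open>2 M T \<le> 1\<close> integration over \<open>s\<close> absorbs the integral and yields \<open>\<bar>\<psi>\<bar> \<le> 2 P T \<bar>\<psi>\<bar>\<close>. In
  particular \<open>\<psi>\<close> is bounded, and the right-hand side of the Duhamel formula is continuous.
  Since \<open>V\<close> is bounded, the Agmon distance is Lipschitz, and so the weight \<open>\<phi> ((1 - \<epsilon>) \<rho>)\<close> changes
  at most exponentially; the Gaussian decay of the heat kernel compensates this, and
  Cauchy-Schwarz turns \<open>\<bar>\<psi>\<bar> \<le> 2 P T \<bar>\<psi>\<bar>\<close> into the weighted pointwise bound.
\<close>

section \<open>Lipschitz continuity of the Agmon distance\<close>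

text \<open>The delicate point is time 0. The a priori bound for \<open>avg r\<close> is of order
  r^(-n/2), in general not integrable at 0, so finiteness of its integral over times in (0,T] cannot
  be read off pointwise. It holds almost everywhere, because after one unit of heat flow all times
  involved are at least 1; without it the absorption would subtract infinity from infinity. That the
  heat flow of psi returns to psi at vanishing time is proved only weakly, against indicators of
  boxes, which is enough to identify its almost everywhere limit with psi. The weak equation admits
  only compactly supported test functions, hence the truncation. Cutting off each coordinate
  separately keeps the kernel a product, so derivatives, integrals and convolutions reduce to one
  variable. Boundedness of W is the order zero part of \<open>C_b k\<close>. The weighted bound
  holds almost everywhere at first and passes to every point because both the representative and the
  weight are continuous.\<close>

lemma abs_continuous_on_add:
  assumes "abs_continuous_on S f" "abs_continuous_on S g"
  shows "abs_continuous_on S (\<lambda>t. f t + g t)"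
  unfolding abs_continuous_on_def
proof (intro allI impI)
  fix e :: real assume "e > 0"
  then have "e / 2 > 0" by simp
  from assms(1)[unfolded abs_continuous_on_def, rule_format, OF this]
  obtain d1 where d1: "d1 > 0" "\<And>d. d division_of \<Union>d \<and> \<Union>d \<subseteq> S \<and> (\<Sum>I\<in>d. Sup I - Inf I) < d1
       \<Longrightarrow> (\<Sum>I\<in>d. norm (f (Sup I) - f (Inf I))) < e / 2" by blast
  from assms(2)[unfolded abs_continuous_on_def, rule_format, OF \<open>e / 2 > 0\<close>]
  obtain d2 where d2: "d2 > 0" "\<And>d. d division_of \<Union>d \<and> \<Union>d \<subseteq> S \<and> (\<Sum>I\<in>d. Sup I - Inf I) < d2
       \<Longrightarrow> (\<Sum>I\<in>d. norm (g (Sup I) - g (Inf I))) < e / 2" by blast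
  show "\<exists>\<delta>>0. \<forall>d. d division_of \<Union>d \<and> \<Union>d \<subseteq> S \<and> (\<Sum>I\<in>d. Sup I - Inf I) < \<delta>
       \<longrightarrow> (\<Sum>I\<in>d. norm (f (Sup I) + g (Sup I) - (f (Inf I) + g (Inf I)))) < e"
  proof (intro exI[of _ "min d1 d2"] conjI allI impI)
    fix d :: "real set set"
    assume d: "d division_of \<Union>d \<and> \<Union>d \<subseteq> S \<and> (\<Sum>I\<in>d. Sup I - Inf I) < min d1 d2"
    have "(\<Sum>I\<in>d. norm (f (Sup I) + g (Sup I) - (f (Inf I) + g (Inf I))))
        \<le> (\<Sum>I\<in>d. norm (f (Sup I) - f (Inf I)) + norm (g (Sup I) - g (Inf I)))"
      by (intro sum_mono) (simp add: norm_diff_triangle_ineq)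
    also have "\<dots> < e / 2 + e / 2"
      unfolding sum.distrib using d d1(2)[of d] d2(2)[of d] by (intro add_strict_mono) auto
    finally show "(\<Sum>I\<in>d. norm (f (Sup I) + g (Sup I) - (f (Inf I) + g (Inf I)))) < e" by simp
  qed (use d1 d2 in auto)
qed

lemma division_of_realD:
  fixes d :: "real set set"
  assumes "d division_of S" "I \<in> d"
  shows "I = {Inf I..Sup I}" "Inf I \<le> Sup I" "Inf I \<in> S" "Sup I \<in> S"
proof -
  obtain a b where ab: "I = {a..b}" using division_ofD(4)[OF assms] by auto
  moreover have "I \<noteq> {}" using division_ofD(3)[OF assms] .
  moreover have "I \<subseteq> S" using division_ofD(2)[OF assms] .
  ultimately show "I = {Inf I..Sup I}" "Inf I \<le> Sup I" "Inf I \<in> S" "Sup I \<in> S"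
    by auto
qed

lemma abs_continuous_on_lipschitz:
  fixes f :: "real \<Rightarrow> 'a::real_normed_vector"
  assumes f: "\<And>s t. s \<in> S \<Longrightarrow> t \<in> S \<Longrightarrow> norm (f s - f t) \<le> B * \<bar>s - t\<bar>"
  shows "abs_continuous_on S f"
  unfolding abs_continuous_on_def
proof (intro allI impI)
  fix e :: real assume e: "e > 0"
  define B' where "B' = \<bar>B\<bar> + 1"
  have B': "B' > 0" "B \<le> B'" unfolding B'_def by auto
  show "\<exists>\<delta>>0. \<forall>d. d division_of \<Union>d \<and> \<Union>d \<subseteq> S \<and> (\<Sum>I\<in>d. Sup I - Inf I) < \<delta>
       \<longrightarrow> (\<Sum>I\<in>d. norm (f (Sup I) - f (Inf I))) < e"
  proof (intro exI[of _ "e / B'"] conjI allI impI)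
    fix d :: "real set set"
    assume d: "d division_of \<Union>d \<and> \<Union>d \<subseteq> S \<and> (\<Sum>I\<in>d. Sup I - Inf I) < e / B'"
    have "(\<Sum>I\<in>d. norm (f (Sup I) - f (Inf I))) \<le> (\<Sum>I\<in>d. B' * (Sup I - Inf I))"
    proof (intro sum_mono)
      fix I assume "I \<in> d"
      with d have I: "Inf I \<le> Sup I" "Inf I \<in> S" "Sup I \<in> S"
        using division_of_realD[of d "\<Union>d" I] by auto
      have "norm (f (Sup I) - f (Inf I)) \<le> B * (Sup I - Inf I)"
        using f[OF I(3,2)] I(1) by simp
      also have "\<dots> \<le> B' * (Sup I - Inf I)"
        using B' I(1) by (intro mult_right_mono) auto
      finally show "norm (f (Sup I) - f (Inf I)) \<le> B' * (Sup I - Inf I)" .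
    qed
    also have "\<dots> = B' * (\<Sum>I\<in>d. Sup I - Inf I)" by (simp add: sum_distrib_left)
    also have "\<dots> < e"
      using d B' by (simp add: pos_less_divide_eq mult.commute)
    finally show "(\<Sum>I\<in>d. norm (f (Sup I) - f (Inf I))) < e" .
  qed (use e B' in auto)
qed

text \<open>Monotonicity keeps the images of non-overlapping intervals non-overlapping, and the
  Lipschitz bound stretches their total length by at most \<open>B\<close>; so the delta of
  \<open>f\<close>, divided by \<open>B\<close>, works.\<close>

lemma abs_continuous_on_compose_mono_lipschitz:
  fixes f :: "real \<Rightarrow> 'a::real_normed_vector"
  assumes f: "abs_continuous_on T f" and T: "is_interval T"
    and \<tau>: "\<And>s. s \<in> S \<Longrightarrow> \<tau> s \<in> T" "mono_on S \<tau>"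
    and lip: "\<And>s t. s \<in> S \<Longrightarrow> t \<in> S \<Longrightarrow> \<bar>\<tau> s - \<tau> t\<bar> \<le> B * \<bar>s - t\<bar>" and "B > 0"
  shows "abs_continuous_on S (\<lambda>t. f (\<tau> t))"
  unfolding abs_continuous_on_def
proof (intro allI impI)
  fix e :: real assume "e > 0"
  from f[unfolded abs_continuous_on_def, rule_format, OF this]
  obtain d1 where d1: "d1 > 0" "\<And>d. d division_of \<Union>d \<and> \<Union>d \<subseteq> T \<and> (\<Sum>I\<in>d. Sup I - Inf I) < d1
       \<Longrightarrow> (\<Sum>I\<in>d. norm (f (Sup I) - f (Inf I))) < e" by blast
  show "\<exists>\<delta>>0. \<forall>d. d division_of \<Union>d \<and> \<Union>d \<subseteq> S \<and> (\<Sum>I\<in>d. Sup I - Inf I) < \<delta>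
       \<longrightarrow> (\<Sum>I\<in>d. norm (f (\<tau> (Sup I)) - f (\<tau> (Inf I)))) < e"
  proof (intro exI[of _ "d1 / B"] conjI allI impI)
    fix d :: "real set set"
    assume d: "d division_of \<Union>d \<and> \<Union>d \<subseteq> S \<and> (\<Sum>I\<in>d. Sup I - Inf I) < d1 / B"
    then have fin: "finite d" by auto
    have I: "I = {Inf I..Sup I}" "Inf I \<le> Sup I" "Inf I \<in> S" "Sup I \<in> S" if "I \<in> d" for I
      using division_of_realD[of d "\<Union>d" I] d that by auto
    have mono: "\<tau> s \<le> \<tau> t" if "s \<in> S" "t \<in> S" "s \<le> t" for s t
      using \<tau>(2) that by (auto simp: mono_on_def)
    define J where "J I = {\<tau> (Inf I)..\<tau> (Sup I)}" for I
    \<comment> \<open>Intervals collapsed by \<tau> are dropped: two of them may have the same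
      image, which would spoil injectivity of \<open>J\<close>, and they contribute 0 to the
      variation sum.\<close>
    define d' where "d' = {I \<in> d. \<tau> (Inf I) < \<tau> (Sup I)}"
    have d': "I \<in> d" "\<tau> (Inf I) < \<tau> (Sup I)" "Inf I < Sup I" if "I \<in> d'" for I
      using that I[of I] by (auto simp: d'_def less_le)
    have disj: "interior (J I) \<inter> interior (J I') = {}" if "I \<in> d'" "I' \<in> d'" "I \<noteq> I'" for I I'
    proof -
      have "interior I \<inter> interior I' = {}"
        using division_ofD(5)[of d "\<Union>d" I I'] d that d'(1) by blast
      then have "{Inf I<..<Sup I} \<inter> {Inf I'<..<Sup I'} = {}"
        using I[OF d'(1)[OF that(1)]] I[OF d'(1)[OF that(2)]]
        by (metis interior_atLeastAtMost_real)
      then have "Sup I \<le> Inf I' \<or> Sup I' \<le> Inf I"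
        using d'(3)[OF that(1)] d'(3)[OF that(2)]
        by (auto simp: min_le_iff_disj le_max_iff_disj not_le)
      then have "\<tau> (Sup I) \<le> \<tau> (Inf I') \<or> \<tau> (Sup I') \<le> \<tau> (Inf I)"
        using mono I[OF d'(1)[OF that(1)]] I[OF d'(1)[OF that(2)]] by blast
      then show ?thesis
        by (auto simp: J_def)
    qed
    have inj: "inj_on J d'"
    proof (rule inj_onI, rule ccontr)
      fix I I' assume a: "I \<in> d'" "I' \<in> d'" "J I = J I'" "I \<noteq> I'"
      then have "interior (J I) = {}" using disj[of I I'] by simp
      with d'(2)[OF a(1)] show False by (simp add: J_def)
    qed
    have SI: "Sup (J I) = \<tau> (Sup I)" "Inf (J I) = \<tau> (Inf I)" if "I \<in> d'" for I
      using d'(2)[OF that] by (auto simp: J_def)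
    have div: "J ` d' division_of \<Union>(J ` d')"
    proof (rule division_ofI)
      show "finite (J ` d')" using fin by (simp add: d'_def)
      show "\<And>K. K \<in> J ` d' \<Longrightarrow> K \<noteq> {}" using d'(2) by (force simp: J_def)
      show "\<And>K. K \<in> J ` d' \<Longrightarrow> \<exists>a b. K = cbox a b" by (auto simp: J_def)
      show "\<And>K1 K2. K1 \<in> J ` d' \<Longrightarrow> K2 \<in> J ` d' \<Longrightarrow> K1 \<noteq> K2 \<Longrightarrow> interior K1 \<inter> interior K2 = {}"
        using disj by blast
    qed auto
    have sub: "\<Union>(J ` d') \<subseteq> T"
    proof clarsimp
      fix I s assume "I \<in> d'" "s \<in> J I"
      then show "s \<in> T"
        using T[unfolded is_interval_1, rule_format, of "\<tau> (Inf I)" "\<tau> (Sup I)" s] \<tau>(1) I[OF d'(1)]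
        by (auto simp: J_def)
    qed
    have "(\<Sum>K\<in>J ` d'. Sup K - Inf K) = (\<Sum>I\<in>d'. \<tau> (Sup I) - \<tau> (Inf I))"
      using inj SI by (simp add: sum.reindex)
    also have "\<dots> \<le> (\<Sum>I\<in>d'. B * (Sup I - Inf I))"
    proof (intro sum_mono)
      fix K assume "K \<in> d'"
      then show "\<tau> (Sup K) - \<tau> (Inf K) \<le> B * (Sup K - Inf K)"
        using lip[of "Sup K" "Inf K"] I[OF d'(1)[of K]] by auto
    qed
    also have "\<dots> \<le> (\<Sum>I\<in>d. B * (Sup I - Inf I))"
      using fin I(2) \<open>B > 0\<close> by (intro sum_mono2) (auto simp: d'_def)
    also have "\<dots> = B * (\<Sum>I\<in>d. Sup I - Inf I)" by (simp add: sum_distrib_left)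
    also have "\<dots> < d1" using d \<open>B > 0\<close> by (simp add: pos_less_divide_eq mult.commute)
    finally have "(\<Sum>K\<in>J ` d'. Sup K - Inf K) < d1" .
    then have "(\<Sum>K\<in>J ` d'. norm (f (Sup K) - f (Inf K))) < e"
      using d1(2)[of "J ` d'"] div sub by blast
    also have "(\<Sum>K\<in>J ` d'. norm (f (Sup K) - f (Inf K)))
        = (\<Sum>I\<in>d'. norm (f (\<tau> (Sup I)) - f (\<tau> (Inf I))))"
      using inj SI by (simp add: sum.reindex)
    also have "\<dots> = (\<Sum>I\<in>d. norm (f (\<tau> (Sup I)) - f (\<tau> (Inf I))))"
    proof (rule sum.mono_neutral_left[OF fin])
      show "\<forall>I\<in>d - d'. norm (f (\<tau> (Sup I)) - f (\<tau> (Inf I))) = 0"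
      proof
        fix K assume K: "K \<in> d - d'"
        then have "\<tau> (Inf K) = \<tau> (Sup K)"
          using mono[of "Inf K" "Sup K"] I[of K] by (auto simp: d'_def)
        then show "norm (f (\<tau> (Sup K)) - f (\<tau> (Inf K))) = 0" by simp
      qed
    qed (auto simp: d'_def)
    finally show "(\<Sum>I\<in>d. norm (f (\<tau> (Sup I)) - f (\<tau> (Inf I)))) < e" .
  qed (use d1 \<open>B > 0\<close> in auto)
qed

text \<open>The Agmon length integrates over \<open>lebesgue\<close> a function that is not known to
  be Borel measurable, so the change of variables is needed for the completed measure.\<close>

lemma lebesgue_integral_real_affine:
  fixes f :: "real \<Rightarrow> real"
  assumes f: "integrable lebesgue f" and c: "c \<noteq> 0"
  shows "integrable lebesgue (\<lambda>x. f (t + c * x))"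
    and "(LINT x|lebesgue. f x) = \<bar>c\<bar> * (LINT x|lebesgue. f (t + c * x))"
proof -
  have eq: "lebesgue = density (distr lebesgue lebesgue (\<lambda>x. t + c * x)) (\<lambda>_. ennreal \<bar>c\<bar>)"
    using lebesgue_real_affine[OF c, of t] .
  have [measurable]: "(\<lambda>x. t + c * x) \<in> lebesgue \<rightarrow>\<^sub>M lebesgue"
    using lebesgue_affine_measurable[of "\<lambda>_::real. c" t] c by simp
  have [measurable]: "f \<in> borel_measurable lebesgue" using f by simp
  have "integrable (density (distr lebesgue lebesgue (\<lambda>x. t + c * x)) (\<lambda>_. ennreal \<bar>c\<bar>)) f"
    using f eq by simp
  then have "integrable (distr lebesgue lebesgue (\<lambda>x. t + c * x)) (\<lambda>x. \<bar>c\<bar> *\<^sub>R f x)"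
    by (subst (asm) integrable_density) auto
  then have "integrable (distr lebesgue lebesgue (\<lambda>x. t + c * x)) f"
    using c by simp
  then show "integrable lebesgue (\<lambda>x. f (t + c * x))"
    by (subst (asm) integrable_distr_eq) auto
  have "(LINT x|lebesgue. f x)
     = (LINT x|density (distr lebesgue lebesgue (\<lambda>x. t + c * x)) (\<lambda>_. ennreal \<bar>c\<bar>). f x)"
    using eq by simp
  also have "\<dots> = (LINT x|distr lebesgue lebesgue (\<lambda>x. t + c * x). \<bar>c\<bar> *\<^sub>R f x)"
    by (rule integral_density) auto
  also have "\<dots> = (LINT x|lebesgue. \<bar>c\<bar> *\<^sub>R f (t + c * x))"
    by (rule integral_distr) auto
  finally show "(LINT x|lebesgue. f x) = \<bar>c\<bar> * (LINT x|lebesgue. f (t + c * x))"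
    by simp
qed

text \<open>
  Precomposing with an affine map of slope \<open>k\<close> multiplies the derivative by \<open>k\<close> where it exists; where it
  does not, \<^const>\<open>vector_derivative\<close> is a fixed unspecified vector and is not rescaled.
\<close>

lemma vector_derivative_affine_reparam:
  fixes \<gamma> :: "real \<Rightarrow> 'a::real_normed_vector"
  assumes "k \<noteq> 0"
  shows "vector_derivative (\<lambda>t. \<gamma> (c + k * t)) (at t)
    = (if \<gamma> differentiable (at (c + k * t)) then k else 1) *\<^sub>R vector_derivative \<gamma> (at (c + k * t))"
proof (cases "\<gamma> differentiable (at (c + k * t))")
  case True
  then have "(\<gamma> has_vector_derivative vector_derivative \<gamma> (at (c + k * t))) (at (c + k * t))"
    by (simp add: vector_derivative_works)
  then have "((\<gamma> \<circ> (\<lambda>t. c + k * t)) has_vector_derivative k *\<^sub>R vector_derivative \<gamma> (at (c + k * t))) (at t)"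
    by (intro vector_diff_chain_at) (auto intro!: derivative_eq_intros)
  then show ?thesis using True by (simp add: o_def vector_derivative_at)
next
  case False
  have "\<not> (\<lambda>t. \<gamma> (c + k * t)) differentiable (at t)"
  proof
    assume "(\<lambda>t. \<gamma> (c + k * t)) differentiable (at t)"
    then obtain d where "((\<lambda>t. \<gamma> (c + k * t)) has_vector_derivative d) (at t)"
      by (auto simp: vector_derivative_works)
    then have "((\<lambda>t. \<gamma> (c + k * t)) \<circ> (\<lambda>s. (s - c) / k) has_vector_derivative (1 / k) *\<^sub>R d) (at (c + k * t))"
      using assms by (intro vector_diff_chain_at) (auto intro!: derivative_eq_intros)
    moreover have "(\<lambda>t. \<gamma> (c + k * t)) \<circ> (\<lambda>s. (s - c) / k) = \<gamma>"
      using assms by (auto simp: o_def)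
    ultimately show False
      using False by (metis differentiableI_vector)
  qed
  then have "\<And>d. \<not> ((\<lambda>t. \<gamma> (c + k * t)) has_vector_derivative d) (at t)"
    using differentiableI_vector by blast
  moreover have "\<And>d. \<not> (\<gamma> has_vector_derivative d) (at (c + k * t))"
    using False differentiableI_vector by blast
  ultimately show ?thesis using False by (simp add: vector_derivative_def)
qed

section \<open>Prepending a line segment to a path\<close>

lemma ac_paths_line: "(\<lambda>t. y + (1 - t) *\<^sub>R (x - y)) \<in> ac_paths x y"
  unfolding ac_paths_def
proof (intro CollectI conjI abs_continuous_on_lipschitz)
  fix s t :: real
  have "y + (1 - s) *\<^sub>R (x - y) - (y + (1 - t) *\<^sub>R (x - y)) = (t - s) *\<^sub>R (x - y)"
    by (simp add: algebra_simps)
  then show "norm (y + (1 - s) *\<^sub>R (x - y) - (y + (1 - t) *\<^sub>R (x - y))) \<le> norm (x - y) * \<bar>s - t\<bar>"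
    by (simp add: abs_minus_commute)
qed auto

text \<open>The path runs straight from \<open>x\<close> to \<open>\<gamma> 0\<close> on
  [0, 1 - 1/k] and then follows \<gamma> sped up by the factor \<open>k\<close>. It is a sum instead
  of a case distinction: the first summand is \<gamma> composed with a monotone Lipschitz map, the
  second is Lipschitz and fades out at 1 - 1/k, so absolute continuity needs no gluing
  argument.\<close>

definition prepend_line :: "real \<Rightarrow> 'a::real_normed_vector \<Rightarrow> (real \<Rightarrow> 'a) \<Rightarrow> real \<Rightarrow> 'a" where
  "prepend_line k x \<gamma> t = \<gamma> (max 0 (1 - k + k * t)) + (1 - min 1 (t / (1 - 1 / k))) *\<^sub>R (x - \<gamma> 0)"

lemma prepend_line_ac_paths:
  fixes \<gamma> :: "real \<Rightarrow> real^'n"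
  assumes \<gamma>: "\<gamma> \<in> ac_paths y z" and k: "k > 1"
  shows "prepend_line k x \<gamma> \<in> ac_paths x z"
proof -
  define \<theta> where "\<theta> = 1 - 1 / k"
  have \<theta>: "0 < \<theta>" "\<theta> < 1" using k by (auto simp: \<theta>_def)
  have g: "abs_continuous_on {0..1} \<gamma>" "\<gamma> 0 = y" "\<gamma> 1 = z" using \<gamma> by (auto simp: ac_paths_def)
  have "abs_continuous_on {0..1} (\<lambda>t. \<gamma> (max 0 (1 - k + k * t)))"
  proof (rule abs_continuous_on_compose_mono_lipschitz[OF g(1)])
    show "is_interval {0..1::real}" by simp
    show "max 0 (1 - k + k * s) \<in> {0..1}" if "s \<in> {0..1}" for s
      using that k mult_left_mono[of s 1 k] by auto
    show "mono_on {0..1} (\<lambda>s. max 0 (1 - k + k * s))"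
      using k by (auto intro!: mono_onI max.mono mult_left_mono)
    show "\<bar>max 0 (1 - k + k * s) - max 0 (1 - k + k * t)\<bar> \<le> k * \<bar>s - t\<bar>" for s t
    proof -
      have "\<bar>max 0 (1 - k + k * s) - max 0 (1 - k + k * t)\<bar> \<le> \<bar>k * s - k * t\<bar>" by linarith
      also have "\<dots> = k * \<bar>s - t\<bar>" using k by (simp add: right_diff_distrib[symmetric] abs_mult)
      finally show ?thesis .
    qed
  qed (use k in auto)
  moreover have "abs_continuous_on {0..1} (\<lambda>t. (1 - min 1 (t / \<theta>)) *\<^sub>R (x - y))"
  proof (rule abs_continuous_on_lipschitz)
    fix s t :: real
    have "norm ((1 - min 1 (s / \<theta>)) *\<^sub>R (x - y) - (1 - min 1 (t / \<theta>)) *\<^sub>R (x - y))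
      = \<bar>min 1 (t / \<theta>) - min 1 (s / \<theta>)\<bar> * norm (x - y)"
      unfolding scaleR_left_diff_distrib[symmetric] by simp
    also have "\<dots> \<le> \<bar>t / \<theta> - s / \<theta>\<bar> * norm (x - y)"
      by (intro mult_right_mono) (linarith, simp)
    also have "\<bar>t / \<theta> - s / \<theta>\<bar> = \<bar>s - t\<bar> / \<theta>"
      using \<theta> by (simp add: diff_divide_distrib[symmetric] abs_minus_commute)
    finally show "norm ((1 - min 1 (s / \<theta>)) *\<^sub>R (x - y) - (1 - min 1 (t / \<theta>)) *\<^sub>R (x - y))
      \<le> (norm (x - y) / \<theta>) * \<bar>s - t\<bar>" by (simp add: mult.commute)
  qed
  ultimately have "abs_continuous_on {0..1} (prepend_line k x \<gamma>)"
    unfolding prepend_line_def g \<theta>_def[symmetric] by (rule abs_continuous_on_add)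
  then show ?thesis
    using g k \<theta> by (auto simp: ac_paths_def prepend_line_def \<theta>_def[symmetric])
qed

definition agmon_integrand :: "(real^'n \<Rightarrow> real) \<Rightarrow> real \<Rightarrow> (real \<Rightarrow> real^'n) \<Rightarrow> real \<Rightarrow> real" where
  "agmon_integrand V E \<gamma> t =
     sqrt (max (V (\<gamma> t) - E) 0) * norm (vector_derivative \<gamma> (at t within {0..1}))"

lemma agmon_integrand_nonneg: "0 \<le> agmon_integrand V E \<gamma> t"
  by (simp add: agmon_integrand_def)

lemma agmon_integrand_interior:
  assumes "0 < t" "t < 1"
  shows "agmon_integrand V E \<gamma> t = sqrt (max (V (\<gamma> t) - E) 0) * norm (vector_derivative \<gamma> (at t))"
  using assms by (simp add: agmon_integrand_def at_within_Icc_at)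

text \<open>The straight part has constant speed. Integrated over its duration 1 - 1/k, the bound
  contributes \<open>L * norm (x - \<gamma> 0)\<close>, whatever \<open>k\<close> is.\<close>

lemma agmon_integrand_prepend_left:
  assumes k: "k > 1" and t: "0 < t" "t < 1 - 1 / k" and L: "\<And>x. sqrt (max (V x - E) 0) \<le> L"
  shows "agmon_integrand V E (prepend_line k x \<gamma>) t \<le> L * (norm (x - \<gamma> 0) / (1 - 1 / k))"
proof -
  let ?\<theta> = "1 - 1 / k"
  have th: "?\<theta> > 0" "?\<theta> < 1" using k by auto
  have "((\<lambda>t. \<gamma> 0 + (1 - t / ?\<theta>) *\<^sub>R (x - \<gamma> 0)) has_vector_derivative (- (1 / ?\<theta>)) *\<^sub>R (x - \<gamma> 0)) (at t)"
    using th by (auto intro!: derivative_eq_intros)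
  then have "(prepend_line k x \<gamma> has_vector_derivative (- (1 / ?\<theta>)) *\<^sub>R (x - \<gamma> 0)) (at t)"
  proof (rule has_vector_derivative_transform_within_open[of _ _ _ "{0<..<?\<theta>}"])
    fix s assume s: "s \<in> {0<..<?\<theta>}"
    then have "k * s < k * ?\<theta>" using k by (intro mult_strict_left_mono) auto
    also have "k * ?\<theta> = k - 1" using k by (simp add: field_simps)
    finally have "1 - k + k * s < 0" by simp
    moreover have "s / ?\<theta> < 1" using s th by (simp add: divide_less_eq_1)
    ultimately show "\<gamma> 0 + (1 - s / ?\<theta>) *\<^sub>R (x - \<gamma> 0) = prepend_line k x \<gamma> s"
      by (simp add: prepend_line_def)
  qed (use t in auto)
  then have "vector_derivative (prepend_line k x \<gamma>) (at t) = (- (1 / ?\<theta>)) *\<^sub>R (x - \<gamma> 0)"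
    by (rule vector_derivative_at)
  then have "norm (vector_derivative (prepend_line k x \<gamma>) (at t)) = norm (x - \<gamma> 0) / ?\<theta>"
    using th by simp
  moreover have "agmon_integrand V E (prepend_line k x \<gamma>) t = sqrt (max (V (prepend_line k x \<gamma> t) - E) 0)
      * norm (vector_derivative (prepend_line k x \<gamma>) (at t))"
    using t th by (intro agmon_integrand_interior) linarith+
  ultimately show ?thesis
    using th by (simp only:) (intro mult_right_mono L, simp)
qed

lemma agmon_integrand_prepend_right:
  assumes k: "k > 1" and t: "1 - 1 / k < t" "t < 1"
  shows "agmon_integrand V E (prepend_line k x \<gamma>) t
    = (if \<gamma> differentiable (at (1 - k + k * t)) then k else 1) * agmon_integrand V E \<gamma> (1 - k + k * t)"
proof -
  let ?\<theta> = "1 - 1 / k"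
  have th: "?\<theta> > 0" "?\<theta> < 1" using k by auto
  have eq: "prepend_line k x \<gamma> s = \<gamma> (1 - k + k * s)" and s0: "0 < 1 - k + k * s" if "?\<theta> < s" for s
  proof -
    have "k * ?\<theta> < k * s" using k that by (intro mult_strict_left_mono) auto
    moreover have "k * ?\<theta> = k - 1" using k by (simp add: field_simps)
    ultimately show s: "0 < 1 - k + k * s" by simp
    moreover have "1 \<le> s / ?\<theta>" using that th by (simp add: le_divide_eq_1)
    ultimately show "prepend_line k x \<gamma> s = \<gamma> (1 - k + k * s)"
      by (simp add: prepend_line_def)
  qed
  have s1: "1 - k + k * t < 1" using k t by simp
  have "vector_derivative (prepend_line k x \<gamma>) (at t) = vector_derivative (\<lambda>t. \<gamma> ((1 - k) + k * t)) (at t)"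
  proof (rule vector_derivative_cong_eq)
    show "\<forall>\<^sub>F s in nhds t. s \<in> UNIV \<longrightarrow> prepend_line k x \<gamma> s = \<gamma> (1 - k + k * s)"
      using eventually_nhds_in_open[of "{?\<theta><..}" t] t by (auto elim!: eventually_mono simp: eq)
  qed auto
  moreover have "0 < t" using t th by linarith
  ultimately show ?thesis
    using t k s0[OF t(1)] s1 eq[OF t(1)]
    by (simp add: agmon_integrand_interior vector_derivative_affine_reparam)
qed

lemma AE_lebesgue_notin_finite: "finite S \<Longrightarrow> AE t in lebesgue. t \<notin> S" for S :: "'a::euclidean_space set"
  by (intro AE_not_in null_sets_completionI finite_imp_null_set_lborel)

text \<open>The fast part is pulled back to (0,1) by t = 1 - 1/k + s/k. Integrability of
  \<open>m\<close> is a conclusion because the caller has to recover integrability along \<gamma>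
  from that along the longer path.\<close>

lemma prepend_line_integral:
  fixes \<gamma> :: "real \<Rightarrow> real^'n"
  assumes k: "k > 1" and L: "\<And>x. sqrt (max (V x - E) 0) \<le> L"
    and int: "set_integrable lebesgue {0..1} (agmon_integrand V E (prepend_line k x \<gamma>))"
  defines "m \<equiv> \<lambda>s. (if \<gamma> differentiable (at s) then k else 1) * agmon_integrand V E \<gamma> s"
  shows "set_integrable lebesgue {0<..<1} m"
    and "(LINT t:{0..1}|lebesgue. agmon_integrand V E (prepend_line k x \<gamma>) t)
      \<le> L * norm (x - \<gamma> 0) + (LINT s:{0<..<1}|lebesgue. m s) / k"
proof -
  define G where "G = agmon_integrand V E (prepend_line k x \<gamma>)"
  define \<theta> where "\<theta> = 1 - 1 / k"
  have \<theta>: "0 < \<theta>" "\<theta> < 1" using k by (auto simp: \<theta>_def)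
  have sub: "set_integrable lebesgue {\<theta><..<1} G" "set_integrable lebesgue {0<..<\<theta>} G"
    using \<theta> by (auto intro!: set_integrable_subset[OF int[folded G_def]])
  have iff: "\<theta> + 1 / k * s \<in> {\<theta><..<1} \<longleftrightarrow> s \<in> {0<..<1}" for s
    using k by (auto simp: \<theta>_def field_simps)
  have eq: "indicator {\<theta><..<1} (\<theta> + 1 / k * s) *\<^sub>R G (\<theta> + 1 / k * s) = indicator {0<..<1} s *\<^sub>R m s" for s
  proof (cases "s \<in> {0<..<1}")
    case True
    then have "\<theta> < \<theta> + 1 / k * s" "\<theta> + 1 / k * s < 1" using iff[of s] by auto
    moreover have "1 - k + k * (\<theta> + 1 / k * s) = s" using k by (simp add: \<theta>_def field_simps)
    ultimately have "G (\<theta> + 1 / k * s) = m s"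
      using agmon_integrand_prepend_right[OF k, of "\<theta> + 1 / k * s" V E x \<gamma>]
      by (simp add: G_def m_def \<theta>_def)
    then show ?thesis using True iff[of s] by (simp add: indicator_def)
  next
    case False
    then show ?thesis using iff[of s] by (simp add: indicator_def)
  qed
  have aff: "integrable lebesgue (\<lambda>s. indicator {\<theta><..<1} (\<theta> + 1 / k * s) *\<^sub>R G (\<theta> + 1 / k * s))"
    "(LINT t:{\<theta><..<1}|lebesgue. G t)
      = \<bar>1 / k\<bar> * (LINT s|lebesgue. indicator {\<theta><..<1} (\<theta> + 1 / k * s) *\<^sub>R G (\<theta> + 1 / k * s))"
    using lebesgue_integral_real_affine[OF sub(1)[unfolded set_integrable_def], of "1 / k" \<theta>] k
    by (auto simp: set_lebesgue_integral_def)
  show "set_integrable lebesgue {0<..<1} m"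
    using aff(1) unfolding eq set_integrable_def .
  have right: "(LINT t:{\<theta><..<1}|lebesgue. G t) = (LINT s:{0<..<1}|lebesgue. m s) / k"
    using aff(2) k unfolding eq set_lebesgue_integral_def by simp
  have "(LINT t:{0..1}|lebesgue. G t) =
     (LINT t|lebesgue. indicator {0<..<\<theta>} t *\<^sub>R G t + indicator {\<theta><..<1} t *\<^sub>R G t)"
    unfolding set_lebesgue_integral_def
  proof (rule integral_cong_AE)
    have "AE t in lebesgue. t \<notin> {0, \<theta>, 1}" by (rule AE_lebesgue_notin_finite) simp
    then show "AE t in lebesgue. indicator {0..1} t *\<^sub>R G t =
       indicator {0<..<\<theta>} t *\<^sub>R G t + indicator {\<theta><..<1} t *\<^sub>R G t"
      by eventually_elim (use \<theta> in \<open>auto simp: indicator_def\<close>)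
    show "(\<lambda>t. indicator {0..1} t *\<^sub>R G t) \<in> borel_measurable lebesgue"
      using int unfolding G_def set_integrable_def by blast
    show "(\<lambda>t. indicator {0<..<\<theta>} t *\<^sub>R G t + indicator {\<theta><..<1} t *\<^sub>R G t) \<in> borel_measurable lebesgue"
      using sub unfolding set_integrable_def by (intro borel_measurable_add) blast+
  qed
  also have "\<dots> = (LINT t:{0<..<\<theta>}|lebesgue. G t) + (LINT t:{\<theta><..<1}|lebesgue. G t)"
    unfolding set_lebesgue_integral_def
    using sub unfolding set_integrable_def by (intro Bochner_Integration.integral_add) auto
  also have "(LINT t:{0<..<\<theta>}|lebesgue. G t) \<le> (LINT t:{0<..<\<theta>}|lebesgue. L * (norm (x - \<gamma> 0) / \<theta>))"
  proof (rule set_integral_mono[OF sub(2)])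
    show "set_integrable lebesgue {0<..<\<theta>} (\<lambda>t. L * (norm (x - \<gamma> 0) / \<theta>))"
      unfolding set_integrable_def
      using lmeasurable_box[of 0 \<theta>]
      by (intro integrable_scaleR_left integrable_real_indicator) (auto simp: fmeasurable_def)
    show "G t \<le> L * (norm (x - \<gamma> 0) / \<theta>)" if "t \<in> {0<..<\<theta>}" for t
      using agmon_integrand_prepend_left[OF k, of t V E L x \<gamma>] that L by (simp add: G_def \<theta>_def)
  qed
  also have "\<dots> = L * norm (x - \<gamma> 0)"
    using \<theta> by (simp add: set_lebesgue_integral_def)
  finally show "(LINT t:{0..1}|lebesgue. agmon_integrand V E (prepend_line k x \<gamma>) t)
      \<le> L * norm (x - \<gamma> 0) + (LINT s:{0<..<1}|lebesgue. m s) / k"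
    using right by (simp add: G_def)
qed

text \<open>
  Only one direction of the additivity of the Agmon length under concatenation is needed. The
  integral is \<open>0\<close> by convention for a non-integrable integrand, so one has to know that the
  integrand of \<open>\<gamma>\<close> is measurable once that of the longer path is. Almost everywhere
  differentiability of \<open>\<gamma>\<close> is avoided here: the set where \<open>\<gamma>\<close> is not differentiable is eliminated
  by comparing the concatenations with the speeds \<open>2\<close> and \<open>3\<close>.
\<close>

lemma agmon_metric_le_line:
  fixes \<gamma> :: "real \<Rightarrow> real^'n"
  assumes \<gamma>: "\<gamma> \<in> ac_paths y z" and L: "\<And>x. sqrt (max (V x - E) 0) \<le> L"
  shows "agmon_metric V E x z \<le> L * norm (x - y) + (LINT t:{0..1}|lebesgue. agmon_integrand V E \<gamma> t)"
proof -
  define F where "F = agmon_integrand V E \<gamma>"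
  define G where "G k = agmon_integrand V E (prepend_line k x \<gamma>)" for k
  define m where "m k s = (if \<gamma> differentiable (at s) then k else 1) * F s" for k s
  have y: "\<gamma> 0 = y" using \<gamma> by (simp add: ac_paths_def)
  have L0: "L \<ge> 0" using L[of 0] by (rule order_trans[rotated]) simp
  have nonneg: "0 \<le> (LINT t:{0..1}|lebesgue. agmon_integrand V E \<eta> t)" for \<eta> :: "real \<Rightarrow> real^'n"
    unfolding set_lebesgue_integral_def by (intro integral_nonneg_AE) (auto simp: agmon_integrand_nonneg)
  have bdd: "bdd_below ((\<lambda>\<eta>. LINT t:{0..1}|lebesgue. agmon_integrand V E \<eta> t) ` ac_paths x z)"
    using nonneg by (intro bdd_belowI2[of _ 0]) auto
  have le: "agmon_metric V E x z \<le> (LINT t:{0..1}|lebesgue. G k t)" if "k > 1" for k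
    unfolding agmon_metric_def agmon_integrand_def[symmetric] G_def
    by (rule cINF_lower[OF bdd prepend_line_ac_paths[OF \<gamma> that]])
  consider k where "k \<in> {2, 3}" "\<not> set_integrable lebesgue {0..1} (G k)"
    | "set_integrable lebesgue {0..1} (G 2)" "set_integrable lebesgue {0..1} (G 3)" by blast
  then show ?thesis
  proof cases
    case 1
    \<comment> \<open>Here the convention for non-integrable functions helps: a path of nominal
      length 0 already makes the infimum at most 0.\<close>
    then have "(LINT t:{0..1}|lebesgue. G k t) = 0"
      by (simp add: set_integrable_def set_lebesgue_integral_def not_integrable_integral_eq)
    moreover have "k > 1" using 1 by auto
    ultimately have "agmon_metric V E x z \<le> 0" using le[of k] by simp
    also have "0 \<le> L * norm (x - y) + (LINT t:{0..1}|lebesgue. agmon_integrand V E \<gamma> t)"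
      using L0 nonneg[of \<gamma>] by simp
    finally show ?thesis .
  next
    case 2
    have m: "set_integrable lebesgue {0<..<1} (m 2)" "set_integrable lebesgue {0<..<1} (m 3)"
      using prepend_line_integral(1)[where k=2 and V=V, OF _ L] prepend_line_integral(1)[where k=3 and V=V, OF _ L] 2
      unfolding m_def F_def G_def by simp_all
    have F: "set_integrable lebesgue {0<..<1} F"
    proof -
      \<comment> \<open>The coefficients a = 2 and b = -1 solve 2a + 3b = 1 and a + b = 1, so the
        combination gives \<open>F\<close> both where \<gamma> is differentiable and where it is
        not.\<close>
      have "F = (\<lambda>s. 2 *\<^sub>R m 2 s - m 3 s)" by (auto simp: m_def)
      then show ?thesis using m by (auto intro!: set_integral_diff(1) set_integrable_scaleR_right)
    qed
    have "agmon_metric V E x z \<le> L * norm (x - y) + (LINT s:{0<..<1}|lebesgue. m 2 s) / 2"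
      using prepend_line_integral(2)[where k=2 and V=V and \<gamma>=\<gamma> and x=x, OF _ L] 2 le[of 2]
      unfolding m_def F_def G_def y by linarith
    also have "(LINT s:{0<..<1}|lebesgue. m 2 s) \<le> (LINT s:{0<..<1}|lebesgue. 2 * F s)"
    proof (rule set_integral_mono[OF m(1)])
      show "set_integrable lebesgue {0<..<1} (\<lambda>s. 2 * F s)" using F by simp
      show "m 2 s \<le> 2 * F s" for s
        using agmon_integrand_nonneg[of V E \<gamma> s] by (simp add: m_def F_def)
    qed
    also have "(LINT s:{0<..<1}|lebesgue. 2 * F s) = 2 * (LINT s:{0<..<1}|lebesgue. F s)"
      by simp
    also have "(LINT s:{0<..<1}|lebesgue. F s) = (LINT s:{0..1}|lebesgue. F s)"
      unfolding set_lebesgue_integral_def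
    proof (rule integral_cong_AE)
      have *: "AE t in lebesgue. t \<notin> {0, 1::real}" by (rule AE_lebesgue_notin_finite) simp
      then show ae: "AE t in lebesgue. indicator {0<..<1} t *\<^sub>R F t = indicator {0..1} t *\<^sub>R F t"
        by eventually_elim (auto simp: indicator_def)
      show ms: "(\<lambda>t. indicator {0<..<1} t *\<^sub>R F t) \<in> borel_measurable lebesgue"
        using F unfolding set_integrable_def by blast
      \<comment> \<open>Measurability is known on the open interval only; the two endpoint values
        are added by hand.\<close>
      have "(\<lambda>t. indicator {0..1} t *\<^sub>R F t)
          = (\<lambda>t. indicator {0<..<1} t *\<^sub>R F t + indicator {0} t * F 0 + indicator {1} t * F 1)"
        by (rule ext) (auto simp: indicator_def of_bool_def)
      moreover have "indicator {0} \<in> borel_measurable lebesgue" "indicator {1::real} \<in> borel_measurable lebesgue"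
        by (auto intro!: borel_measurable_indicator)
      ultimately show "(\<lambda>t. indicator {0..1} t *\<^sub>R F t) \<in> borel_measurable lebesgue"
        using ms by (auto intro!: borel_measurable_add borel_measurable_times)
    qed
    finally show ?thesis by (simp add: F_def)
  qed
qed

lemma agmon_dist_le:
  fixes x y :: "real^'n"
  assumes L: "\<And>x. sqrt (max (V x - E) 0) \<le> L"
  shows "agmon_dist V E x \<le> agmon_dist V E y + L * norm (x - y)"
proof -
  have "agmon_metric V E x 0 - L * norm (x - y) \<le> agmon_metric V E y 0"
    unfolding agmon_metric_def[of V E y 0] agmon_integrand_def[symmetric]
    using agmon_metric_le_line[where V=V and x=x and y=y, OF _ L] ac_paths_line[of 0 y]
    by (intro cINF_greatest) force+
  then show ?thesis by (simp add: agmon_dist_def)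
qed

lemma agmon_dist_nonneg: "0 \<le> agmon_dist V E x"
  unfolding agmon_dist_def agmon_metric_def agmon_integrand_def[symmetric] set_lebesgue_integral_def
  using ac_paths_line[of 0 x]
  by (intro cINF_greatest) (auto intro!: integral_nonneg_AE simp: agmon_integrand_nonneg)

text \<open>The derivative of ln \<phi> is \<phi>'/\<phi>, so by the mean value inequality ln \<phi>
  is \<open>B\<close>-Lipschitz on the half-line; exponentiating gives the claim.\<close>

lemma log_lipschitz_weight:
  fixes \<phi> \<phi>' :: "real \<Rightarrow> real"
  assumes deriv: "\<And>t. t \<ge> 0 \<Longrightarrow> (\<phi> has_real_derivative \<phi>' t) (at t within {0..})"
    and pos: "\<And>t. t \<ge> 0 \<Longrightarrow> \<phi> t > 0"
    and B: "\<And>t. t \<ge> 0 \<Longrightarrow> \<bar>\<phi>' t / \<phi> t\<bar> \<le> B"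
    and st: "s \<ge> 0" "t \<ge> 0"
  shows "\<phi> s \<le> exp (B * \<bar>s - t\<bar>) * \<phi> t"
proof -
  have "norm (ln (\<phi> s) - ln (\<phi> t)) \<le> B * norm (s - t)"
  proof (rule field_differentiable_bound[of "{0..}" "\<lambda>t. ln (\<phi> t)" "\<lambda>t. \<phi>' t / \<phi> t"])
    show "((\<lambda>t. ln (\<phi> t)) has_field_derivative \<phi>' r / \<phi> r) (at r within {0..})" if "r \<in> {0..}" for r
      using deriv[of r] pos[of r] that by (auto intro!: derivative_eq_intros)
  qed (use B st in auto)
  then have "ln (\<phi> s) \<le> B * \<bar>s - t\<bar> + ln (\<phi> t)" by (simp add: abs_le_iff)
  then have "exp (ln (\<phi> s)) \<le> exp (B * \<bar>s - t\<bar> + ln (\<phi> t))" by simp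
  then show ?thesis using pos st by (simp add: exp_add)
qed

section \<open>Test functions of product form\<close>

text \<open>The derivative is carried as a witness instead of being named by \<open>deriv\<close>,
  so closure under sums, products and affine substitution goes by induction with existence and
  formula treated together.\<close>

primrec times_differentiable :: "nat \<Rightarrow> (real \<Rightarrow> real) \<Rightarrow> bool" where
  "times_differentiable 0 f \<longleftrightarrow> True"
| "times_differentiable (Suc k) f \<longleftrightarrow>
     (\<exists>f'. (\<forall>x. (f has_real_derivative f' x) (at x)) \<and> times_differentiable k f')"

definition smooth_real :: "(real \<Rightarrow> real) \<Rightarrow> bool" where
  "smooth_real f \<longleftrightarrow> (\<forall>k. times_differentiable k f)"

lemma times_differentiable_Suc_D: "times_differentiable (Suc k) f \<Longrightarrow> times_differentiable k f"
proof (induction k arbitrary: f)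
  case (Suc k)
  then obtain f' where "\<And>x. (f has_real_derivative f' x) (at x)" "times_differentiable (Suc k) f'"
    by (subst (asm) times_differentiable.simps) blast
  then show ?case using Suc.IH[of f'] by auto
qed simp

lemma times_differentiable_add:
  "times_differentiable k f \<Longrightarrow> times_differentiable k g \<Longrightarrow> times_differentiable k (\<lambda>x. f x + g x)"
proof (induction k arbitrary: f g)
  case (Suc k)
  then obtain f' g' where "\<And>x. (f has_real_derivative f' x) (at x)" "times_differentiable k f'"
    "\<And>x. (g has_real_derivative g' x) (at x)" "times_differentiable k g'" by auto
  then show ?case using Suc.IH[of f' g']
    by (auto intro!: exI[of _ "\<lambda>x. f' x + g' x"] derivative_eq_intros)
qed simp

lemma times_differentiable_mult:
  "times_differentiable k f \<Longrightarrow> times_differentiable k g \<Longrightarrow> times_differentiable k (\<lambda>x. f x * g x)"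
proof (induction k arbitrary: f g)
  case (Suc k)
  then obtain f' g' where d: "\<And>x. (f has_real_derivative f' x) (at x)" "times_differentiable k f'"
    "\<And>x. (g has_real_derivative g' x) (at x)" "times_differentiable k g'" by auto
  have "times_differentiable k (\<lambda>x. f x * g' x + f' x * g x)"
    using Suc.IH[of f g'] Suc.IH[of f' g] d(2,4) Suc.prems[THEN times_differentiable_Suc_D]
    by (intro times_differentiable_add) auto
  then show ?case using d(1,3)
    by (auto intro!: exI[of _ "\<lambda>x. f x * g' x + f' x * g x"] derivative_eq_intros)
qed simp

lemma times_differentiable_affine:
  "times_differentiable k f \<Longrightarrow> times_differentiable k (\<lambda>x. f (a + c * x))"
proof (induction k arbitrary: f)
  case (Suc k)
  then obtain f' where d: "\<And>x. (f has_real_derivative f' x) (at x)" "times_differentiable k f'" by auto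
  have "times_differentiable k (\<lambda>x. c)"
    by (induction k arbitrary: c) (auto intro!: exI[of _ "\<lambda>_. 0"] derivative_eq_intros)
  then have "times_differentiable k (\<lambda>x. f' (a + c * x) * c)"
    using Suc.IH[OF d(2)] by (intro times_differentiable_mult)
  moreover have "((\<lambda>x. f (a + c * x)) has_real_derivative f' (a + c * x) * c) (at x)" for x
    by (rule DERIV_chain2[OF d(1)]) (auto intro!: derivative_eq_intros)
  ultimately show ?case
    unfolding times_differentiable.simps by (intro exI[of _ "\<lambda>x. f' (a + c * x) * c"]) blast
qed simp

lemma smooth_real_mult: "smooth_real f \<Longrightarrow> smooth_real g \<Longrightarrow> smooth_real (\<lambda>x. f x * g x)"
  by (simp add: smooth_real_def times_differentiable_mult)

lemma smooth_real_affine: "smooth_real f \<Longrightarrow> smooth_real (\<lambda>x. f (a + c * x))"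
  by (simp add: smooth_real_def times_differentiable_affine)

lemma smooth_real_derivative:
  assumes "smooth_real f"
  shows "smooth_real (deriv f)" "(f has_real_derivative deriv f x) (at x)"
proof -
  have *: "\<exists>f'. (\<forall>x. (f has_real_derivative f' x) (at x)) \<and> times_differentiable k f'" for k
    using assms[unfolded smooth_real_def, rule_format, of "Suc k"] by simp
  have eq: "f' = deriv f" if "\<forall>x. (f has_real_derivative f' x) (at x)" for f'
    using that by (auto intro!: DERIV_imp_deriv[symmetric])
  show "smooth_real (deriv f)" unfolding smooth_real_def using * eq by blast
  show "(f has_real_derivative deriv f x) (at x)" using *[of 0] eq by blast
qed

text \<open>Membership in a family closed under differentiation gives differentiability to every
  order by induction, without any formula for the higher derivatives.\<close>

lemma smooth_real_coinduct:
  assumes "f \<in> S" and "\<And>g. g \<in> S \<Longrightarrow> \<exists>g'\<in>S. \<forall>x. (g has_real_derivative g' x) (at x)"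
  shows "smooth_real f"
proof -
  have "\<forall>g\<in>S. times_differentiable k g" for k
    by (induction k) (use assms(2) in \<open>auto, blast\<close>)
  then show ?thesis using assms(1) by (simp add: smooth_real_def)
qed

lemma smooth_real_continuous: "smooth_real f \<Longrightarrow> continuous_on A f"
  using smooth_real_derivative(2) DERIV_continuous_on by (metis has_field_derivative_at_within)

text \<open>The polynomial parameter enlarges the classical exp(-1/x), extended by zero, to a family
  that is closed under differentiation.\<close>

definition flat :: "real poly \<Rightarrow> real \<Rightarrow> real" where
  "flat p x = (if x > 0 then poly p (1 / x) * exp (- (1 / x)) else 0)"

lemma poly_exp_tendsto_0: "((\<lambda>x. poly p x * exp (- x)) \<longlongrightarrow> 0) at_top" for p :: "real poly"
proof -
  have "((\<lambda>x. \<Sum>i\<le>degree p. coeff p i * (x ^ i / exp x)) \<longlongrightarrow> (\<Sum>i\<le>degree p. coeff p i * 0)) at_top"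
    by (intro tendsto_sum tendsto_mult tendsto_const tendsto_power_div_exp_0)
  then show ?thesis
    by (simp add: poly_altdef exp_minus sum_distrib_right divide_inverse mult.assoc)
qed

text \<open>With y = 1/x, the chain rule turns p(y) exp(-y) into y^2 (p(y) - p'(y)) exp(-y). At 0
  the right difference quotient is y p(y) exp(-y) with y tending to infinity, again a polynomial
  times a decaying exponential.\<close>

lemma flat_has_derivative:
  "(flat p has_real_derivative flat (monom 1 2 * (p - pderiv p)) x) (at x)"
proof (cases x "0 :: real" rule: linorder_cases)
  case greater
  have "((\<lambda>x. poly p (1 / x) * exp (- (1 / x))) has_real_derivative
     flat (monom 1 2 * (p - pderiv p)) x) (at x)"
    using greater by (auto intro!: derivative_eq_intros poly_DERIV[THEN DERIV_chain2]
      simp: flat_def poly_monom field_simps power2_eq_square)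
  then show ?thesis
    by (rule has_field_derivative_transform_within_open[of _ _ _ "{0<..}"])
       (use greater in \<open>auto simp: flat_def\<close>)
next
  case less
  have "((\<lambda>_. 0) has_real_derivative 0) (at x)" by simp
  then have "(flat p has_real_derivative 0) (at x)"
    by (rule has_field_derivative_transform_within_open[of _ _ _ "{..<0}"])
       (use less in \<open>auto simp: flat_def\<close>)
  then show ?thesis using less by (simp add: flat_def)
next
  case equal
  have "((\<lambda>y. flat p y / y) \<longlongrightarrow> 0) (at_right 0)"
  proof -
    have "((\<lambda>y. poly ([:0, 1:] * p) (inverse y) * exp (- inverse y)) \<longlongrightarrow> 0) (at_right 0)"
      by (rule filterlim_compose[OF poly_exp_tendsto_0 filterlim_inverse_at_top_right])
    then show ?thesis
      by (rule Lim_transform_eventually)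
         (auto simp: eventually_at_filter flat_def field_simps)
  qed
  moreover have "((\<lambda>y. flat p y / y) \<longlongrightarrow> 0) (at_left 0)"
    by (rule Lim_transform_eventually[of "\<lambda>_. 0"]) (auto simp: eventually_at_filter flat_def)
  ultimately have "((\<lambda>y. flat p y / y) \<longlongrightarrow> 0) (at 0)"
    by (simp add: filterlim_at_split)
  then show ?thesis
    using equal by (simp add: has_field_derivative_iff flat_def)
qed

text \<open>The factor \<open>exp 1\<close> normalizes each half so that the bump has value 1 at 0;
  the truncations then converge to the untruncated kernel itself.\<close>

definition bump :: "real \<Rightarrow> real" where
  "bump x = flat [:exp 1:] (1 - x) * flat [:exp 1:] (1 + x)"

lemma smooth_flat: "smooth_real (flat p)"
  by (rule smooth_real_coinduct[of _ "range flat"]) (use flat_has_derivative in blast)+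

lemma smooth_bump: "smooth_real bump"
  using smooth_real_mult[OF smooth_real_affine[OF smooth_flat[of "[:exp 1:]"], of 1 "-1"]
      smooth_real_affine[OF smooth_flat[of "[:exp 1:]"], of 1 1]]
  by (simp add: bump_def[abs_def])

lemma bump_0: "bump 0 = 1"
  by (simp add: bump_def flat_def exp_minus)

lemma bump_outside: "\<bar>x\<bar> \<ge> 1 \<Longrightarrow> bump x = 0"
  by (auto simp: bump_def flat_def)

lemma smooth_gaussian: "smooth_real (\<lambda>x. exp (- (c * x\<^sup>2)))"
proof (rule smooth_real_coinduct[of _ "range (\<lambda>p x. poly p x * exp (- (c * x\<^sup>2)))"])
  show "(\<lambda>x. exp (- (c * x\<^sup>2))) \<in> range (\<lambda>p x. poly p x * exp (- (c * x\<^sup>2)))"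
    by (rule image_eqI[of _ _ 1]) auto
  fix g assume "g \<in> range (\<lambda>p x. poly p x * exp (- (c * x\<^sup>2)))"
  then obtain p where g: "g = (\<lambda>x. poly p x * exp (- (c * x\<^sup>2)))" by auto
  have "(g has_real_derivative poly (pderiv p - [:0, 2 * c:] * p) x * exp (- (c * x\<^sup>2))) (at x)" for x
    unfolding g by (auto intro!: derivative_eq_intros poly_DERIV simp: algebra_simps)
  then show "\<exists>g'\<in>range (\<lambda>p x. poly p x * exp (- (c * x\<^sup>2))). \<forall>x. (g has_real_derivative g' x) (at x)"
    by (intro bexI[OF _ rangeI[of _ "pderiv p - [:0, 2 * c:] * p"]]) blast
qed

text \<open>A partial derivative changes a single factor, so this class is closed under
  \<open>partial_deriv\<close> and the conditions of \<open>C_k\<close> reduce to calculus in one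
  variable.\<close>

definition prod_fun :: "('n \<Rightarrow> real \<Rightarrow> real) \<Rightarrow> real^'n \<Rightarrow> real" where
  "prod_fun h x = (\<Prod>i\<in>UNIV. h i (x $ i))"

lemma prod_fun_line:
  "prod_fun h (x + t *\<^sub>R axis i 1) = h i (x $ i + t) * (\<Prod>j\<in>UNIV - {i}. h j (x $ j))"
proof -
  have "prod_fun h (x + t *\<^sub>R axis i 1)
      = h i ((x + t *\<^sub>R axis i 1) $ i) * (\<Prod>j\<in>UNIV - {i}. h j ((x + t *\<^sub>R axis i 1) $ j))"
    unfolding prod_fun_def by (rule prod.remove) auto
  also have "(\<Prod>j\<in>UNIV - {i}. h j ((x + t *\<^sub>R axis i 1) $ j)) = (\<Prod>j\<in>UNIV - {i}. h j (x $ j))"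
    by (intro prod.cong) (auto simp: axis_def)
  finally show ?thesis by (simp add: axis_def)
qed

lemma prod_fun_upd: "prod_fun (h(i := g)) x = g (x $ i) * (\<Prod>j\<in>UNIV - {i}. h j (x $ j))"
  using prod_fun_line[of "h(i := g)" x 0 i] by simp

lemma prod_fun_partial:
  assumes "\<And>x. (h i has_real_derivative h' x) (at x)"
  shows "((\<lambda>t. prod_fun h (x + t *\<^sub>R axis i 1)) has_real_derivative prod_fun (h(i := h')) x) (at 0)"
    and "partial_deriv i (prod_fun h) = prod_fun (h(i := h'))"
proof -
  have *: "((\<lambda>t. prod_fun h (x + t *\<^sub>R axis i 1)) has_real_derivative prod_fun (h(i := h')) x) (at 0)" for x
    unfolding prod_fun_line prod_fun_upd
    by (auto intro!: derivative_eq_intros assms[THEN DERIV_chain2])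
  then show "((\<lambda>t. prod_fun h (x + t *\<^sub>R axis i 1)) has_real_derivative prod_fun (h(i := h')) x) (at 0)" .
  show "partial_deriv i (prod_fun h) = prod_fun (h(i := h'))"
    using * by (intro ext) (simp add: partial_deriv_def DERIV_imp_deriv)
qed

lemma iter_partial_prod_fun:
  assumes "\<And>i. smooth_real (h i)"
  shows "\<exists>h'. (\<forall>i. smooth_real (h' i)) \<and> iter_partial \<alpha> (prod_fun h) = prod_fun h'"
proof (induction \<alpha>)
  case Nil
  then show ?case using assms by auto
next
  case (Cons i \<alpha>)
  then obtain h' where h': "\<And>i. smooth_real (h' i)" "iter_partial \<alpha> (prod_fun h) = prod_fun h'" by auto
  have "iter_partial (i # \<alpha>) (prod_fun h) = prod_fun (h'(i := deriv (h' i)))"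
    using prod_fun_partial(2)[of h' i, OF smooth_real_derivative(2)[OF h'(1)]] h'(2) by simp
  then show ?case using h'(1) smooth_real_derivative(1)[OF h'(1)]
    by (intro exI[of _ "h'(i := deriv (h' i))"] conjI) (simp, assumption)
qed

lemma iter_partial_2_prod_fun:
  assumes "\<And>x. (h i has_real_derivative h' x) (at x)" "\<And>x. (h' has_real_derivative h'' x) (at x)"
  shows "iter_partial [i, i] (prod_fun h) = prod_fun (h(i := h''))"
  using prod_fun_partial(2)[of h i h'] prod_fun_partial(2)[of "h(i := h')" i h''] assms by simp

lemma prod_fun_test_function:
  fixes h :: "'n::finite \<Rightarrow> real \<Rightarrow> real"
  assumes h: "\<And>i. smooth_real (h i)" and supp: "\<And>i t. \<bar>t\<bar> \<ge> R \<Longrightarrow> h i t = 0"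
  shows "prod_fun h \<in> test_functions"
proof -
  have cont: "continuous_on UNIV (iter_partial \<alpha> (prod_fun h))" for \<alpha>
  proof -
    obtain h' where h': "\<And>i. smooth_real (h' i)" "iter_partial \<alpha> (prod_fun h) = prod_fun h'"
      using iter_partial_prod_fun[of h, OF h] by blast
    show ?thesis unfolding h'(2) unfolding prod_fun_def[abs_def]
      by (intro continuous_on_prod continuous_on_compose2[OF smooth_real_continuous[OF h'(1), of UNIV]]
          continuous_intros) auto
  qed
  have diff: "(\<lambda>t. iter_partial \<alpha> (prod_fun h) (x + t *\<^sub>R axis i 1)) field_differentiable at 0" for \<alpha> i x
  proof -
    obtain h' where h': "\<And>i. smooth_real (h' i)" "iter_partial \<alpha> (prod_fun h) = prod_fun h'"
      using iter_partial_prod_fun[of h, OF h] by blast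
    show ?thesis unfolding h'(2) field_differentiable_def
      using prod_fun_partial(1)[of h' i, OF smooth_real_derivative(2)[OF h'(1)]] by blast
  qed
  have "{x. prod_fun h x \<noteq> 0} \<subseteq> cbox (\<chi> i. - R) (\<chi> i. R)"
  proof
    fix x assume "x \<in> {x. prod_fun h x \<noteq> 0}"
    then have "h i (x $ i) \<noteq> 0" for i by (auto simp: prod_fun_def)
    then have "\<bar>x $ i\<bar> < R" for i using supp[of "x $ i" i] by force
    then show "x \<in> cbox (\<chi> i. - R) (\<chi> i. R)"
      by (auto simp: mem_box_cart abs_less_iff intro: less_imp_le) (metis minus_le_iff less_imp_le)
  qed
  then have "compact (closure {x. prod_fun h x \<noteq> 0})"
    using bounded_subset[OF bounded_cbox] by (auto simp: compact_closure)
  then show ?thesis using cont diff by (auto simp: test_functions_def C_k_def)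
qed


lemma deriv_vanishes_outside:
  fixes f :: "real \<Rightarrow> real"
  assumes "\<And>x. \<bar>x\<bar> \<ge> r \<Longrightarrow> f x = 0" "\<bar>x\<bar> > r"
  shows "deriv f x = 0"
proof (rule DERIV_imp_deriv)
  have "((\<lambda>_. 0) has_real_derivative 0) (at x)" by simp
  then show "(f has_real_derivative 0) (at x)"
    by (rule has_field_derivative_transform_within_open[of _ _ _ "{x. \<bar>x\<bar> > r}"])
       (use assms in \<open>auto intro!: open_Collect_less continuous_intros\<close>)
qed

lemma smooth_compact_support_bounded:
  assumes "smooth_real f" "\<And>x. \<bar>x\<bar> \<ge> r \<Longrightarrow> f x = 0"
  shows "\<exists>B. \<forall>x. \<bar>f x\<bar> \<le> B"
proof -
  have "compact (f ` {-r..r})"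
    by (intro compact_continuous_image smooth_real_continuous assms compact_Icc)
  then have "bounded (f ` {-r..r})" by (rule compact_imp_bounded)
  then obtain B where "\<forall>x\<in>{-r..r}. \<bar>f x\<bar> \<le> B" by (auto simp: bounded_iff)
  then have "\<bar>f x\<bar> \<le> max B 0" for x
    using assms(2)[of x] by (cases "x \<in> {-r..r}") (fastforce simp: max_def)+
  then show ?thesis by blast
qed

lemma bump_derivatives_bounded:
  "\<exists>B. \<forall>x. \<bar>bump x\<bar> \<le> B \<and> \<bar>deriv bump x\<bar> \<le> B \<and> \<bar>deriv (deriv bump) x\<bar> \<le> B"
proof -
  have s1: "smooth_real (deriv bump)" using smooth_bump smooth_real_derivative(1) by blast
  then have s2: "smooth_real (deriv (deriv bump))" using smooth_real_derivative(1) by blast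
  \<comment> \<open>The radius is enlarged with each derivative because
    \<open>deriv_vanishes_outside\<close> says nothing at the boundary of the support.\<close>
  have z1: "deriv bump x = 0" if "\<bar>x\<bar> \<ge> 2" for x
    using deriv_vanishes_outside[of 1 bump x] bump_outside that by simp
  then have z2: "deriv (deriv bump) x = 0" if "\<bar>x\<bar> \<ge> 3" for x
    using deriv_vanishes_outside[of 2 "deriv bump" x] that by simp
  obtain B0 B1 B2 where "\<And>x. \<bar>bump x\<bar> \<le> B0" "\<And>x. \<bar>deriv bump x\<bar> \<le> B1" "\<And>x. \<bar>deriv (deriv bump) x\<bar> \<le> B2"
    using smooth_compact_support_bounded[OF smooth_bump bump_outside]
      smooth_compact_support_bounded[OF s1 z1] smooth_compact_support_bounded[OF s2 z2] by meson
  then show ?thesis by (intro exI[of _ "max B0 (max B1 B2)"]) (simp add: le_max_iff_disj)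
qed

section \<open>The heat kernel\<close>

lemma nn_integral_lborel_prod_vec:
  fixes f :: "'n::finite \<Rightarrow> real \<Rightarrow> ennreal"
  assumes [measurable]: "\<And>i. f i \<in> borel_measurable borel"
  shows "(\<integral>\<^sup>+x. (\<Prod>i\<in>UNIV. f i (x $ i)) \<partial>(lborel :: (real^'n) measure)) = (\<Prod>i\<in>UNIV. (\<integral>\<^sup>+s. f i s \<partial>lborel))"
proof -
  have B: "Basis = range (\<lambda>i. axis i (1::real) :: real^'n)" by (auto simp: Basis_vec_def)
  have inj: "inj (\<lambda>i. axis i (1::real) :: real^'n)" by (auto intro!: injI simp: axis_eq_axis)
  \<comment> \<open>\<open>g\<close> transports the family along the bijection between coordinates
    and standard basis vectors.\<close>
  define g where "g b = f (THE i. b = axis i (1::real))" for b :: "real^'n"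
  have g: "g (axis i 1) = f i" for i by (simp add: g_def axis_eq_axis)
  have "(\<integral>\<^sup>+x. (\<Prod>b\<in>Basis. g b (x \<bullet> b)) \<partial>(lborel :: (real^'n) measure)) = (\<Prod>b\<in>Basis. (\<integral>\<^sup>+s. g b s \<partial>lborel))"
    by (rule nn_integral_lborel_prod) (auto simp: g_def)
  then show ?thesis
    unfolding B prod.reindex[OF inj] by (simp add: g o_def inner_axis)
qed

lemma nn_integral_lborel_translate:
  fixes f :: "'a::euclidean_space \<Rightarrow> ennreal"
  assumes [measurable]: "f \<in> borel_measurable borel"
  shows "(\<integral>\<^sup>+x. f (a + x) \<partial>lborel) = (\<integral>\<^sup>+x. f x \<partial>lborel)"
  by (subst (2) lborel_distr_plus[of a, symmetric]) (simp add: nn_integral_distr)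

lemma nn_integral_lborel_reflect:
  fixes f :: "'a::euclidean_space \<Rightarrow> ennreal"
  assumes [measurable]: "f \<in> borel_measurable borel"
  shows "(\<integral>\<^sup>+x. f (a - x) \<partial>lborel) = (\<integral>\<^sup>+x. f x \<partial>lborel)"
  by (subst (2) lborel_affine[of "-1" a]) (simp_all add: nn_integral_density nn_integral_distr)

text \<open>The kernel of the heat semigroup generated by the Laplacian. The normalization (4 pi
  t)^(n/2) is written as a power of a square root so that one root goes to each one-dimensional
  Gaussian.\<close>

definition heat :: "real \<Rightarrow> real^'n \<Rightarrow> real" where
  "heat t z = exp (- (norm z)\<^sup>2 / (4 * t)) / sqrt (4 * pi * t) ^ CARD('n)"

lemma heat_measurable [measurable]:
  assumes [measurable]: "f \<in> borel_measurable N" "g \<in> borel_measurable N"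
  shows "(\<lambda>x. heat (f x) (g x)) \<in> borel_measurable N"
  unfolding heat_def by measurable

lemma heat_nonneg: "t > 0 \<Longrightarrow> 0 \<le> heat t z"
  by (simp add: heat_def)

lemma heat_minus: "heat t (- z) = heat t z"
  by (simp add: heat_def)

lemma heat_commute: "heat t (x - y) = heat t (y - x)"
  by (simp add: heat_def norm_minus_commute)

lemma norm_vec_power2: "(norm z)\<^sup>2 = (\<Sum>i\<in>UNIV. (z $ i)\<^sup>2)" for z :: "real^'n"
  by (simp add: norm_vec_def L2_set_def sum_nonneg)

definition gauss :: "real \<Rightarrow> real \<Rightarrow> real" where
  "gauss t s = exp (- s\<^sup>2 / (4 * t)) / sqrt (4 * pi * t)"

lemma gauss_eq_normal_density: "t > 0 \<Longrightarrow> gauss t = normal_density 0 (sqrt (2 * t))"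
  by (auto simp: gauss_def normal_density_def fun_eq_iff)

lemma gauss_nonneg: "t > 0 \<Longrightarrow> gauss t s \<ge> 0"
  by (simp add: gauss_def)

lemma heat_eq_prod: "heat t z = (\<Prod>i\<in>UNIV. gauss t (z $ i))"
proof -
  have "- (norm z)\<^sup>2 / (4 * t) = (\<Sum>i\<in>UNIV. - (z $ i)\<^sup>2 / (4 * t))"
    by (simp add: norm_vec_power2 sum_divide_distrib sum_negf)
  then show ?thesis
    by (simp add: heat_def gauss_def exp_sum prod_dividef)
qed

lemma ennreal_heat: "t > 0 \<Longrightarrow> ennreal (heat t z) = (\<Prod>i\<in>UNIV. ennreal (gauss t (z $ i)))"
  unfolding heat_eq_prod by (rule prod_ennreal[symmetric]) (simp add: gauss_nonneg)

lemma gauss_measurable [measurable]: "gauss t \<in> borel_measurable borel"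
  unfolding gauss_def[abs_def] by measurable

lemma nn_integral_heat:
  assumes "t > 0"
  shows "(\<integral>\<^sup>+z. heat t z \<partial>(lborel :: (real^'n) measure)) = 1"
proof -
  have "(\<integral>\<^sup>+s. gauss t s \<partial>lborel) = 1"
    using assms by (subst nn_integral_eq_integral)
      (auto simp: gauss_eq_normal_density integrable_normal_density integral_normal_density)
  then show ?thesis
    using assms nn_integral_lborel_prod_vec[of "\<lambda>_ s. ennreal (gauss t s)"] by (simp add: ennreal_heat)
qed

lemma nn_integral_heat_shift:
  "t > 0 \<Longrightarrow> (\<integral>\<^sup>+y. heat t (x - y) \<partial>(lborel :: (real^'n) measure)) = 1"
  using nn_integral_lborel_reflect[of "\<lambda>z. ennreal (heat t z)" x] nn_integral_heat[of t] by simp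

text \<open>After translation by \<open>z\<close> the integral factorizes into one-dimensional
  convolutions of centred normal densities with variances 2s and 2t, and variances add.\<close>

lemma heat_semigroup:
  assumes s: "s > 0" and t: "t > 0"
  shows "(\<integral>\<^sup>+y. ennreal (heat s (x - y)) * ennreal (heat t (y - z)) \<partial>lborel) = heat (s + t) (x - z)"
proof -
  have g: "(\<integral>\<^sup>+r. ennreal (gauss s (a - r)) * ennreal (gauss t r) \<partial>lborel) = gauss (s + t) a" for a
  proof -
    have "(\<integral>\<^sup>+r. ennreal (normal_density 0 (sqrt (2 * s)) (a - r) * normal_density 0 (sqrt (2 * t)) r) \<partial>lborel)
      = normal_density 0 (sqrt ((sqrt (2 * s))\<^sup>2 + (sqrt (2 * t))\<^sup>2)) a"
      using fun_cong[OF conv_normal_density_zero_mean[of "sqrt (2 * s)" "sqrt (2 * t)"]] s t by simp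
    then show ?thesis using s t by (simp add: gauss_eq_normal_density ennreal_mult distrib_left)
  qed
  have "(\<integral>\<^sup>+y. ennreal (heat s (x - y)) * ennreal (heat t (y - z)) \<partial>lborel)
     = (\<integral>\<^sup>+y. ennreal (heat s (x - (z + y))) * ennreal (heat t (z + y - z)) \<partial>lborel)"
    by (rule nn_integral_lborel_translate[symmetric]) measurable
  also have "\<dots> = (\<integral>\<^sup>+y. (\<Prod>i\<in>UNIV. ennreal (gauss s ((x - z) $ i - y $ i)) * ennreal (gauss t (y $ i))) \<partial>lborel)"
    using s t by (simp add: ennreal_heat prod.distrib diff_diff_eq)
  also have "\<dots> = (\<Prod>i\<in>UNIV. (\<integral>\<^sup>+r. ennreal (gauss s ((x - z) $ i - r)) * ennreal (gauss t r) \<partial>lborel))"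
    by (rule nn_integral_lborel_prod_vec) measurable
  also have "\<dots> = ennreal (heat (s + t) (x - z))"
    using s t by (simp only: g ennreal_heat add_pos_pos)
  finally show ?thesis .
qed

section \<open>Comparison of Gaussians of different widths\<close>

lemma heat_le: "t > 0 \<Longrightarrow> heat t (z :: real^'n) \<le> 1 / sqrt (4 * pi * t) ^ CARD('n)"
  unfolding heat_def by (intro divide_right_mono) auto

text \<open>Completing the square gives \<Lambda>|z| \<le> |z|^2/(8t) + 2t \<Lambda>^2. Half of the
  Gaussian exponent absorbs the exponential, the other half is the exponent at time 2t, and the
  power of the quotient exchanges the normalizations.\<close>

lemma heat_weighted_bound:
  fixes z :: "real^'n"
  assumes t: "t > 0"
  shows "heat t z * exp (\<Lambda> * norm z)
    \<le> exp (2 * t * \<Lambda>\<^sup>2) * (sqrt (4 * pi * (2 * t)) / sqrt (4 * pi * t)) ^ CARD('n) * heat (2 * t) z"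
proof -
  have "0 \<le> (norm z - 4 * t * \<Lambda>)\<^sup>2 / (8 * t)" using t by simp
  also have "\<dots> = (norm z)\<^sup>2 / (8 * t) - \<Lambda> * norm z + 2 * t * \<Lambda>\<^sup>2"
    using t by (simp add: power2_diff field_simps power2_eq_square)
  moreover have "(norm z)\<^sup>2 / (4 * t) = 2 * ((norm z)\<^sup>2 / (8 * t))" "(norm z)\<^sup>2 / (4 * (2 * t)) = (norm z)\<^sup>2 / (8 * t)"
    by simp_all
  ultimately have "- (norm z)\<^sup>2 / (4 * t) + \<Lambda> * norm z \<le> 2 * t * \<Lambda>\<^sup>2 - (norm z)\<^sup>2 / (4 * (2 * t))"
    by linarith
  then have "exp (- (norm z)\<^sup>2 / (4 * t)) * exp (\<Lambda> * norm z) \<le> exp (2 * t * \<Lambda>\<^sup>2) * exp (- (norm z)\<^sup>2 / (4 * (2 * t)))"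
    by (simp add: exp_add[symmetric])
  then have "exp (- (norm z)\<^sup>2 / (4 * t)) * exp (\<Lambda> * norm z) / sqrt (4 * pi * t) ^ CARD('n)
      \<le> exp (2 * t * \<Lambda>\<^sup>2) * exp (- (norm z)\<^sup>2 / (4 * (2 * t))) / sqrt (4 * pi * t) ^ CARD('n)"
    using t by (intro divide_right_mono) auto
  then show ?thesis
    using t by (simp add: heat_def power_divide)
qed

text \<open>A single Gaussian dominates the kernels of all times in [s,T] together with a quadratic
  factor: the exponent is estimated at \<open>T\<close>, the normalization at \<open>s\<close>, and
  1 + |z|^2 costs exp(|z|^2/(8T)), which is half of the exponent at \<open>T\<close>.\<close>

lemma heat_moment_bound:
  fixes z :: "real^'n"
  assumes "0 < s" "s \<le> r" "r \<le> T"
  shows "(1 + (norm z)\<^sup>2) * heat r z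
    \<le> max 1 (8 * T) * (sqrt (4 * pi * (2 * T)) / sqrt (4 * pi * s)) ^ CARD('n) * heat (2 * T) z"
proof -
  define q where "q = (norm z)\<^sup>2"
  have q: "q \<ge> 0" by (simp add: q_def)
  have T: "T > 0" using assms by linarith
  have "1 + q \<le> max 1 (8 * T) * (1 + q / (8 * T))"
  proof -
    have "q = 8 * T * (q / (8 * T))" using T by simp
    also have "\<dots> \<le> max 1 (8 * T) * (q / (8 * T))"
      using T q by (intro mult_right_mono) auto
    finally show ?thesis unfolding distrib_left by (intro add_mono) auto
  qed
  also have "\<dots> \<le> max 1 (8 * T) * exp (q / (8 * T))"
    by (intro mult_left_mono exp_ge_add_one_self) auto
  finally have "(1 + q) * exp (- q / (4 * T)) \<le> max 1 (8 * T) * exp (q / (8 * T)) * exp (- q / (4 * T))"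
    by (intro mult_right_mono) auto
  also have "\<dots> = max 1 (8 * T) * exp (- q / (4 * (2 * T)))"
  proof -
    have "q / (8 * T) + - q / (4 * T) = - q / (4 * (2 * T))" using T by (simp add: field_simps)
    then show ?thesis by (simp only: mult.assoc exp_add[symmetric])
  qed
  finally have 1: "(1 + q) * exp (- q / (4 * T)) \<le> max 1 (8 * T) * exp (- q / (4 * (2 * T)))" .
  have "heat r z \<le> exp (- q / (4 * T)) / sqrt (4 * pi * s) ^ CARD('n)"
    unfolding heat_def q_def[symmetric]
  proof (rule frac_le)
    have "q / (4 * T) \<le> q / (4 * r)" using assms q by (intro divide_left_mono) auto
    then show "exp (- q / (4 * r)) \<le> exp (- q / (4 * T))" by simp
    show "sqrt (4 * pi * s) ^ CARD('n) \<le> sqrt (4 * pi * r) ^ CARD('n)"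
      using assms by (intro power_mono real_sqrt_le_mono) auto
  qed (use assms in auto)
  then have "(1 + q) * heat r z \<le> (1 + q) * (exp (- q / (4 * T)) / sqrt (4 * pi * s) ^ CARD('n))"
    using q by (intro mult_left_mono) auto
  also have "\<dots> \<le> max 1 (8 * T) * exp (- q / (4 * (2 * T))) / sqrt (4 * pi * s) ^ CARD('n)"
    using 1 assms by (auto intro!: divide_right_mono)
  also have "\<dots> = max 1 (8 * T) * (sqrt (4 * pi * (2 * T)) / sqrt (4 * pi * s)) ^ CARD('n) * heat (2 * T) z"
    using T by (simp add: heat_def q_def power_divide)
  finally show ?thesis by (simp add: q_def)
qed

text \<open>Gives a majorant independent of \<open>x\<close> in the unit ball around
  \<open>x0\<close>, for the continuity of \<open>heat_conv\<close>. It comes from |x0-y|^2 \<le>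
  2|x-y|^2 + 2|x-x0|^2.\<close>

lemma heat_shift_bound:
  fixes x :: "real^'n"
  assumes t: "t > 0" and x: "norm (x - x0) \<le> 1"
  shows "heat t (x - y)
    \<le> exp (1 / (4 * t)) * (sqrt (4 * pi * (2 * t)) / sqrt (4 * pi * t)) ^ CARD('n) * heat (2 * t) (x0 - y)"
proof -
  have "norm (x0 - y) \<le> norm (x - y) + norm (x - x0)"
    using norm_triangle_ineq4[of "x - y" "x - x0"] by (simp add: algebra_simps)
  then have "(norm (x0 - y))\<^sup>2 \<le> (norm (x - y) + norm (x - x0))\<^sup>2" by (intro power_mono) auto
  also have "\<dots> \<le> 2 * (norm (x - y))\<^sup>2 + 2 * (norm (x - x0))\<^sup>2"
    using sum_squares_bound[of "norm (x - y)" "norm (x - x0)"] by (simp add: power2_sum)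
  also have "(norm (x - x0))\<^sup>2 \<le> 1" using x by (simp add: power_le_one)
  finally have "- (norm (x - y))\<^sup>2 / (4 * t) \<le> 1 / (4 * t) - (norm (x0 - y))\<^sup>2 / (4 * (2 * t))"
    using t by (simp add: field_simps)
  then have "exp (- (norm (x - y))\<^sup>2 / (4 * t)) \<le> exp (1 / (4 * t)) * exp (- (norm (x0 - y))\<^sup>2 / (4 * (2 * t)))"
    by (simp add: exp_add[symmetric])
  then have "exp (- (norm (x - y))\<^sup>2 / (4 * t)) / sqrt (4 * pi * t) ^ CARD('n)
     \<le> exp (1 / (4 * t)) * exp (- (norm (x0 - y))\<^sup>2 / (4 * (2 * t))) / sqrt (4 * pi * t) ^ CARD('n)"
    using t by (intro divide_right_mono) auto
  then show ?thesis using t by (simp add: heat_def power_divide)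
qed

text \<open>The heat equation in one formula: this is the time derivative of the kernel, and it is
  also its Laplacian, in which role it appears as the limit of
  \<open>cutoff_heat_laplacian\<close>.\<close>

definition heat_dt :: "real \<Rightarrow> real^'n \<Rightarrow> real" where
  "heat_dt t z = ((norm z)\<^sup>2 / (4 * t\<^sup>2) - real CARD('n) / (2 * t)) * heat t z"

lemma heat_has_derivative:
  fixes z :: "real^'n"
  assumes "t > 0"
  shows "((\<lambda>t. heat t z) has_real_derivative heat_dt t z) (at t)"
proof -
  let ?N = "CARD('n)"
  have N: "?N > 0" by simp
  have sq: "((\<lambda>t. sqrt (4 * pi * t) ^ ?N) has_real_derivative real ?N / (2 * t) * sqrt (4 * pi * t) ^ ?N) (at t)"
  proof -
    have "pi * t > 0" using assms by simp
    then have "((\<lambda>t. sqrt (4 * pi * t) ^ ?N) has_real_derivative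
       real ?N * (4 * pi * (inverse (sqrt (4 * pi * t)) / 2)) * sqrt (4 * pi * t) ^ (?N - 1)) (at t)"
      using assms by (auto intro!: derivative_eq_intros simp: mult_less_0_iff)
    moreover have "real ?N * (4 * pi * (inverse (sqrt (4 * pi * t)) / 2)) * sqrt (4 * pi * t) ^ (?N - 1)
      = real ?N / (2 * t) * sqrt (4 * pi * t) ^ ?N"
    proof -
      have "sqrt (4 * pi * t) ^ ?N = sqrt (4 * pi * t) * sqrt (4 * pi * t) ^ (?N - 1)"
        using N by (metis Suc_diff_1 power_Suc)
      moreover have "4 * pi * inverse (sqrt (4 * pi * t)) = sqrt (4 * pi * t) / t"
        using assms by (simp add: field_simps flip: real_sqrt_mult)
      moreover have "real ?N * (4 * pi * (inverse (sqrt (4 * pi * t)) / 2)) * q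
        = real ?N / 2 * (4 * pi * inverse (sqrt (4 * pi * t))) * q" for q by simp
      ultimately show ?thesis by simp
    qed
    ultimately show ?thesis by simp
  qed
  have ex: "((\<lambda>t. exp (- (norm z)\<^sup>2 / (4 * t))) has_real_derivative
      (norm z)\<^sup>2 / (4 * t\<^sup>2) * exp (- (norm z)\<^sup>2 / (4 * t))) (at t)"
    using assms by (auto intro!: derivative_eq_intros simp: power2_eq_square field_simps)
  have "((\<lambda>t. heat t z) has_real_derivative
     ((norm z)\<^sup>2 / (4 * t\<^sup>2) * exp (- (norm z)\<^sup>2 / (4 * t)) * sqrt (4 * pi * t) ^ ?N
      - exp (- (norm z)\<^sup>2 / (4 * t)) * (real ?N / (2 * t) * sqrt (4 * pi * t) ^ ?N))
     / (sqrt (4 * pi * t) ^ ?N * sqrt (4 * pi * t) ^ ?N)) (at t)"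
    unfolding heat_def using assms by (intro DERIV_divide ex sq) auto
  moreover have alg: "(A * e * q - e * (B * q)) / (q * q) = (A - B) * (e / q)" if "q \<noteq> 0" for A B e q :: real
    using that by (simp add: field_simps)
  moreover have nz: "sqrt (4 * pi * t) ^ ?N \<noteq> 0" using assms by simp
  ultimately show ?thesis
    unfolding heat_dt_def heat_def alg[OF nz] by blast
qed

lemma heat_dt_bound:
  fixes z :: "real^'n"
  assumes "0 < s" "s \<le> r" "r \<le> T"
  shows "\<bar>heat_dt r z\<bar> \<le> (1 / (4 * s\<^sup>2) + real CARD('n) / (2 * s)) * ((1 + (norm z)\<^sup>2) * heat r z)"
proof -
  have r: "r > 0" using assms by linarith
  have "\<bar>(norm z)\<^sup>2 / (4 * r\<^sup>2) - real CARD('n) / (2 * r)\<bar> \<le> (norm z)\<^sup>2 / (4 * r\<^sup>2) + real CARD('n) / (2 * r)"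
    using r by (intro order_trans[OF abs_triangle_ineq4]) simp
  also have "\<dots> \<le> (norm z)\<^sup>2 / (4 * s\<^sup>2) + real CARD('n) / (2 * s)"
    using assms by (intro add_mono divide_left_mono mult_left_mono power_mono) auto
  also have "\<dots> \<le> (1 / (4 * s\<^sup>2) + real CARD('n) / (2 * s)) * (1 + (norm z)\<^sup>2)"
    using assms by (simp add: distrib_left distrib_right)
  finally show ?thesis
    unfolding heat_dt_def abs_mult mult.assoc[symmetric]
    using heat_nonneg[OF r, of z] by (simp add: mult_right_mono)
qed

section \<open>Compactly supported truncations of the heat kernel\<close>

definition cutoff_gauss :: "real \<Rightarrow> real \<Rightarrow> real \<Rightarrow> real" where
  "cutoff_gauss t R s = bump (s / R) * gauss t s"

text \<open>The second derivative of \<open>cutoff_gauss t R\<close> by the Leibniz rule: the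
  Gaussian has logarithmic derivative -s/(2t), and its second derivative is s^2/(4t^2) - 1/(2t)
  times itself.\<close>

definition cutoff_gauss'' :: "real \<Rightarrow> real \<Rightarrow> real \<Rightarrow> real" where
  "cutoff_gauss'' t R s = (deriv (deriv bump) (s / R) / R\<^sup>2 - 2 * (s / (2 * t)) * deriv bump (s / R) / R
     + (s\<^sup>2 / (4 * t\<^sup>2) - 1 / (2 * t)) * bump (s / R)) * gauss t s"

lemma smooth_cutoff_gauss: "smooth_real (cutoff_gauss t R)"
proof -
  have "smooth_real (\<lambda>s. bump (0 + 1 / R * s))" by (rule smooth_real_affine[OF smooth_bump])
  moreover have "smooth_real (gauss t)"
  proof -
    \<comment> \<open>The normalizing constant is obtained as a smooth function by evaluating
      \<open>flat\<close> at the constant argument 1; the factor \<open>exp 1\<close> cancels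
      exp(-1).\<close>
    have "smooth_real (\<lambda>x. flat [:1 / sqrt (4 * pi * t) * exp 1:] (1 + 0 * x))"
      by (rule smooth_real_affine[OF smooth_flat])
    from smooth_real_mult[OF this smooth_gaussian[of "1 / (4 * t)"]]
    show ?thesis by (simp add: flat_def gauss_def[abs_def] exp_minus)
  qed
  ultimately show ?thesis
    using smooth_real_mult by (force simp: cutoff_gauss_def[abs_def])
qed

lemma cutoff_gauss_has_derivatives:
  assumes R: "R > 0" and t: "t > 0"
  obtains h' where "\<And>s. (cutoff_gauss t R has_real_derivative h' s) (at s)"
    "\<And>s. (h' has_real_derivative cutoff_gauss'' t R s) (at s)"
proof
  have inner: "((\<lambda>s. s / R) has_real_derivative 1 / R) (at s)" for s
    using R by (auto intro!: derivative_eq_intros)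
  have b: "((\<lambda>s. bump (s / R)) has_real_derivative deriv bump (s / R) * (1 / R)) (at s)"
    "((\<lambda>s. deriv bump (s / R)) has_real_derivative deriv (deriv bump) (s / R) * (1 / R)) (at s)" for s
    by (rule DERIV_chain2[OF smooth_real_derivative(2)[OF smooth_bump] inner],
        rule DERIV_chain2[OF smooth_real_derivative(2)[OF smooth_real_derivative(1)[OF smooth_bump]] inner])
  have g: "(gauss t has_real_derivative - (s / (2 * t)) * gauss t s) (at s)" for s
  proof -
    have "((\<lambda>s. exp (- s\<^sup>2 / (4 * t))) has_real_derivative - (s / (2 * t)) * exp (- s\<^sup>2 / (4 * t))) (at s)"
      using t by (auto intro!: derivative_eq_intros)
    from DERIV_cdivide[OF this, of "sqrt (4 * pi * t)"] show ?thesis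
      by (simp add: gauss_def[abs_def])
  qed
  show "(cutoff_gauss t R has_real_derivative
      (deriv bump (s / R) / R - s / (2 * t) * bump (s / R)) * gauss t s) (at s)" for s
    unfolding cutoff_gauss_def
    by (rule derivative_eq_intros b g refl)+ (simp add: algebra_simps)
  show "((\<lambda>s. (deriv bump (s / R) / R - s / (2 * t) * bump (s / R)) * gauss t s) has_real_derivative
      cutoff_gauss'' t R s) (at s)" for s
  proof -
    have l: "((\<lambda>s. s / (2 * t)) has_real_derivative 1 / (2 * t)) (at s)"
      using t by (auto intro!: derivative_eq_intros)
    show ?thesis
      unfolding cutoff_gauss''_def
      by (rule DERIV_cong[OF DERIV_mult[OF DERIV_diff[OF DERIV_cdivide[OF b(2)] DERIV_mult[OF l b(1)]] g]])
        (use R t in \<open>simp add: algebra_simps power2_eq_square add_divide_distrib diff_divide_distrib\<close>)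
  qed
qed

text \<open>Each derivative that falls on the bump brings a factor 1/R \<le> 1, so the bounds are
  uniform in \<open>R\<close> and can serve as majorants; the powers of \<open>s\<close> from the
  Gaussian are collected in 1 + s^2.\<close>

lemma cutoff_gauss_bound:
  assumes t: "t > 0" and B: "\<And>x. \<bar>bump x\<bar> \<le> B" "\<And>x. \<bar>deriv bump x\<bar> \<le> B" "\<And>x. \<bar>deriv (deriv bump) x\<bar> \<le> B"
    and R: "R \<ge> 1"
  shows "\<bar>cutoff_gauss t R s\<bar> \<le> B * gauss t s"
    and "\<bar>cutoff_gauss'' t R s\<bar> \<le> B * (1 + 1 / t + (1 / (4 * t\<^sup>2) + 1 / (2 * t))) * ((1 + s\<^sup>2) * gauss t s)"
proof -
  have g: "gauss t s \<ge> 0" using gauss_nonneg[OF t] .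
  show "\<bar>cutoff_gauss t R s\<bar> \<le> B * gauss t s"
    unfolding cutoff_gauss_def abs_mult using B(1) g by (simp add: mult_right_mono)
  have B0: "B \<ge> 0" using B(1)[of 0] by linarith
  have s: "1 \<le> 1 + s\<^sup>2" "\<bar>s\<bar> \<le> 1 + s\<^sup>2" "s\<^sup>2 \<le> 1 + s\<^sup>2"
  proof -
    have "0 \<le> (\<bar>s\<bar> - 1)\<^sup>2" by simp
    then have "2 * \<bar>s\<bar> \<le> s\<^sup>2 + 1" by (simp add: power2_diff)
    then show "\<bar>s\<bar> \<le> 1 + s\<^sup>2" by linarith
  qed auto
  have 1: "\<bar>deriv (deriv bump) (s / R) / R\<^sup>2\<bar> \<le> B * (1 + s\<^sup>2)"
  proof -
    have "\<bar>deriv (deriv bump) (s / R) / R\<^sup>2\<bar> \<le> B / 1"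
      unfolding abs_divide using B(3)[of "s / R"] R B0 by (intro frac_le) auto
    also have "\<dots> \<le> B * (1 + s\<^sup>2)" using B0 s(1) by (simp add: distrib_left)
    finally show ?thesis .
  qed
  have 2: "\<bar>2 * (s / (2 * t)) * deriv bump (s / R) / R\<bar> \<le> B * (1 / t) * (1 + s\<^sup>2)"
  proof -
    have "\<bar>2 * (s / (2 * t)) * deriv bump (s / R) / R\<bar> \<le> \<bar>2 * (s / (2 * t)) * deriv bump (s / R)\<bar> / 1"
      unfolding abs_divide using R by (intro divide_left_mono) auto
    also have "\<dots> = (\<bar>s\<bar> / t) * \<bar>deriv bump (s / R)\<bar>" using t by (simp add: abs_mult)
    also have "\<dots> \<le> ((1 + s\<^sup>2) / t) * B"
      using B(2)[of "s / R"] s t by (intro mult_mono divide_right_mono) auto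
    finally show ?thesis by (simp add: mult.commute)
  qed
  have 3: "\<bar>(s\<^sup>2 / (4 * t\<^sup>2) - 1 / (2 * t)) * bump (s / R)\<bar> \<le> B * (1 / (4 * t\<^sup>2) + 1 / (2 * t)) * (1 + s\<^sup>2)"
  proof -
    have "\<bar>s\<^sup>2 / (4 * t\<^sup>2) - 1 / (2 * t)\<bar> \<le> s\<^sup>2 / (4 * t\<^sup>2) + 1 / (2 * t)"
      using t by (intro order_trans[OF abs_triangle_ineq4]) simp
    also have "\<dots> \<le> (1 / (4 * t\<^sup>2) + 1 / (2 * t)) * (1 + s\<^sup>2)"
      using t by (simp add: distrib_left distrib_right)
    finally have "\<bar>(s\<^sup>2 / (4 * t\<^sup>2) - 1 / (2 * t)) * bump (s / R)\<bar> \<le> ((1 / (4 * t\<^sup>2) + 1 / (2 * t)) * (1 + s\<^sup>2)) * B"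
      unfolding abs_mult using B(1)[of "s / R"] t by (intro mult_mono) auto
    then show ?thesis by (simp add: mult_ac)
  qed
  have "\<bar>deriv (deriv bump) (s / R) / R\<^sup>2 - 2 * (s / (2 * t)) * deriv bump (s / R) / R
     + (s\<^sup>2 / (4 * t\<^sup>2) - 1 / (2 * t)) * bump (s / R)\<bar>
     \<le> B * (1 + s\<^sup>2) + B * (1 / t) * (1 + s\<^sup>2) + B * (1 / (4 * t\<^sup>2) + 1 / (2 * t)) * (1 + s\<^sup>2)"
    using 1 2 3 by linarith
  also have "\<dots> = B * (1 + 1 / t + (1 / (4 * t\<^sup>2) + 1 / (2 * t))) * (1 + s\<^sup>2)"
    by (simp add: distrib_left distrib_right)
  finally show "\<bar>cutoff_gauss'' t R s\<bar> \<le> B * (1 + 1 / t + (1 / (4 * t\<^sup>2) + 1 / (2 * t))) * ((1 + s\<^sup>2) * gauss t s)"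
    unfolding cutoff_gauss''_def abs_mult mult.assoc[symmetric] using g by (simp add: mult_right_mono)
qed

lemma cutoff_gauss_tendsto:
  "((\<lambda>R. cutoff_gauss t R s) \<longlongrightarrow> gauss t s) at_top"
  "((\<lambda>R. cutoff_gauss'' t R s) \<longlongrightarrow> (s\<^sup>2 / (4 * t\<^sup>2) - 1 / (2 * t)) * gauss t s) at_top"
proof -
  have inv: "((\<lambda>R. c / R) \<longlongrightarrow> 0) at_top" for c :: real by real_asymp
  have cont: "isCont bump 0" "isCont (deriv bump) 0" "isCont (deriv (deriv bump)) 0"
    using smooth_bump smooth_real_derivative by (blast intro: DERIV_isCont)+
  have b: "((\<lambda>R. f (s / R)) \<longlongrightarrow> f 0) at_top" if "isCont f 0" for f :: "real \<Rightarrow> real"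
    using isCont_tendsto_compose[OF that inv] .
  have "((\<lambda>R. cutoff_gauss t R s) \<longlongrightarrow> bump 0 * gauss t s) at_top"
    unfolding cutoff_gauss_def by (intro tendsto_intros b cont)
  then show "((\<lambda>R. cutoff_gauss t R s) \<longlongrightarrow> gauss t s) at_top" by (simp add: bump_0)
  have "((\<lambda>R. (deriv (deriv bump) (s / R) * (1 / R) * (1 / R) - 2 * (s / (2 * t)) * deriv bump (s / R) * (1 / R)
     + (s\<^sup>2 / (4 * t\<^sup>2) - 1 / (2 * t)) * bump (s / R)) * gauss t s)
     \<longlongrightarrow> (deriv (deriv bump) 0 * 0 * 0 - 2 * (s / (2 * t)) * deriv bump 0 * 0
     + (s\<^sup>2 / (4 * t\<^sup>2) - 1 / (2 * t)) * bump 0) * gauss t s) at_top"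
    by (intro tendsto_intros b cont inv)
  then show "((\<lambda>R. cutoff_gauss'' t R s) \<longlongrightarrow> (s\<^sup>2 / (4 * t\<^sup>2) - 1 / (2 * t)) * gauss t s) at_top"
    by (simp add: cutoff_gauss''_def[abs_def] bump_0 power2_eq_square field_simps)
qed

text \<open>The cutoff is applied coordinate by coordinate, to a cube instead of a ball, so that the
  truncated kernel is still a product.\<close>

definition cutoff_heat :: "real \<Rightarrow> real \<Rightarrow> real^'n \<Rightarrow> real" where
  "cutoff_heat t R z = (\<Prod>i\<in>UNIV. cutoff_gauss t R (z $ i))"

definition cutoff_heat_laplacian :: "real \<Rightarrow> real \<Rightarrow> real^'n \<Rightarrow> real" where
  "cutoff_heat_laplacian t R z =
     (\<Sum>i\<in>UNIV. cutoff_gauss'' t R (z $ i) * (\<Prod>j\<in>UNIV - {i}. cutoff_gauss t R (z $ j)))"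

lemma cutoff_heat_test_function:
  fixes x :: "real^'n"
  assumes R: "R > 0" and t: "t > 0"
  shows "(\<lambda>y. cutoff_heat t R (x - y)) \<in> test_functions"
    and "(\<Sum>i\<in>UNIV. iter_partial [i, i] (\<lambda>y. cutoff_heat t R (x - y)) y) = cutoff_heat_laplacian t R (x - y)"
proof -
  define h where "h i s = cutoff_gauss t R (x $ i - s)" for i s
  have eq: "(\<lambda>y. cutoff_heat t R (x - y)) = prod_fun h"
    by (auto simp: cutoff_heat_def prod_fun_def h_def)
  have "smooth_real (\<lambda>s. cutoff_gauss t R (x $ i + -1 * s))" for i
    by (rule smooth_real_affine[OF smooth_cutoff_gauss])
  moreover have "h i s = 0" if "\<bar>s\<bar> \<ge> norm x + R" for i s
  proof -
    have "R \<le> \<bar>x $ i - s\<bar>" using component_le_norm_cart[of x i] that by linarith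
    then have "1 \<le> \<bar>(x $ i - s) / R\<bar>" using R by (simp add: abs_divide le_divide_eq_1)
    then show ?thesis by (simp add: h_def cutoff_gauss_def bump_outside)
  qed
  ultimately show "(\<lambda>y. cutoff_heat t R (x - y)) \<in> test_functions"
    unfolding eq by (intro prod_fun_test_function[of h "norm x + R"]) (auto simp: h_def[abs_def])
  obtain h' where h': "\<And>s. (cutoff_gauss t R has_real_derivative h' s) (at s)"
    "\<And>s. (h' has_real_derivative cutoff_gauss'' t R s) (at s)"
    using cutoff_gauss_has_derivatives[OF R t] by blast
  have d: "iter_partial [i, i] (prod_fun h) = prod_fun (h(i := \<lambda>s. cutoff_gauss'' t R (x $ i - s)))" for i
  proof (rule iter_partial_2_prod_fun)
    have inner: "((\<lambda>s. x $ i - s) has_real_derivative - 1) (at s)" for s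
      by (auto intro!: derivative_eq_intros)
    show "(h i has_real_derivative - h' (x $ i - s)) (at s)" for s
      unfolding h_def using DERIV_chain2[OF h'(1) inner] by simp
    show "((\<lambda>s. - h' (x $ i - s)) has_real_derivative cutoff_gauss'' t R (x $ i - s)) (at s)" for s
      using DERIV_minus[OF DERIV_chain2[OF h'(2) inner]] by simp
  qed
  show "(\<Sum>i\<in>UNIV. iter_partial [i, i] (\<lambda>y. cutoff_heat t R (x - y)) y) = cutoff_heat_laplacian t R (x - y)"
    unfolding eq d prod_fun_upd by (simp add: cutoff_heat_laplacian_def h_def)
qed

lemma cutoff_heat_tendsto:
  fixes z :: "real^'n"
  assumes "t > 0"
  shows "((\<lambda>R. cutoff_heat t R z) \<longlongrightarrow> heat t z) at_top"
    and "((\<lambda>R. cutoff_heat_laplacian t R z) \<longlongrightarrow> heat_dt t z) at_top"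
proof -
  show "((\<lambda>R. cutoff_heat t R z) \<longlongrightarrow> heat t z) at_top"
    unfolding cutoff_heat_def heat_eq_prod by (intro tendsto_prod cutoff_gauss_tendsto)
  have "((\<lambda>R. cutoff_heat_laplacian t R z) \<longlongrightarrow>
     (\<Sum>i\<in>UNIV. (((z $ i)\<^sup>2 / (4 * t\<^sup>2) - 1 / (2 * t)) * gauss t (z $ i)) * (\<Prod>j\<in>UNIV - {i}. gauss t (z $ j)))) at_top"
    unfolding cutoff_heat_laplacian_def by (intro tendsto_sum tendsto_mult tendsto_prod cutoff_gauss_tendsto)
  also have "(\<Sum>i\<in>UNIV. (((z $ i)\<^sup>2 / (4 * t\<^sup>2) - 1 / (2 * t)) * gauss t (z $ i)) * (\<Prod>j\<in>UNIV - {i}. gauss t (z $ j)))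
     = (\<Sum>i\<in>UNIV. ((z $ i)\<^sup>2 / (4 * t\<^sup>2) - 1 / (2 * t)) * heat t z)"
    unfolding heat_eq_prod
  proof (intro sum.cong refl)
    fix i :: 'n
    show "((z $ i)\<^sup>2 / (4 * t\<^sup>2) - 1 / (2 * t)) * gauss t (z $ i) * (\<Prod>j\<in>UNIV - {i}. gauss t (z $ j))
      = ((z $ i)\<^sup>2 / (4 * t\<^sup>2) - 1 / (2 * t)) * (\<Prod>j\<in>UNIV. gauss t (z $ j))"
      by (simp only: prod.remove[of UNIV i "\<lambda>i. gauss t (z $ i)"] finite UNIV_I mult.assoc)
  qed
  also have "\<dots> = heat_dt t z"
    by (simp add: heat_dt_def sum_distrib_right[symmetric] sum_subtractf sum_divide_distrib[symmetric] norm_vec_power2)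
  finally show "((\<lambda>R. cutoff_heat_laplacian t R z) \<longlongrightarrow> heat_dt t z) at_top" .
qed

text \<open>The integrable majorant for letting \<open>R\<close> tend to infinity. In each term of
  the Laplacian only one coordinate carries a quadratic factor, which is at most 1 + |z|^2 and is
  absorbed by widening the Gaussian.\<close>

lemma cutoff_heat_bound:
  assumes t: "t > 0"
  obtains C where "C \<ge> 0" "\<And>R (z :: real^'n). R \<ge> 1 \<Longrightarrow> \<bar>cutoff_heat t R z\<bar> \<le> C * heat (2 * t) z"
    "\<And>R (z :: real^'n). R \<ge> 1 \<Longrightarrow> \<bar>cutoff_heat_laplacian t R z\<bar> \<le> C * heat (2 * t) z"
proof -
  obtain B where B: "\<And>x. \<bar>bump x\<bar> \<le> B" "\<And>x. \<bar>deriv bump x\<bar> \<le> B" "\<And>x. \<bar>deriv (deriv bump) x\<bar> \<le> B"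
    using bump_derivatives_bounded by blast
  have B0: "B \<ge> 0" using B(1)[of 0] by linarith
  define D where "D = B * (1 + 1 / t + (1 / (4 * t\<^sup>2) + 1 / (2 * t)))"
  have D0: "D \<ge> 0" using B0 t by (simp add: D_def)
  define K where "K = max 1 (8 * t) * (sqrt (4 * pi * (2 * t)) / sqrt (4 * pi * t)) ^ CARD('n)"
  have K: "(1 + (norm z)\<^sup>2) * heat t z \<le> K * heat (2 * t) z" for z :: "real^'n"
    using heat_moment_bound[of t t t z] t by (simp add: K_def)
  have hK: "heat t z \<le> K * heat (2 * t) z" for z :: "real^'n"
    using K[of z] mult_right_mono[of 1 "1 + (norm z)\<^sup>2" "heat t z"] heat_nonneg[OF t, of z] by simp
  have K0: "K \<ge> 0" using t by (simp add: K_def)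
  have h0: "0 \<le> heat (2 * t) z" for z :: "real^'n" using heat_nonneg[of "2 * t"] t by simp
  have "\<bar>cutoff_heat t R z\<bar> \<le> (B ^ CARD('n) * K) * heat (2 * t) z" if R: "R \<ge> 1" for R and z :: "real^'n"
  proof -
    have "\<bar>cutoff_heat t R z\<bar> \<le> (\<Prod>i\<in>UNIV. B * gauss t (z $ i))"
      unfolding cutoff_heat_def abs_prod by (intro prod_mono conjI abs_ge_zero cutoff_gauss_bound(1)[OF t B R])
    also have "\<dots> = B ^ CARD('n) * heat t z" by (simp add: prod.distrib heat_eq_prod)
    also have "\<dots> \<le> B ^ CARD('n) * (K * heat (2 * t) z)" by (intro mult_left_mono hK) (simp add: B0)
    finally show ?thesis by (simp add: mult.assoc)
  qed
  moreover have "\<bar>cutoff_heat_laplacian t R z\<bar> \<le> (real CARD('n) * (D * B ^ (CARD('n) - 1)) * K) * heat (2 * t) z"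
    if R: "R \<ge> 1" for R and z :: "real^'n"
  proof -
    have "\<bar>cutoff_heat_laplacian t R z\<bar> \<le> (\<Sum>i\<in>(UNIV :: 'n set). (D * B ^ (CARD('n) - 1)) * ((1 + (norm z)\<^sup>2) * heat t z))"
      unfolding cutoff_heat_laplacian_def
    proof (rule order_trans[OF sum_abs], rule sum_mono)
      fix i :: 'n
      have zi: "(z $ i)\<^sup>2 \<le> (norm z)\<^sup>2" using component_le_norm_cart[of z i] by (simp add: abs_le_square_iff[symmetric])
      have "\<bar>cutoff_gauss'' t R (z $ i) * (\<Prod>j\<in>UNIV - {i}. cutoff_gauss t R (z $ j))\<bar>
         \<le> (D * ((1 + (norm z)\<^sup>2) * gauss t (z $ i))) * (\<Prod>j\<in>UNIV - {i}. B * gauss t (z $ j))"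
        unfolding abs_mult abs_prod
      proof (intro mult_mono prod_mono conjI abs_ge_zero cutoff_gauss_bound(1)[OF t B R] prod_nonneg)
        have "\<bar>cutoff_gauss'' t R (z $ i)\<bar> \<le> D * ((1 + (z $ i)\<^sup>2) * gauss t (z $ i))"
          unfolding D_def by (rule cutoff_gauss_bound(2)[OF t B R])
        also have "\<dots> \<le> D * ((1 + (norm z)\<^sup>2) * gauss t (z $ i))"
          using D0 zi gauss_nonneg[OF t] by (intro mult_left_mono mult_right_mono) auto
        finally show "\<bar>cutoff_gauss'' t R (z $ i)\<bar> \<le> D * ((1 + (norm z)\<^sup>2) * gauss t (z $ i))" .
        show "0 \<le> D * ((1 + (norm z)\<^sup>2) * gauss t (z $ i))"
          using D0 gauss_nonneg[OF t] by simp
      qed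
      also have "\<dots> = (D * B ^ (CARD('n) - 1)) * ((1 + (norm z)\<^sup>2) * heat t z)"
        by (simp add: heat_eq_prod prod.remove[of UNIV i] prod.distrib card_Diff_singleton mult_ac)
      finally show "\<bar>cutoff_gauss'' t R (z $ i) * (\<Prod>j\<in>UNIV - {i}. cutoff_gauss t R (z $ j))\<bar>
         \<le> (D * B ^ (CARD('n) - 1)) * ((1 + (norm z)\<^sup>2) * heat t z)" .
    qed
    also have "\<dots> = real CARD('n) * (D * B ^ (CARD('n) - 1)) * ((1 + (norm z)\<^sup>2) * heat t z)" by simp
    also have "\<dots> \<le> real CARD('n) * (D * B ^ (CARD('n) - 1)) * (K * heat (2 * t) z)"
      by (intro mult_left_mono K) (simp add: B0 D0)
    finally show ?thesis by (simp add: mult.assoc)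
  qed
  moreover have "0 \<le> B ^ CARD('n) * K" "0 \<le> real CARD('n) * (D * B ^ (CARD('n) - 1)) * K"
    using B0 D0 K0 by auto
  ultimately show ?thesis
    using h0 by (intro that[of "max (B ^ CARD('n) * K) (real CARD('n) * (D * B ^ (CARD('n) - 1)) * K)"])
      (fastforce intro: order_trans[OF _ mult_right_mono])+
qed

text \<open>Open boxes form an intersection-stable generator of the Borel sets, so vanishing
  integrals spread from boxes to all Borel sets by Dynkin induction. This is done inside one fixed
  box, where \<open>f\<close> is integrable; countably many boxes then exhaust the space.\<close>

lemma AE_zero_of_box_integrals:
  fixes f :: "'a::euclidean_space \<Rightarrow> 'b::{banach, second_countable_topology}"
  assumes int: "\<And>a b. set_integrable lborel (box a b) f"
    and zero: "\<And>a b. (LINT x:box a b|lborel. f x) = 0"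
  shows "AE x in lborel. f x = 0"
proof -
  have "AE x in lborel. indicator (box a b) x *\<^sub>R f x = 0" for a b
  proof (rule sigma_finite_measure.density_zero[OF sigma_finite_lborel])
    let ?g = "\<lambda>x. indicator (box a b) x *\<^sub>R f x"
    show g: "integrable lborel ?g" using int[of a b] by (simp add: set_integrable_def)
    fix A :: "'a set" assume "A \<in> sets lborel"
    then have A: "A \<in> sigma_sets UNIV (range (\<lambda>(a, b). box a b))"
      by (simp add: borel_eq_box)
    have "Int_stable (range (\<lambda>(a, b). box a b :: 'a set))"
      by (auto simp: Int_stable_def box_Int_box)
    moreover have "range (\<lambda>(a, b). box a b :: 'a set) \<subseteq> Pow UNIV" by auto
    ultimately show "(LINT x:A|lborel. ?g x) = 0"
      using A
    proof (induction rule: sigma_sets_induct_disjoint)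
      case (basic A)
      then obtain c d where "A = box c d" by auto
      then obtain p q where pq: "A \<inter> box a b = box p q" by (auto simp: box_Int_box)
      have "(LINT x:A|lborel. ?g x) = (LINT x:box p q|lborel. f x)"
        unfolding set_lebesgue_integral_def pq[symmetric] by (simp add: indicator_inter_arith mult.commute)
      then show ?case using zero by simp
    next
      case empty
      then show ?case by (simp add: set_lebesgue_integral_def)
    next
      case (compl A)
      then have A: "A \<in> sets lborel" by (simp add: borel_eq_box)
      have "(LINT x:UNIV - A|lborel. ?g x) = (LINT x:UNIV|lborel. ?g x) - (LINT x:A|lborel. ?g x)"
      proof -
        have "(LINT x:UNIV|lborel. ?g x) = (LINT x:A|lborel. ?g x) + (LINT x:UNIV - A|lborel. ?g x)"
          using A g set_integral_Un[of A "UNIV - A" lborel ?g]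
          by (simp add: set_integrable_def integrable_mult_indicator del: scaleR_scaleR)
        then show ?thesis by simp
      qed
      also have "(LINT x:UNIV|lborel. ?g x) = 0"
        using zero[of a b] by (simp add: set_lebesgue_integral_def)
      finally show ?case using compl.IH by simp
    next
      case (union A)
      have A: "A i \<in> sets lborel" for i using union(2) by (auto simp: borel_eq_box)
      have "(LINT x:(\<Union>i. A i)|lborel. ?g x) = (\<Sum>i. (LINT x:A i|lborel. ?g x))"
      proof (rule lebesgue_integral_countable_add)
        show "set_integrable lborel (\<Union>i. A i) ?g"
          using A g by (simp add: set_integrable_def integrable_mult_indicator del: scaleR_scaleR)
      qed (use A union(1) in \<open>auto simp: disjoint_family_on_def\<close>)
      then show ?case using union.IH by simp
    qed
  qed
  then have "AE x in lborel. \<forall>k::nat. indicator (box (- real k *\<^sub>R One) (real k *\<^sub>R One)) x *\<^sub>R f x = 0"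
    by (subst AE_all_countable) auto
  then show ?thesis
  proof eventually_elim
    case (elim x)
    have "x \<in> (\<Union>k::nat. box (- (real k *\<^sub>R One)) (real k *\<^sub>R One))"
      unfolding UN_box_eq_UNIV by simp
    then obtain k :: nat where "x \<in> box (- real k *\<^sub>R One) (real k *\<^sub>R One)"
      by auto
    then show ?case using elim[rule_format, of k] by simp
  qed
qed

section \<open>The heat semigroup acting on functions\<close>

definition heat_avg :: "real \<Rightarrow> (real^'n \<Rightarrow> ennreal) \<Rightarrow> real^'n \<Rightarrow> ennreal" where
  "heat_avg t f x = (\<integral>\<^sup>+y. ennreal (heat t (x - y)) * f y \<partial>lborel)"

text \<open>The complex counterpart of \<open>heat_avg\<close>. Estimates are made for
  \<open>heat_avg\<close>, whose values may be infinite and for which Tonelli and monotonicity need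
  no integrability; the Duhamel formula, which involves cancellation, needs
  \<open>heat_conv\<close>.\<close>

definition heat_conv :: "real \<Rightarrow> (real^'n \<Rightarrow> complex) \<Rightarrow> real^'n \<Rightarrow> complex" where
  "heat_conv t f x = (LINT y|lborel. heat t (x - y) *\<^sub>R f y)"

lemma heat_avg_measurable [measurable]:
  assumes [measurable]: "f \<in> borel_measurable borel" "g \<in> borel_measurable N" "h \<in> borel_measurable N"
  shows "(\<lambda>w. heat_avg (g w) f (h w)) \<in> borel_measurable N"
  unfolding heat_avg_def by measurable

lemma heat_conv_measurable [measurable]:
  assumes [measurable]: "f \<in> borel_measurable borel" "g \<in> borel_measurable N" "h \<in> borel_measurable N"
  shows "(\<lambda>w. heat_conv (g w) f (h w)) \<in> borel_measurable N"
  unfolding heat_conv_def by measurable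

lemma heat_avg_semigroup:
  assumes [measurable]: "f \<in> borel_measurable borel" and s: "s > 0" and t: "t > 0"
  shows "heat_avg s (heat_avg t f) x = heat_avg (s + t) f x"
proof -
  have "heat_avg s (heat_avg t f) x
     = (\<integral>\<^sup>+y. \<integral>\<^sup>+z. ennreal (heat s (x - y)) * (ennreal (heat t (y - z)) * f z) \<partial>lborel \<partial>lborel)"
    unfolding heat_avg_def by (intro nn_integral_cong nn_integral_cmult[symmetric]) measurable
  also have "\<dots> = (\<integral>\<^sup>+z. \<integral>\<^sup>+y. ennreal (heat s (x - y)) * (ennreal (heat t (y - z)) * f z) \<partial>lborel \<partial>lborel)"
    by (rule lborel_pair.Fubini') measurable
  also have "\<dots> = (\<integral>\<^sup>+z. (\<integral>\<^sup>+y. ennreal (heat s (x - y)) * ennreal (heat t (y - z)) \<partial>lborel) * f z \<partial>lborel)"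
    by (subst nn_integral_multc[symmetric]) (simp_all add: mult.assoc)
  also have "\<dots> = heat_avg (s + t) f x"
    unfolding heat_semigroup[OF s t] heat_avg_def ..
  finally show ?thesis .
qed

lemma heat_avg_mono_AE:
  assumes "AE y in lborel. f y \<le> g y"
  shows "heat_avg t f x \<le> heat_avg t g x"
  unfolding heat_avg_def
proof (rule nn_integral_mono_AE)
  show "AE y in lborel. ennreal (heat t (x - y)) * f y \<le> ennreal (heat t (x - y)) * g y"
    using assms by eventually_elim (rule mult_left_mono, auto)
qed

lemma heat_avg_const: "t > 0 \<Longrightarrow> heat_avg t (\<lambda>_. c) x = c"
  unfolding heat_avg_def by (subst nn_integral_multc) (simp_all add: nn_integral_heat_shift)

text \<open>A substitute for Cauchy-Schwarz: for the kernel h one has h f \<le> h^2 + f^2, and h^2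
  is at most the supremum of h times h, which has mass 1. The bound is uniform in
  \<open>x\<close>.\<close>

lemma heat_avg_L2_bound:
  fixes f :: "real^'n \<Rightarrow> real"
  assumes [measurable]: "f \<in> borel_measurable borel" and t: "t > 0" and f: "\<And>y. f y \<ge> 0"
  shows "heat_avg t (\<lambda>y. ennreal (f y)) x
    \<le> ennreal (1 / sqrt (4 * pi * t) ^ CARD('n)) + (\<integral>\<^sup>+y. ennreal ((f y)\<^sup>2) \<partial>lborel)"
proof -
  let ?c = "1 / sqrt (4 * pi * t) ^ CARD('n)"
  have c: "?c \<ge> 0" using t by simp
  have "heat_avg t (\<lambda>y. ennreal (f y)) x
    \<le> (\<integral>\<^sup>+y. ennreal ?c * ennreal (heat t (x - y)) + ennreal ((f y)\<^sup>2) \<partial>lborel)"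
    unfolding heat_avg_def
  proof (rule nn_integral_mono)
    fix y
    let ?h = "heat t (x - y)"
    have h: "?h \<ge> 0" by (rule heat_nonneg[OF t])
    have "?h * f y \<le> ?h * ?h + f y * f y"
    proof (cases "?h \<le> f y")
      case True
      then have "?h * f y \<le> f y * f y" using f by (intro mult_right_mono) auto
      then show ?thesis using h by (simp add: add_increasing)
    next
      case False
      then have "?h * f y \<le> ?h * ?h" using h by (intro mult_left_mono) auto
      then show ?thesis by (simp add: add_increasing2)
    qed
    also have "?h * ?h \<le> ?c * ?h" using heat_le[OF t, of "x - y"] h by (intro mult_right_mono) auto
    finally have "ennreal (?h * f y) \<le> ennreal (?c * ?h + (f y)\<^sup>2)"
      by (intro ennreal_leI) (simp add: power2_eq_square)
    then show "ennreal ?h * ennreal (f y) \<le> ennreal ?c * ennreal ?h + ennreal ((f y)\<^sup>2)"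
      using h f c by (simp add: ennreal_mult'[symmetric] ennreal_plus[symmetric] del: ennreal_plus)
  qed
  also have "\<dots> = ennreal ?c + (\<integral>\<^sup>+y. ennreal ((f y)\<^sup>2) \<partial>lborel)"
    using t by (simp add: nn_integral_add nn_integral_cmult nn_integral_heat_shift)
  finally show ?thesis .
qed

lemma heat_conv_integrable:
  fixes f :: "real^'n \<Rightarrow> complex"
  assumes [measurable]: "f \<in> borel_measurable borel" and t: "t > 0"
    and f: "(\<integral>\<^sup>+y. ennreal ((norm (f y))\<^sup>2) \<partial>lborel) < \<infinity>"
  shows "integrable lborel (\<lambda>y. heat t (x - y) *\<^sub>R f y)"
proof (rule integrableI_bounded)
  have "(\<integral>\<^sup>+y. ennreal (norm (heat t (x - y) *\<^sub>R f y)) \<partial>lborel) = heat_avg t (\<lambda>y. ennreal (norm (f y))) x"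
    unfolding heat_avg_def by (simp add: ennreal_mult abs_of_nonneg heat_nonneg[OF t])
  also have "\<dots> < \<infinity>"
    using heat_avg_L2_bound[of "\<lambda>y. norm (f y)" t x] f t by (simp add: ennreal_add_less_top le_less_trans)
  finally show "(\<integral>\<^sup>+y. ennreal (norm (heat t (x - y) *\<^sub>R f y)) \<partial>lborel) < \<infinity>" .
qed measurable

lemma norm_heat_conv_le:
  assumes [measurable]: "f \<in> borel_measurable borel" and t: "t > 0"
  shows "ennreal (norm (heat_conv t f x)) \<le> heat_avg t (\<lambda>y. ennreal (norm (f y))) x"
proof (cases "integrable lborel (\<lambda>y. heat t (x - y) *\<^sub>R f y)")
  case True
  have "ennreal (norm (heat_conv t f x)) \<le> (\<integral>\<^sup>+y. ennreal (norm (heat t (x - y) *\<^sub>R f y)) \<partial>lborel)"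
    unfolding heat_conv_def by (rule integral_norm_bound_ennreal[OF True])
  then show ?thesis
    unfolding heat_avg_def by (simp add: ennreal_mult abs_of_nonneg heat_nonneg[OF t])
next
  case False
  then show ?thesis by (simp add: heat_conv_def not_integrable_integral_eq)
qed

lemma continuous_on_heat_conv:
  fixes f :: "real^'n \<Rightarrow> complex"
  assumes [measurable]: "f \<in> borel_measurable borel" and t: "t > 0"
    and f: "(\<integral>\<^sup>+y. ennreal ((norm (f y))\<^sup>2) \<partial>lborel) < \<infinity>"
  shows "continuous_on UNIV (heat_conv t f)"
proof (intro continuous_at_imp_continuous_on ballI)
  fix x0 :: "real^'n"
  define C where "C = exp (1 / (4 * t)) * (sqrt (4 * pi * (2 * t)) / sqrt (4 * pi * t)) ^ CARD('n)"
  show "isCont (heat_conv t f) x0"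
    unfolding continuous_at_sequentially comp_def
  proof (intro allI impI)
    fix X assume X: "X \<longlonglongrightarrow> x0"
    then obtain k0 where k0: "norm (X k - x0) \<le> 1" if "k \<ge> k0" for k
      unfolding LIMSEQ_iff by (meson less_imp_le zero_less_one)
    have "(\<lambda>k. heat_conv t f (X (k + k0))) \<longlonglongrightarrow> heat_conv t f x0"
      unfolding heat_conv_def
    proof (rule integral_dominated_convergence[where w = "\<lambda>y. norm (C *\<^sub>R (heat (2 * t) (x0 - y) *\<^sub>R f y))"])
      show "integrable lborel (\<lambda>y. norm (C *\<^sub>R (heat (2 * t) (x0 - y) *\<^sub>R f y)))"
        using t by (intro integrable_norm integrable_scaleR_right heat_conv_integrable f) auto
      show "AE y in lborel. norm (heat t (X (k + k0) - y) *\<^sub>R f y) \<le> norm (C *\<^sub>R (heat (2 * t) (x0 - y) *\<^sub>R f y))" for k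
      proof (intro AE_I2)
        fix y
        have "heat t (X (k + k0) - y) \<le> C * heat (2 * t) (x0 - y)"
          unfolding C_def using heat_shift_bound[OF t k0, of "k + k0" y] by simp
        moreover have "0 \<le> heat t (X (k + k0) - y)" "0 \<le> heat (2 * t) (x0 - y)" "0 \<le> C"
          using t by (auto intro!: heat_nonneg simp: C_def)
        ultimately show "norm (heat t (X (k + k0) - y) *\<^sub>R f y) \<le> norm (C *\<^sub>R (heat (2 * t) (x0 - y) *\<^sub>R f y))"
          by (simp add: mult.assoc[symmetric] mult_right_mono)
      qed
      have "(\<lambda>k. X (k + k0)) \<longlonglongrightarrow> x0" using X by (rule LIMSEQ_ignore_initial_segment)
      then show "AE y in lborel. (\<lambda>k. heat t (X (k + k0) - y) *\<^sub>R f y) \<longlonglongrightarrow> heat t (x0 - y) *\<^sub>R f y"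
        unfolding heat_def using t by (intro AE_I2 tendsto_intros) auto
    qed measurable
    then show "(\<lambda>k. heat_conv t f (X k)) \<longlonglongrightarrow> heat_conv t f x0"
      by (rule LIMSEQ_offset)
  qed
qed

section \<open>The heat kernel as an approximate identity\<close>

lemma heat_tail_bound:
  fixes z :: "real^'n"
  assumes t: "t > 0" and \<delta>: "\<delta> \<ge> 0" "norm z \<ge> \<delta>"
  shows "heat t z \<le> sqrt 2 ^ CARD('n) * exp (- (\<delta>\<^sup>2 / (8 * t))) * heat (2 * t) z"
proof -
  have "\<delta>\<^sup>2 \<le> (norm z)\<^sup>2" using \<delta> by (intro power_mono) auto
  then have "\<delta>\<^sup>2 / (8 * t) \<le> (norm z)\<^sup>2 / (8 * t)" using t by (intro divide_right_mono) auto
  \<comment> \<open>One half of the exponent yields the small factor, the other half is the exponent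
    of \<open>heat (2 * t)\<close> and keeps the bound integrable.\<close>
  moreover have "(norm z)\<^sup>2 / (4 * t) = 2 * ((norm z)\<^sup>2 / (8 * t))" by simp
  ultimately have "- (norm z)\<^sup>2 / (4 * t) \<le> - (\<delta>\<^sup>2 / (8 * t)) + - (norm z)\<^sup>2 / (8 * t)" by simp
  then have "exp (- (norm z)\<^sup>2 / (4 * t)) \<le> exp (- (\<delta>\<^sup>2 / (8 * t))) * exp (- (norm z)\<^sup>2 / (8 * t))"
    by (simp add: exp_add[symmetric])
  then have "exp (- (norm z)\<^sup>2 / (4 * t)) / sqrt (4 * pi * t) ^ CARD('n)
     \<le> exp (- (\<delta>\<^sup>2 / (8 * t))) * exp (- (norm z)\<^sup>2 / (8 * t)) / sqrt (4 * pi * t) ^ CARD('n)"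
    using t by (intro divide_right_mono) auto
  moreover have "heat (2 * t) z = exp (- (norm z)\<^sup>2 / (8 * t)) / (sqrt 2 ^ CARD('n) * sqrt (4 * pi * t) ^ CARD('n))"
  proof -
    have "sqrt (4 * pi * (2 * t)) = sqrt 2 * sqrt (4 * pi * t)"
      unfolding real_sqrt_mult[symmetric] by (simp add: mult_ac)
    then show ?thesis unfolding heat_def by (simp add: power_mult_distrib)
  qed
  ultimately show ?thesis by (simp add: heat_def[of t])
qed

text \<open>Off the frontier the indicator is constant on some ball of radius \<delta>, and the
  kernel has mass 1, so the error is at most the mass outside that ball, which is of order
  exp(-\<delta>^2/(8s)).\<close>

lemma heat_indicator_tendsto:
  fixes y :: "real^'n"
  assumes [measurable]: "S \<in> sets borel" and y: "y \<notin> frontier S"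
    and s: "\<And>k::nat. s k > 0" "s \<longlonglongrightarrow> 0"
  shows "(\<lambda>k. (LINT x|lborel. heat (s k) (x - y) * indicator S x)) \<longlonglongrightarrow> indicator S y"
proof -
  have int: "integrable lborel (\<lambda>x. heat t (x - y))" and one: "(LINT x|lborel. heat t (x - y)) = 1" if "t > 0" for t
  proof -
    have *: "(\<integral>\<^sup>+x. ennreal (heat t (x - y)) \<partial>lborel) = 1"
      using nn_integral_heat_shift[OF that, of y] by (simp add: heat_commute)
    then show "integrable lborel (\<lambda>x. heat t (x - y))"
      by (intro integrableI_bounded) (auto simp: heat_nonneg[OF that] abs_of_nonneg)
    show "(LINT x|lborel. heat t (x - y)) = 1"
      using * by (subst integral_eq_nn_integral) (auto simp: heat_nonneg[OF that])
  qed
  obtain \<delta> where \<delta>: "\<delta> > 0" "\<And>x. norm (x - y) < \<delta> \<Longrightarrow> indicator S x = (indicator S y :: real)"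
  proof -
    from y consider "y \<in> interior S" | "y \<in> - closure S" by (auto simp: frontier_def)
    then show ?thesis
    proof cases
      case 1
      then obtain d where "d > 0" "ball y d \<subseteq> S" by (auto simp: mem_interior)
      then show ?thesis using 1 interior_subset
        by (intro that[of d]) (auto simp: dist_norm norm_minus_commute indicator_def)
    next
      case 2
      then obtain d where "d > 0" "ball y d \<subseteq> - closure S"
        using open_Compl[OF closed_closure, of S] by (auto simp: open_contains_ball)
      then show ?thesis using closure_subset[of S] 2
        by (intro that[of d]) (auto simp: dist_norm norm_minus_commute indicator_def subset_iff)
    qed
  qed
  let ?b = "\<lambda>k. sqrt 2 ^ CARD('n) * exp (- (\<delta>\<^sup>2 / (8 * s k)))"
  have bound: "norm ((LINT x|lborel. heat (s k) (x - y) * indicator S x) - indicator S y) \<le> ?b k" for k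
  proof -
    have sk: "s k > 0" "2 * s k > 0" using s(1) by auto
    have i: "integrable lborel (\<lambda>x. heat (s k) (x - y) * indicator S x)"
      using int[OF sk(1)] by (rule Bochner_Integration.integrable_bound)
        (auto simp: indicator_def)
    have "(LINT x|lborel. heat (s k) (x - y) * indicator S x) - indicator S y
        = (LINT x|lborel. heat (s k) (x - y) * indicator S x) - (LINT x|lborel. heat (s k) (x - y) * indicator S y)"
      using one[OF sk(1)] by simp
    also have "\<dots> = (LINT x|lborel. heat (s k) (x - y) * indicator S x - heat (s k) (x - y) * indicator S y)"
      using i int[OF sk(1)] by (subst Bochner_Integration.integral_diff) auto
    also have "norm \<dots> \<le> (LINT x|lborel. ?b k * heat (2 * s k) (x - y))"
    proof (rule Bochner_Integration.integral_norm_bound_integral)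
      fix x
      show "norm (heat (s k) (x - y) * indicator S x - heat (s k) (x - y) * indicator S y) \<le> ?b k * heat (2 * s k) (x - y)"
      proof (cases "norm (x - y) < \<delta>")
        case True
        then have "(indicator S x :: real) = indicator S y" by (rule \<delta>(2))
        then show ?thesis using heat_nonneg[OF sk(2), of "x - y"] by simp
      next
        case False
        have "norm (heat (s k) (x - y) * indicator S x - heat (s k) (x - y) * indicator S y)
          = heat (s k) (x - y) * \<bar>indicator S x - indicator S y\<bar>"
          using heat_nonneg[OF sk(1), of "x - y"] by (simp add: right_diff_distrib[symmetric] abs_mult)
        also have "\<dots> \<le> heat (s k) (x - y) * 1"
          using heat_nonneg[OF sk(1), of "x - y"] by (intro mult_left_mono) (auto simp: indicator_def)
        also have "\<dots> \<le> ?b k * heat (2 * s k) (x - y)"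
          using heat_tail_bound[OF sk(1), of \<delta> "x - y"] False \<delta>(1) by simp
        finally show ?thesis .
      qed
    qed (use i int[OF sk(1)] int[OF sk(2)] in auto)
    also have "\<dots> = ?b k" using one[OF sk(2)] by simp
    finally show ?thesis .
  qed
  have "((\<lambda>t. exp (- (\<delta>\<^sup>2 / (8 * t)))) \<longlongrightarrow> 0) (at_right 0)"
    using \<delta>(1) by real_asymp
  moreover have "s k \<noteq> 0" for k using s(1)[of k] by simp
  then have "filterlim s (at_right 0) sequentially"
    using s by (auto simp: filterlim_at)
  ultimately have "(\<lambda>k. exp (- (\<delta>\<^sup>2 / (8 * s k)))) \<longlonglongrightarrow> 0"
    by (rule filterlim_compose)
  then have "?b \<longlonglongrightarrow> 0" by (rule tendsto_mult_right_zero)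
  then have "(\<lambda>k. (LINT x|lborel. heat (s k) (x - y) * indicator S x) - indicator S y) \<longlonglongrightarrow> 0"
    by (rule Lim_null_comparison[rotated]) (use bound in auto)
  then show ?thesis by (simp add: LIM_zero_iff)
qed

text \<open>Dominating the indicator by a Gaussian turns integrals over bounded sets into heat
  averages, to which the semigroup law applies.\<close>

lemma indicator_le_heat:
  fixes S :: "(real^'n) set"
  assumes "bounded S"
  obtains c where "c \<ge> 0" "\<And>x. indicator S x \<le> c * heat 1 x"
proof -
  obtain r where r: "r > 0" "\<And>x. x \<in> S \<Longrightarrow> norm x \<le> r"
    using assms by (auto simp: bounded_pos)
  define m where "m = exp (- r\<^sup>2 / 4) / sqrt (4 * pi) ^ CARD('n)"
  have m: "m > 0" by (simp add: m_def)
  have "m \<le> heat 1 x" if "x \<in> S" for x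
    unfolding m_def heat_def using r(2)[OF that] by (auto intro!: divide_right_mono power_mono)
  then show ?thesis
    using m heat_nonneg[of 1]
    by (intro that[of "1 / m"]) (auto simp: indicator_def field_simps)
qed

text \<open>Fubini moves the kernel from \<open>f\<close>, which has no regularity, to the indicator
  of \<open>S\<close>, where convergence is pointwise off the null frontier. The majorant is the
  heat flow of c times \<open>heat 1\<close>, by the semigroup law a kernel at a time in
  [1,2].\<close>

lemma heat_conv_tendsto_weakly:
  fixes f :: "real^'n \<Rightarrow> complex"
  assumes [measurable]: "f \<in> borel_measurable borel"
    and f: "(\<integral>\<^sup>+y. ennreal ((norm (f y))\<^sup>2) \<partial>lborel) < \<infinity>"
    and S [measurable]: "S \<in> sets borel" and bdd: "bounded S" and fr: "frontier S \<in> null_sets lborel"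
    and s: "\<And>k::nat. s k > 0" "\<And>k. s k \<le> 1" "s \<longlonglongrightarrow> 0"
  shows "(\<lambda>k. LINT x:S|lborel. heat_conv (s k) f x) \<longlonglongrightarrow> (LINT x:S|lborel. f x)"
proof -
  obtain c where c: "c \<ge> 0" "\<And>x. indicator S x \<le> c * heat 1 x"
    using indicator_le_heat[OF bdd] by blast
  \<comment> \<open>The constant of \<open>heat_moment_bound\<close> for times between 1 and 2,
    which also explains the time 4 = 2 * 2 of the majorant.\<close>
  define K where "K = max 1 (8 * 2) * (sqrt (4 * pi * (2 * 2)) / sqrt (4 * pi * 1)) ^ CARD('n)"
  have K0: "K \<ge> 0" by (simp add: K_def)
  have K: "heat r z \<le> K * heat 4 z" if "1 \<le> r" "r \<le> 2" for r and z :: "real^'n"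
  proof -
    have "heat r z \<le> (1 + (norm z)\<^sup>2) * heat r z"
      using heat_nonneg[of r z] that by (simp add: distrib_right)
    also have "\<dots> \<le> K * heat (2 * 2) z" unfolding K_def by (rule heat_moment_bound) (use that in auto)
    finally show ?thesis by simp
  qed
  define g where "g k y = (LINT x|lborel. heat (s k) (x - y) * indicator S x)" for k and y :: "real^'n"
  have h0: "0 \<le> heat (s k) z" for k and z :: "real^'n" by (rule heat_nonneg[OF s(1)])
  have g_nn: "(\<integral>\<^sup>+x. ennreal (heat (s k) (x - y) * indicator S x) \<partial>lborel) \<le> ennreal (c * K * heat 4 y)" for k y
  proof -
    have "(\<integral>\<^sup>+x. ennreal (heat (s k) (x - y) * indicator S x) \<partial>lborel)
       \<le> (\<integral>\<^sup>+x. ennreal c * (ennreal (heat (s k) (y - x)) * ennreal (heat 1 (x - 0))) \<partial>lborel)"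
    proof (rule nn_integral_mono)
      fix x
      have "heat (s k) (x - y) * indicator S x \<le> heat (s k) (x - y) * (c * heat 1 x)"
        by (intro mult_left_mono c h0)
      then show "ennreal (heat (s k) (x - y) * indicator S x)
        \<le> ennreal c * (ennreal (heat (s k) (y - x)) * ennreal (heat 1 (x - 0)))"
        using c(1) h0[of k "y - x"] heat_nonneg[of 1 x]
        by (simp add: ennreal_mult'[symmetric] heat_commute[of _ x y] mult_ac ennreal_leI)
    qed
    also have "\<dots> = ennreal c * ennreal (heat (s k + 1) y)"
      using heat_semigroup[OF s(1), of 1 k y 0] by (simp add: nn_integral_cmult)
    also have "\<dots> \<le> ennreal (c * K * heat 4 y)"
      using K[of "s k + 1" y] s(1)[of k] s(2)[of k] c(1) K0
      by (simp add: ennreal_mult'[symmetric] mult.assoc mult_left_mono ennreal_leI)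
    finally show ?thesis .
  qed
  have g_bound: "0 \<le> g k y" "g k y \<le> c * K * heat 4 y" for k y
  proof -
    show "0 \<le> g k y" unfolding g_def by (intro integral_nonneg_AE AE_I2) (simp add: h0)
    have "0 \<le> c * K * heat 4 y" using c(1) K0 heat_nonneg[of 4 y] by simp
    then show "g k y \<le> c * K * heat 4 y"
      unfolding g_def using g_nn[of k y]
      by (subst integral_eq_nn_integral) (auto simp: h0 intro!: enn2real_leI)
  qed
  have meas[measurable]: "(\<lambda>y. g k y) \<in> borel_measurable borel" for k
    unfolding g_def by measurable
  have eq: "(LINT x:S|lborel. heat_conv (s k) f x) = (LINT y|lborel. g k y *\<^sub>R f y)" for k
  proof -
    define F where "F x y = (heat (s k) (x - y) * indicator S x) *\<^sub>R f y" for x y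
    have [measurable]: "case_prod F \<in> borel_measurable (lborel \<Otimes>\<^sub>M lborel)"
      unfolding F_def by measurable
    have int: "integrable (lborel \<Otimes>\<^sub>M lborel) (case_prod F)"
    proof (rule integrableI_bounded)
      have "(\<integral>\<^sup>+p. ennreal (norm (case_prod F p)) \<partial>(lborel \<Otimes>\<^sub>M lborel))
         = (\<integral>\<^sup>+y. \<integral>\<^sup>+x. ennreal (norm (F x y)) \<partial>lborel \<partial>lborel)"
        by (subst lborel_pair.nn_integral_snd[symmetric]) auto
      also have "\<dots> \<le> (\<integral>\<^sup>+y. ennreal (norm ((c * K) *\<^sub>R (heat 4 (0 - y) *\<^sub>R f y))) \<partial>lborel)"
      proof (rule nn_integral_mono)
        fix y
        have "(\<integral>\<^sup>+x. ennreal (norm (F x y)) \<partial>lborel)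
          = (\<integral>\<^sup>+x. ennreal (heat (s k) (x - y) * indicator S x) * ennreal (norm (f y)) \<partial>lborel)"
          by (intro nn_integral_cong) (simp add: F_def h0 abs_of_nonneg ennreal_mult)
        also have "\<dots> = (\<integral>\<^sup>+x. ennreal (heat (s k) (x - y) * indicator S x) \<partial>lborel) * ennreal (norm (f y))"
          by (rule nn_integral_multc) measurable
        also have "\<dots> \<le> ennreal (c * K * heat 4 y) * ennreal (norm (f y))"
          by (intro mult_right_mono g_nn) simp
        also have "\<dots> = ennreal (norm ((c * K) *\<^sub>R (heat 4 (0 - y) *\<^sub>R f y)))"
          using c(1) K0 heat_nonneg[of 4 y] by (simp add: ennreal_mult'[symmetric] heat_minus mult_ac)
        finally show "(\<integral>\<^sup>+x. ennreal (norm (F x y)) \<partial>lborel) \<le> ennreal (norm ((c * K) *\<^sub>R (heat 4 (0 - y) *\<^sub>R f y)))" .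
      qed
      also have "\<dots> < \<infinity>"
        using integrable_scaleR_right[OF heat_conv_integrable[of f 4 0, OF _ _ f], of "c * K"]
        unfolding integrable_iff_bounded by simp
      finally show "(\<integral>\<^sup>+p. ennreal (norm (case_prod F p)) \<partial>(lborel \<Otimes>\<^sub>M lborel)) < \<infinity>" .
    qed measurable
    have "(LINT x:S|lborel. heat_conv (s k) f x) = (LINT x|lborel. LINT y|lborel. F x y)"
      unfolding set_lebesgue_integral_def heat_conv_def F_def
      by (intro Bochner_Integration.integral_cong refl)
        (subst Bochner_Integration.integral_scaleR_right[symmetric], simp add: mult.commute)
    also have "\<dots> = (LINT y|lborel. LINT x|lborel. F x y)"
      by (rule lborel_pair.Fubini_integral[OF int, symmetric])
    also have "\<dots> = (LINT y|lborel. g k y *\<^sub>R f y)"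
      unfolding F_def g_def
    proof (intro Bochner_Integration.integral_cong refl integral_scaleR_left)
      show "integrable lborel (\<lambda>x. heat (s k) (x - y) * indicator S x)" for y
        using g_nn[of k y] by (intro integrableI_bounded) (auto simp: h0 abs_of_nonneg intro: le_less_trans)
    qed
    finally show ?thesis .
  qed
  have "(\<lambda>k. LINT y|lborel. g k y *\<^sub>R f y) \<longlonglongrightarrow> (LINT y|lborel. indicator S y *\<^sub>R f y)"
  proof (rule integral_dominated_convergence[where w = "\<lambda>y. norm ((c * K) *\<^sub>R (heat 4 (0 - y) *\<^sub>R f y))"])
    show "integrable lborel (\<lambda>y. norm ((c * K) *\<^sub>R (heat 4 (0 - y) *\<^sub>R f y)))"
      using heat_conv_integrable[of f 4 0, OF _ _ f] by (intro integrable_norm integrable_scaleR_right) simp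
    have "AE y in lborel. y \<notin> frontier S" using fr by (rule AE_not_in)
    then show "AE y in lborel. (\<lambda>k. g k y *\<^sub>R f y) \<longlonglongrightarrow> indicator S y *\<^sub>R f y"
    proof eventually_elim
      case (elim y)
      then show ?case
        unfolding g_def by (intro tendsto_intros heat_indicator_tendsto S s)
    qed
    show "AE y in lborel. norm (g k y *\<^sub>R f y) \<le> norm ((c * K) *\<^sub>R (heat 4 (0 - y) *\<^sub>R f y))" for k
    proof (intro AE_I2)
      fix y
      have "norm (g k y *\<^sub>R f y) \<le> (c * K * heat 4 y) * norm (f y)"
        using g_bound[of k y] by (simp add: mult_right_mono)
      then show "norm (g k y *\<^sub>R f y) \<le> norm ((c * K) *\<^sub>R (heat 4 (0 - y) *\<^sub>R f y))"
        using c(1) K0 heat_nonneg[of 4 y] by (simp add: heat_minus mult.assoc)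
    qed
  qed measurable
  then show ?thesis unfolding eq unfolding set_lebesgue_integral_def .
qed

section \<open>Solutions with a bounded potential\<close>

lemma norm_integral_le_nn_integral:
  fixes g :: "'a \<Rightarrow> 'b::{banach, second_countable_topology}"
  shows "ennreal (norm (integral\<^sup>L N g)) \<le> (\<integral>\<^sup>+x. ennreal (norm (g x)) \<partial>N)"
  by (cases "integrable N g") (auto simp: integral_norm_bound_ennreal not_integrable_integral_eq)

lemma frontier_box_null: "frontier (box a b) \<in> null_sets lborel" for a b :: "'a::euclidean_space"
proof -
  have "negligible (frontier (box a b))" by (rule negligible_convex_frontier) (rule convex_box)
  then have "frontier (box a b) \<in> null_sets lebesgue" by (simp add: negligible_iff_null_sets)
  then show ?thesis by (simp add: null_sets_completion_iff)
qed

text \<open>The equation \<Delta>u = Wu with both derivatives on the test function. \<open>u\<close>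
  is a Borel representative, so that Fubini over \<open>lborel\<close> and joint measurability in
  time and space are available.\<close>

locale bounded_potential =
  fixes u :: "real^'n \<Rightarrow> complex" and W :: "real^'n \<Rightarrow> real" and M :: real
  assumes u_meas [measurable]: "u \<in> borel_measurable borel"
    and u_L2: "(\<integral>\<^sup>+x. ennreal ((norm (u x))\<^sup>2) \<partial>lborel) < \<infinity>"
    and W_meas [measurable]: "W \<in> borel_measurable borel"
    and W_bound: "\<And>x. \<bar>W x\<bar> \<le> M"
    and M_pos: "M > 0"
    and weak: "\<And>\<eta>. \<eta> \<in> test_functions \<Longrightarrow>
      (LINT y|lborel. (\<Sum>i\<in>UNIV. iter_partial [i, i] \<eta> y) *\<^sub>R u y) = (LINT y|lborel. \<eta> y *\<^sub>R (W y *\<^sub>R u y))"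
begin

abbreviation Wu :: "real^'n \<Rightarrow> complex" where "Wu y \<equiv> W y *\<^sub>R u y"

abbreviation avg :: "real \<Rightarrow> real^'n \<Rightarrow> ennreal" where "avg t \<equiv> heat_avg t (\<lambda>y. ennreal (norm (u y)))"

lemma Wu_le: "norm (Wu y) \<le> M * norm (u y)"
  using W_bound[of y] by (simp add: mult_right_mono)

lemma Wu_L2: "(\<integral>\<^sup>+x. ennreal ((norm (Wu x))\<^sup>2) \<partial>lborel) < \<infinity>"
proof -
  have "(\<integral>\<^sup>+x. ennreal ((norm (Wu x))\<^sup>2) \<partial>lborel) \<le> (\<integral>\<^sup>+x. ennreal (M\<^sup>2) * ennreal ((norm (u x))\<^sup>2) \<partial>lborel)"
  proof (intro nn_integral_mono)
    fix x
    have "(norm (Wu x))\<^sup>2 \<le> (M * norm (u x))\<^sup>2" by (intro power_mono Wu_le) simp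
    then show "ennreal ((norm (Wu x))\<^sup>2) \<le> ennreal (M\<^sup>2) * ennreal ((norm (u x))\<^sup>2)"
      by (simp add: ennreal_mult'[symmetric] power_mult_distrib ennreal_leI)
  qed
  also have "\<dots> = ennreal (M\<^sup>2) * (\<integral>\<^sup>+x. ennreal ((norm (u x))\<^sup>2) \<partial>lborel)"
    by (rule nn_integral_cmult) measurable
  also have "\<dots> < \<infinity>" using u_L2 by (simp add: ennreal_mult_less_top)
  finally show ?thesis .
qed

text \<open>The weak equation with the heat kernel itself as test function. Its truncations are
  admissible, and dominated convergence removes the cutoff on both sides.\<close>

lemma heat_dt_integral:
  assumes t: "t > 0"
  shows "(LINT y|lborel. heat_dt t (x - y) *\<^sub>R u y) = heat_conv t Wu x"
proof -
  obtain C where C: "C \<ge> 0" "\<And>R z. R \<ge> 1 \<Longrightarrow> \<bar>cutoff_heat t R (z :: real^'n)\<bar> \<le> C * heat (2 * t) z"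
    "\<And>R z. R \<ge> 1 \<Longrightarrow> \<bar>cutoff_heat_laplacian t R (z :: real^'n)\<bar> \<le> C * heat (2 * t) z"
    using cutoff_heat_bound[OF t, where ?'n = 'n] by metis
  have [measurable]: "cutoff_gauss t R \<in> borel_measurable borel" "cutoff_gauss'' t R \<in> borel_measurable borel" for R
  proof -
    have "smooth_real bump" "smooth_real (deriv bump)" "smooth_real (deriv (deriv bump))"
      using smooth_bump smooth_real_derivative(1) by blast+
    then have [measurable]: "bump \<in> borel_measurable borel" "deriv bump \<in> borel_measurable borel"
      "deriv (deriv bump) \<in> borel_measurable borel"
      by (auto intro!: borel_measurable_continuous_onI smooth_real_continuous)
    show "cutoff_gauss t R \<in> borel_measurable borel" "cutoff_gauss'' t R \<in> borel_measurable borel"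
      unfolding cutoff_gauss_def[abs_def] cutoff_gauss''_def[abs_def] by measurable
  qed
  have "(\<lambda>y. (x - y) $ i) \<in> borel_measurable borel" for i
    by (intro borel_measurable_continuous_onI continuous_intros)
  then have comp: "(\<lambda>y. g ((x - y) $ i)) \<in> borel_measurable borel" if "g \<in> borel_measurable borel" for g :: "real \<Rightarrow> real" and i
    using measurable_compose[OF _ that] by blast
  have [measurable]: "(\<lambda>y. cutoff_heat t R (x - y)) \<in> borel_measurable borel"
    "(\<lambda>y. cutoff_heat_laplacian t R (x - y)) \<in> borel_measurable borel" for R
    unfolding cutoff_heat_def cutoff_heat_laplacian_def
    by (intro borel_measurable_prod borel_measurable_sum borel_measurable_times comp; measurable)+
  have [measurable]: "heat_dt t \<in> borel_measurable borel" unfolding heat_dt_def[abs_def] by measurable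
  have ev: "\<forall>\<^sub>F R in at_top. (1::real) \<le> R" by (rule eventually_ge_at_top)
  have 1: "((\<lambda>R. LINT y|lborel. cutoff_heat_laplacian t R (x - y) *\<^sub>R u y)
      \<longlongrightarrow> (LINT y|lborel. heat_dt t (x - y) *\<^sub>R u y)) at_top"
  proof (rule integral_dominated_convergence_at_top[where w = "\<lambda>y. norm (C *\<^sub>R (heat (2 * t) (x - y) *\<^sub>R u y))"])
    show "integrable lborel (\<lambda>y. norm (C *\<^sub>R (heat (2 * t) (x - y) *\<^sub>R u y)))"
      using t by (intro integrable_norm integrable_scaleR_right heat_conv_integrable u_L2) auto
    show "AE y in lborel. ((\<lambda>R. cutoff_heat_laplacian t R (x - y) *\<^sub>R u y) \<longlongrightarrow> heat_dt t (x - y) *\<^sub>R u y) at_top"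
      by (intro AE_I2 tendsto_intros cutoff_heat_tendsto t)
    show "\<forall>\<^sub>F R in at_top. AE y in lborel.
       norm (cutoff_heat_laplacian t R (x - y) *\<^sub>R u y) \<le> norm (C *\<^sub>R (heat (2 * t) (x - y) *\<^sub>R u y))"
      using ev
    proof eventually_elim
      case (elim R)
      show ?case
      proof (intro AE_I2)
        fix y
        have "\<bar>cutoff_heat_laplacian t R (x - y)\<bar> \<le> \<bar>C * heat (2 * t) (x - y)\<bar>"
          using C(3)[OF elim, of "x - y"] by linarith
        then show "norm (cutoff_heat_laplacian t R (x - y) *\<^sub>R u y) \<le> norm (C *\<^sub>R (heat (2 * t) (x - y) *\<^sub>R u y))"
          by (simp add: abs_mult mult.assoc[symmetric] mult_right_mono)
      qed
    qed
  qed measurable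
  have 2: "((\<lambda>R. LINT y|lborel. cutoff_heat t R (x - y) *\<^sub>R Wu y) \<longlongrightarrow> heat_conv t Wu x) at_top"
    unfolding heat_conv_def
  proof (rule integral_dominated_convergence_at_top[where w = "\<lambda>y. norm (C *\<^sub>R (heat (2 * t) (x - y) *\<^sub>R Wu y))"])
    show "integrable lborel (\<lambda>y. norm (C *\<^sub>R (heat (2 * t) (x - y) *\<^sub>R Wu y)))"
      using t by (intro integrable_norm integrable_scaleR_right heat_conv_integrable Wu_L2) auto
    show "AE y in lborel. ((\<lambda>R. cutoff_heat t R (x - y) *\<^sub>R Wu y) \<longlongrightarrow> heat t (x - y) *\<^sub>R Wu y) at_top"
      by (intro AE_I2 tendsto_intros cutoff_heat_tendsto t)
    show "\<forall>\<^sub>F R in at_top. AE y in lborel.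
       norm (cutoff_heat t R (x - y) *\<^sub>R Wu y) \<le> norm (C *\<^sub>R (heat (2 * t) (x - y) *\<^sub>R Wu y))"
      using ev
    proof eventually_elim
      case (elim R)
      show ?case
      proof (intro AE_I2)
        fix y
        have "\<bar>cutoff_heat t R (x - y)\<bar> \<le> \<bar>C * heat (2 * t) (x - y)\<bar>"
          using C(2)[OF elim, of "x - y"] by linarith
        then have "\<bar>cutoff_heat t R (x - y)\<bar> * norm (Wu y) \<le> \<bar>C * heat (2 * t) (x - y)\<bar> * norm (Wu y)"
          by (rule mult_right_mono) simp
        then show "norm (cutoff_heat t R (x - y) *\<^sub>R Wu y) \<le> norm (C *\<^sub>R (heat (2 * t) (x - y) *\<^sub>R Wu y))"
          by (simp only: norm_scaleR abs_mult mult.assoc)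
      qed
    qed
  qed measurable
  have "\<forall>\<^sub>F R in at_top. (LINT y|lborel. cutoff_heat_laplacian t R (x - y) *\<^sub>R u y)
     = (LINT y|lborel. cutoff_heat t R (x - y) *\<^sub>R Wu y)"
    using ev
  proof eventually_elim
    case (elim R)
    then have "R > 0" by simp
    from weak[OF cutoff_heat_test_function(1)[OF this t, of x]] show ?case
      by (simp only: cutoff_heat_test_function(2)[OF \<open>R > 0\<close> t])
  qed
  from Lim_transform_eventually[OF 1 this] 2 show ?thesis
    by (rule tendsto_unique[OF trivial_limit_at_top_linorder])
qed

text \<open>Integrates \<open>heat_dt_integral\<close> in time: Fubini exchanges time and space, and
  for fixed \<open>y\<close> the fundamental theorem of calculus evaluates the time integral. The
  lower limit stays positive because the bound on \<open>heat_dt\<close> blows up at time 0.\<close>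

lemma duhamel:
  assumes s: "0 < s" "s \<le> T"
  shows "heat_conv T u x - heat_conv s u x = (LINT r:{s..T}|lborel. heat_conv r Wu x)"
proof -
  have T: "T > 0" using s by linarith
  define F where "F r y = (indicator {s..T} r * heat_dt r (x - y)) *\<^sub>R u y" for r y
  have [measurable]: "(\<lambda>p. heat_dt (fst p) (x - snd p)) \<in> borel_measurable (borel \<Otimes>\<^sub>M borel)"
    unfolding heat_dt_def[abs_def] by measurable
  have [measurable]: "case_prod F \<in> borel_measurable (lborel \<Otimes>\<^sub>M lborel)"
    unfolding F_def[abs_def] case_prod_beta by measurable
  define K where "K = (1 / (4 * s\<^sup>2) + real CARD('n) / (2 * s)) *
     (max 1 (8 * T) * (sqrt (4 * pi * (2 * T)) / sqrt (4 * pi * s)) ^ CARD('n))"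
  have K0: "K \<ge> 0" using s T by (simp add: K_def)
  have K: "\<bar>heat_dt r z\<bar> \<le> K * heat (2 * T) z" if "s \<le> r" "r \<le> T" for r and z :: "real^'n"
  proof -
    have "\<bar>heat_dt r z\<bar> \<le> (1 / (4 * s\<^sup>2) + real CARD('n) / (2 * s)) * ((1 + (norm z)\<^sup>2) * heat r z)"
      by (rule heat_dt_bound[OF s(1) that])
    also have "\<dots> \<le> (1 / (4 * s\<^sup>2) + real CARD('n) / (2 * s)) *
       (max 1 (8 * T) * (sqrt (4 * pi * (2 * T)) / sqrt (4 * pi * s)) ^ CARD('n) * heat (2 * T) z)"
      using s by (intro mult_left_mono heat_moment_bound that) auto
    finally show ?thesis by (simp only: K_def mult.assoc)
  qed
  have int: "integrable (lborel \<Otimes>\<^sub>M lborel) (case_prod F)"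
  proof (rule integrableI_bounded)
    let ?w = "\<lambda>y. ennreal (norm (K *\<^sub>R (heat (2 * T) (x - y) *\<^sub>R u y)))"
    have "(\<integral>\<^sup>+p. ennreal (norm (case_prod F p)) \<partial>(lborel \<Otimes>\<^sub>M lborel))
      = (\<integral>\<^sup>+r. \<integral>\<^sup>+y. ennreal (norm (F r y)) \<partial>lborel \<partial>lborel)"
      by (subst lborel.nn_integral_fst[symmetric]) auto
    also have "\<dots> \<le> (\<integral>\<^sup>+r. \<integral>\<^sup>+y. indicator {s..T} r * ?w y \<partial>lborel \<partial>lborel)"
    proof (intro nn_integral_mono)
      fix r y
      show "ennreal (norm (F r y)) \<le> indicator {s..T} r * ?w y"
      proof (cases "r \<in> {s..T}")
        case True
        then have "\<bar>heat_dt r (x - y)\<bar> \<le> \<bar>K * heat (2 * T) (x - y)\<bar>"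
          using K[of r "x - y"] by simp
        then show ?thesis
          using True by (simp add: F_def abs_mult mult.assoc[symmetric] mult_right_mono ennreal_leI)
      qed (simp add: F_def)
    qed
    also have "\<dots> = (\<integral>\<^sup>+r. indicator {s..T} r \<partial>lborel) * (\<integral>\<^sup>+y. ?w y \<partial>lborel)"
      by (simp add: nn_integral_cmult nn_integral_multc)
    also have "\<dots> < \<infinity>"
    proof -
      have "integrable lborel (\<lambda>y. K *\<^sub>R (heat (2 * T) (x - y) *\<^sub>R u y))"
        using T by (intro integrable_scaleR_right heat_conv_integrable u_L2) auto
      then have "(\<integral>\<^sup>+y. ?w y \<partial>lborel) < \<infinity>" unfolding integrable_iff_bounded by blast
      then show ?thesis using s by (simp add: ennreal_mult_less_top)
    qed
    finally show "(\<integral>\<^sup>+p. ennreal (norm (case_prod F p)) \<partial>(lborel \<Otimes>\<^sub>M lborel)) < \<infinity>" .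
  qed measurable
  have "(LINT r:{s..T}|lborel. heat_conv r Wu x) = (LINT r|lborel. LINT y|lborel. F r y)"
    unfolding set_lebesgue_integral_def
  proof (intro Bochner_Integration.integral_cong refl)
    fix r
    show "indicator {s..T} r *\<^sub>R heat_conv r Wu x = (LINT y|lborel. F r y)"
    proof (cases "r \<in> {s..T}")
      case True
      then have "r > 0" using s by auto
      then show ?thesis using True by (simp add: F_def heat_dt_integral)
    qed (simp add: F_def)
  qed
  also have "\<dots> = (LINT y|lborel. LINT r|lborel. F r y)"
    by (rule lborel_pair.Fubini_integral[OF int, symmetric])
  also have "\<dots> = (LINT y|lborel. heat T (x - y) *\<^sub>R u y - heat s (x - y) *\<^sub>R u y)"
  proof (intro Bochner_Integration.integral_cong refl)
    fix y
    have hb: "has_bochner_integral lborel (\<lambda>r. indicator {s..T} r *\<^sub>R heat_dt r (x - y)) (heat T (x - y) - heat s (x - y))"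
    proof (rule has_bochner_integral_FTC_Icc[OF s(2)])
      fix r assume "s \<le> r" "r \<le> T"
      then have "r > 0" using s by linarith
      then show "((\<lambda>r. heat r (x - y)) has_vector_derivative heat_dt r (x - y)) (at r within {s..T})"
        using heat_has_derivative[of r "x - y"]
        by (simp add: has_real_derivative_iff_has_vector_derivative has_vector_derivative_at_within)
    next
      show "continuous_on {s..T} (\<lambda>r. heat_dt r (x - y))"
        unfolding heat_dt_def heat_def using s by (intro continuous_intros) auto
    qed
    have "(LINT r|lborel. F r y) = (LINT r|lborel. indicator {s..T} r *\<^sub>R heat_dt r (x - y)) *\<^sub>R u y"
      unfolding F_def using has_bochner_integral_integrable hb
      by (subst integral_scaleR_left[symmetric]) (auto simp: has_bochner_integral_iff)
    then show "(LINT r|lborel. F r y) = heat T (x - y) *\<^sub>R u y - heat s (x - y) *\<^sub>R u y"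
      using hb by (simp add: has_bochner_integral_iff scaleR_left_diff_distrib)
  qed
  also have "\<dots> = heat_conv T u x - heat_conv s u x"
    unfolding heat_conv_def using s T by (intro Bochner_Integration.integral_diff heat_conv_integrable u_L2) auto
  finally show ?thesis by simp
qed

section \<open>The Duhamel formula down to time zero\<close>

definition avg_int :: "real \<Rightarrow> real^'n \<Rightarrow> ennreal" where
  "avg_int T x = (\<integral>\<^sup>+r. indicator {0<..T} r * avg r x \<partial>lborel)"

text \<open>The candidate for the continuous representative: the Duhamel formula solved for the
  value at time 0. Where \<open>avg_int T\<close> is infinite the time integral may be a default
  value, so finiteness is assumed or proved wherever convergence to this function is
  claimed.\<close>

definition limit_fun :: "real \<Rightarrow> real^'n \<Rightarrow> complex" where
  "limit_fun T x = heat_conv T u x - (LINT r:{0<..T}|lborel. heat_conv r Wu x)"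

lemma avg_int_measurable [measurable]: "avg_int T \<in> borel_measurable borel"
  unfolding avg_int_def[abs_def] by measurable

lemma limit_fun_measurable [measurable]: "limit_fun T \<in> borel_measurable borel"
  unfolding limit_fun_def[abs_def] set_lebesgue_integral_def by measurable

lemma avg_le: "t > 0 \<Longrightarrow> avg t x \<le> ennreal (1 / sqrt (4 * pi * t) ^ CARD('n)) + (\<integral>\<^sup>+y. ennreal ((norm (u y))\<^sup>2) \<partial>lborel)"
  by (rule heat_avg_L2_bound) auto

lemma avg_finite: "t > 0 \<Longrightarrow> avg t x < \<infinity>"
  using avg_le[of t x] u_L2 by (auto simp: le_less_trans ennreal_add_less_top)

lemma norm_heat_conv_Wu_le:
  assumes "t > 0"
  shows "ennreal (norm (heat_conv t Wu x)) \<le> ennreal M * avg t x"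
proof -
  have "ennreal (norm (heat_conv t Wu x)) \<le> heat_avg t (\<lambda>y. ennreal (norm (Wu y))) x"
    using assms by (intro norm_heat_conv_le) auto
  also have "\<dots> \<le> heat_avg t (\<lambda>y. ennreal M * ennreal (norm (u y))) x"
    by (intro heat_avg_mono_AE AE_I2) (use Wu_le M_pos in \<open>simp add: ennreal_mult'[symmetric] ennreal_leI\<close>)
  also have "\<dots> = ennreal M * avg t x"
    unfolding heat_avg_def by (subst nn_integral_cmult[symmetric]) (auto simp: mult_ac)
  finally show ?thesis .
qed

lemma nn_integral_heat_conv_Wu_le:
  "(\<integral>\<^sup>+r. ennreal (norm (indicator {0<..T} r *\<^sub>R heat_conv r Wu x)) \<partial>lborel) \<le> ennreal M * avg_int T x"
proof -
  have "(\<integral>\<^sup>+r. ennreal (norm (indicator {0<..T} r *\<^sub>R heat_conv r Wu x)) \<partial>lborel)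
    \<le> (\<integral>\<^sup>+r. ennreal M * (indicator {0<..T} r * avg r x) \<partial>lborel)"
    by (intro nn_integral_mono) (auto simp: indicator_def norm_heat_conv_Wu_le)
  also have "\<dots> = ennreal M * avg_int T x"
    unfolding avg_int_def by (rule nn_integral_cmult) measurable
  finally show ?thesis .
qed

text \<open>The right-hand side does not depend on \<open>s\<close>; it is the majorant for letting
  \<open>s\<close> tend to 0.\<close>

lemma norm_heat_conv_u_le:
  assumes "0 < s" "s \<le> T"
  shows "ennreal (norm (heat_conv s u x)) \<le> avg T x + ennreal M * avg_int T x"
proof -
  have "ennreal (norm (LINT r:{s..T}|lborel. heat_conv r Wu x))
    \<le> (\<integral>\<^sup>+r. ennreal (norm (indicator {s..T} r *\<^sub>R heat_conv r Wu x)) \<partial>lborel)"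
    unfolding set_lebesgue_integral_def by (rule norm_integral_le_nn_integral)
  also have "\<dots> \<le> (\<integral>\<^sup>+r. ennreal (norm (indicator {0<..T} r *\<^sub>R heat_conv r Wu x)) \<partial>lborel)"
    using assms by (intro nn_integral_mono) (auto simp: indicator_def)
  also have "\<dots> \<le> ennreal M * avg_int T x" by (rule nn_integral_heat_conv_Wu_le)
  finally have 1: "ennreal (norm (LINT r:{s..T}|lborel. heat_conv r Wu x)) \<le> ennreal M * avg_int T x" .
  have "heat_conv s u x = heat_conv T u x - (LINT r:{s..T}|lborel. heat_conv r Wu x)"
    using duhamel[OF assms, of x] by (simp add: algebra_simps)
  then have "norm (heat_conv s u x) \<le> norm (heat_conv T u x) + norm (LINT r:{s..T}|lborel. heat_conv r Wu x)"
    by (metis norm_triangle_ineq4)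
  then have "ennreal (norm (heat_conv s u x))
      \<le> ennreal (norm (heat_conv T u x)) + ennreal (norm (LINT r:{s..T}|lborel. heat_conv r Wu x))"
    by (simp add: ennreal_plus[symmetric] ennreal_leI del: ennreal_plus)
  also have "\<dots> \<le> avg T x + ennreal M * avg_int T x"
    using assms by (intro add_mono norm_heat_conv_le 1) auto
  finally show ?thesis .
qed

lemma heat_avg_avg_int:
  assumes "s > 0"
  shows "heat_avg s (avg_int T) x = (\<integral>\<^sup>+r. indicator {0<..T} r * avg (s + r) x \<partial>lborel)"
proof -
  have "heat_avg s (avg_int T) x
     = (\<integral>\<^sup>+y. \<integral>\<^sup>+r. ennreal (heat s (x - y)) * (indicator {0<..T} r * avg r y) \<partial>lborel \<partial>lborel)"
    unfolding heat_avg_def[of s] avg_int_def by (intro nn_integral_cong nn_integral_cmult[symmetric]) measurable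
  also have "\<dots> = (\<integral>\<^sup>+r. \<integral>\<^sup>+y. ennreal (heat s (x - y)) * (indicator {0<..T} r * avg r y) \<partial>lborel \<partial>lborel)"
    by (rule lborel_pair.Fubini') measurable
  also have "\<dots> = (\<integral>\<^sup>+r. indicator {0<..T} r * heat_avg s (avg r) x \<partial>lborel)"
    unfolding heat_avg_def[of s] by (intro nn_integral_cong) (simp add: indicator_def)
  also have "\<dots> = (\<integral>\<^sup>+r. indicator {0<..T} r * avg (s + r) x \<partial>lborel)"
    using assms by (intro nn_integral_cong) (simp add: indicator_def heat_avg_semigroup)
  finally show ?thesis .
qed

text \<open>The bound \<open>avg_le\<close> need not be integrable in time near 0. One unit of heat
  flow replaces the times r by 1 + r, where it is uniform.\<close>

lemma heat_avg_avg_int_finite: "heat_avg 1 (avg_int T) x < \<infinity>"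
proof -
  let ?c = "ennreal 1 + (\<integral>\<^sup>+y. ennreal ((norm (u y))\<^sup>2) \<partial>lborel)"
  have "heat_avg 1 (avg_int T) x \<le> (\<integral>\<^sup>+r. indicator {0<..T} r * ?c \<partial>lborel)"
    unfolding heat_avg_avg_int[OF zero_less_one]
  proof (intro nn_integral_mono)
    fix r
    show "indicator {0<..T} r * avg (1 + r) x \<le> indicator {0<..T} r * ?c"
    proof (cases "r \<in> {0<..T}")
      case True
      have "1 * 1 \<le> (4 * pi) * (1 + r)"
        using True pi_gt3 by (intro mult_mono) auto
      then have "1 \<le> sqrt (4 * pi * (1 + r)) ^ CARD('n)"
        by (intro one_le_power) simp
      then have "1 / sqrt (4 * pi * (1 + r)) ^ CARD('n) \<le> 1" by (simp add: divide_le_eq_1)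
      then have "avg (1 + r) x \<le> ?c"
        using avg_le[of "1 + r" x] True by (intro order_trans[OF avg_le] add_mono ennreal_leI) auto
      then show ?thesis using True by simp
    qed simp
  qed
  also have "\<dots> = emeasure lborel {0<..T} * ?c"
    by (simp add: nn_integral_multc)
  also have "\<dots> < \<infinity>"
  proof -
    have "emeasure lborel {0<..T} < \<infinity>" by (cases "0 \<le> T") auto
    then show ?thesis using u_L2 by (simp add: ennreal_mult_less_top ennreal_add_less_top)
  qed
  finally show ?thesis .
qed

text \<open>The weight \<open>heat 1\<close> is strictly positive, so a finite weighted integral
  forces finiteness almost everywhere.\<close>

lemma avg_int_finite: "AE x in lborel. avg_int T x < \<infinity>"
proof -
  have "AE x in lborel. ennreal (heat 1 (0 - x)) * avg_int T x \<noteq> \<infinity>"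
    using heat_avg_avg_int_finite[of T 0] unfolding heat_avg_def by (intro nn_integral_PInf_AE) auto
  then show ?thesis
  proof eventually_elim
    case (elim x)
    have "heat 1 (0 - x) > 0" by (simp add: heat_def)
    then show ?case using elim by (auto simp: ennreal_mult_eq_top_iff less_top)
  qed
qed

lemma heat_conv_tendsto_limit_fun:
  assumes fin: "avg_int T x < \<infinity>" and T: "T > 0"
    and s: "\<And>k::nat. s k > 0" "\<And>k. s k \<le> T" "s \<longlonglongrightarrow> 0"
  shows "(\<lambda>k. heat_conv (s k) u x) \<longlonglongrightarrow> limit_fun T x"
proof -
  have "(\<lambda>k. LINT r|lborel. indicator {s k..T} r *\<^sub>R heat_conv r Wu x)
     \<longlonglongrightarrow> (LINT r|lborel. indicator {0<..T} r *\<^sub>R heat_conv r Wu x)"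
  proof (rule integral_dominated_convergence[where w = "\<lambda>r. norm (indicator {0<..T} r *\<^sub>R heat_conv r Wu x)"])
    show "integrable lborel (\<lambda>r. norm (indicator {0<..T} r *\<^sub>R heat_conv r Wu x))"
      using le_less_trans[OF nn_integral_heat_conv_Wu_le[of T x]] fin
      by (intro integrable_norm integrableI_bounded) (auto simp: ennreal_mult_less_top)
    show "AE r in lborel. (\<lambda>k. indicator {s k..T} r *\<^sub>R heat_conv r Wu x) \<longlonglongrightarrow> indicator {0<..T} r *\<^sub>R heat_conv r Wu x"
    proof (intro AE_I2)
      fix r
      show "(\<lambda>k. indicator {s k..T} r *\<^sub>R heat_conv r Wu x) \<longlonglongrightarrow> indicator {0<..T} r *\<^sub>R heat_conv r Wu x"
      proof (cases "r > 0")
        case True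
        then have "\<forall>\<^sub>F k in sequentially. s k < r" using s(3) by (rule order_tendstoD(2)[rotated])
        then have "\<forall>\<^sub>F k in sequentially. indicator {s k..T} r *\<^sub>R heat_conv r Wu x = indicator {0<..T} r *\<^sub>R heat_conv r Wu x"
          by eventually_elim (use True in \<open>auto simp: indicator_def\<close>)
        then show ?thesis by (rule tendsto_eventually)
      next
        case False
        then have "indicator {s k..T} r = (0 :: real)" for k using s(1)[of k] by (auto simp: indicator_def)
        then show ?thesis using False by simp
      qed
    qed
    show "AE r in lborel. norm (indicator {s k..T} r *\<^sub>R heat_conv r Wu x) \<le> norm (indicator {0<..T} r *\<^sub>R heat_conv r Wu x)" for k
      using s(1)[of k] by (intro AE_I2) (auto simp: indicator_def)
  qed measurable
  then have "(\<lambda>k. heat_conv T u x - (LINT r:{s k..T}|lborel. heat_conv r Wu x)) \<longlonglongrightarrow> limit_fun T x"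
    unfolding limit_fun_def set_lebesgue_integral_def by (intro tendsto_intros)
  moreover have "heat_conv T u x - (LINT r:{s k..T}|lborel. heat_conv r Wu x) = heat_conv (s k) u x" for k
    using duhamel[OF s(1)[of k] s(2)[of k], of x] by (simp add: algebra_simps)
  ultimately show ?thesis by simp
qed

text \<open>Along times s tending to 0 the functions \<open>heat_conv s u\<close> converge to
  \<open>limit_fun T\<close> almost everywhere, with an integrable majorant on each box, and to
  \<open>u\<close> in the sense of integrals over boxes. Hence the two limits have the same integral
  over every box.\<close>

lemma solution_eq_limit_fun:
  assumes T: "0 < T" "T \<le> 1"
  shows "AE x in lborel. u x = limit_fun T x"
proof -
  define s where "s k = T / real (Suc k)" for k
  have s: "s k > 0" "s k \<le> T" "s k \<le> 1" for k
  proof -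
    show "s k > 0" using T by (simp add: s_def)
    have "T / real (Suc k) \<le> T / 1" using T by (intro divide_left_mono) auto
    then show "s k \<le> T" "s k \<le> 1" using T by (auto simp: s_def)
  qed
  have s0: "s \<longlonglongrightarrow> 0" unfolding s_def by real_asymp
  have "set_integrable lborel (box a b) (\<lambda>x. u x - limit_fun T x) \<and> (LINT x:box a b|lborel. u x - limit_fun T x) = 0" for a b
  proof -
    let ?Q = "box a b"
    obtain c where c: "c \<ge> 0" "\<And>x. indicator ?Q x \<le> c * heat 1 x"
      using indicator_le_heat[OF bounded_box, of a b] by blast
    \<comment> \<open>The bound of \<open>norm_heat_conv_u_le\<close>, localized to the box. It is
      integrable because the indicator is dominated by a multiple of \<open>heat 1\<close>, and
      unit-time averages of both summands are finite.\<close>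
    define w where "w x = indicator ?Q x *\<^sub>R enn2real (avg T x + ennreal M * avg_int T x)" for x
    have w: "integrable lborel w"
    proof (rule integrableI_bounded)
      have "(\<integral>\<^sup>+x. ennreal (norm (w x)) \<partial>lborel)
         \<le> (\<integral>\<^sup>+x. ennreal c * (ennreal (heat 1 (0 - x)) * avg T x + ennreal M * (ennreal (heat 1 (0 - x)) * avg_int T x)) \<partial>lborel)"
      proof (intro nn_integral_mono)
        fix x
        have "ennreal (norm (w x)) \<le> ennreal (indicator ?Q x) * (avg T x + ennreal M * avg_int T x)"
          unfolding w_def by (cases "avg T x + ennreal M * avg_int T x") (auto simp: indicator_def)
        also have "\<dots> \<le> ennreal (c * heat 1 x) * (avg T x + ennreal M * avg_int T x)"
          by (intro mult_right_mono ennreal_leI c) simp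
        also have "\<dots> = ennreal c * (ennreal (heat 1 (0 - x)) * avg T x + ennreal M * (ennreal (heat 1 (0 - x)) * avg_int T x))"
          using c(1) heat_nonneg[of 1 x] by (simp add: ennreal_mult heat_minus distrib_left mult_ac)
        finally show "ennreal (norm (w x)) \<le> \<dots>" .
      qed
      also have "\<dots> = ennreal c * (heat_avg 1 (avg T) 0 + ennreal M * heat_avg 1 (avg_int T) 0)"
        unfolding heat_avg_def[of 1] by (simp add: nn_integral_cmult nn_integral_add)
      also have "\<dots> < \<infinity>"
        using heat_avg_avg_int_finite[of T 0] avg_finite[of "1 + T" 0] T
        by (simp add: heat_avg_semigroup ennreal_mult_less_top ennreal_add_less_top)
      finally show "(\<integral>\<^sup>+x. ennreal (norm (w x)) \<partial>lborel) < \<infinity>" .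
    qed (unfold w_def, measurable)
    have lim: "AE x in lborel. (\<lambda>k. indicator ?Q x *\<^sub>R heat_conv (s k) u x) \<longlonglongrightarrow> indicator ?Q x *\<^sub>R limit_fun T x"
      using avg_int_finite[of T]
    proof eventually_elim
      case (elim x)
      then show ?case
        by (intro tendsto_intros heat_conv_tendsto_limit_fun[OF _ T(1) s(1,2) s0])
    qed
    have dom: "AE x in lborel. norm (indicator ?Q x *\<^sub>R heat_conv (s k) u x) \<le> w x" for k
      using avg_int_finite[of T]
    proof eventually_elim
      case (elim x)
      have "avg T x + ennreal M * avg_int T x < \<infinity>"
        using elim avg_finite[OF T(1), of x] by (simp add: ennreal_mult_less_top ennreal_add_less_top)
      then have "norm (heat_conv (s k) u x) \<le> enn2real (avg T x + ennreal M * avg_int T x)"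
        using norm_heat_conv_u_le[OF s(1)[of k] s(2)[of k], of x]
        by (cases "avg T x + ennreal M * avg_int T x") auto
      then show ?case by (simp add: w_def indicator_def)
    qed
    have lim_int: "integrable lborel (\<lambda>x. indicator ?Q x *\<^sub>R limit_fun T x)"
      by (rule integrable_dominated_convergence[OF _ _ w lim dom]) measurable
    have "(\<lambda>k. LINT x|lborel. indicator ?Q x *\<^sub>R heat_conv (s k) u x) \<longlonglongrightarrow> (LINT x|lborel. indicator ?Q x *\<^sub>R limit_fun T x)"
      by (rule integral_dominated_convergence[OF _ _ w lim dom]) measurable
    moreover have "(\<lambda>k. LINT x:?Q|lborel. heat_conv (s k) u x) \<longlonglongrightarrow> (LINT x:?Q|lborel. u x)"
      by (rule heat_conv_tendsto_weakly[OF u_meas u_L2 _ bounded_box frontier_box_null s(1,3) s0]) simp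
    ultimately have eq: "(LINT x:?Q|lborel. u x) = (LINT x:?Q|lborel. limit_fun T x)"
      unfolding set_lebesgue_integral_def by (rule LIMSEQ_unique[rotated])
    have u_int: "integrable lborel (\<lambda>x. indicator ?Q x *\<^sub>R u x)"
    proof (rule Bochner_Integration.integrable_bound)
      show "integrable lborel (\<lambda>x. c *\<^sub>R (heat 1 (0 - x) *\<^sub>R u x))"
        by (intro integrable_scaleR_right heat_conv_integrable u_L2) auto
      show "AE x in lborel. norm (indicator ?Q x *\<^sub>R u x) \<le> norm (c *\<^sub>R (heat 1 (0 - x) *\<^sub>R u x))"
      proof (intro AE_I2)
        fix x
        have "\<bar>indicator ?Q x\<bar> \<le> \<bar>c * heat 1 (0 - x)\<bar>" using c(2)[of x] by (simp add: heat_minus)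
        then show "norm (indicator ?Q x *\<^sub>R u x) \<le> norm (c *\<^sub>R (heat 1 (0 - x) *\<^sub>R u x))"
          by (simp add: abs_mult mult.assoc[symmetric] mult_right_mono)
      qed
    qed measurable
    show ?thesis
      using set_integral_diff[of lborel ?Q u "limit_fun T"] u_int lim_int eq by (simp add: set_integrable_def)
  qed
  then have "AE x in lborel. u x - limit_fun T x = 0"
    by (intro AE_zero_of_box_integrals) auto
  then show ?thesis by simp
qed

lemma solution_le_avg_int:
  assumes T: "0 < T" "T \<le> 1"
  shows "AE x in lborel. ennreal (norm (u x)) \<le> avg T x + ennreal M * avg_int T x"
  using solution_eq_limit_fun[OF T]
proof eventually_elim
  case (elim x)
  have "ennreal (norm (limit_fun T x))
     \<le> ennreal (norm (heat_conv T u x)) + ennreal (norm (LINT r:{0<..T}|lborel. heat_conv r Wu x))"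
    unfolding limit_fun_def
    by (simp add: ennreal_plus[symmetric] ennreal_leI norm_triangle_ineq4 del: ennreal_plus)
  also have "\<dots> \<le> avg T x + ennreal M * avg_int T x"
  proof (intro add_mono norm_heat_conv_le T u_meas)
    have "ennreal (norm (LINT r:{0<..T}|lborel. heat_conv r Wu x))
       \<le> (\<integral>\<^sup>+r. ennreal (norm (indicator {0<..T} r *\<^sub>R heat_conv r Wu x)) \<partial>lborel)"
      unfolding set_lebesgue_integral_def by (rule norm_integral_le_nn_integral)
    then show "ennreal (norm (LINT r:{0<..T}|lborel. heat_conv r Wu x)) \<le> ennreal M * avg_int T x"
      using nn_integral_heat_conv_Wu_le by (rule order_trans)
  qed
  finally show ?case using elim by simp
qed

text \<open>
  Applying the heat semigroup to the previous bound, for time \<open>T - s\<close>, bounds all averages \<open>avg s\<close>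
  with \<open>s \<le> T\<close> at once. For small \<open>T\<close> the integral term is then absorbed on the left.
\<close>

lemma avg_le_avg_int:
  assumes T: "T \<le> 1" and s: "0 < s" "s \<le> T"
  shows "avg s x \<le> avg T x + ennreal M * avg_int T x"
proof (cases "s = T")
  case False
  then have Ts: "0 < T - s" "T - s \<le> 1" using s T by auto
  have "avg s x \<le> heat_avg s (\<lambda>y. avg (T - s) y + ennreal M * avg_int (T - s) y) x"
    by (intro heat_avg_mono_AE solution_le_avg_int Ts)
  also have "\<dots> = heat_avg s (avg (T - s)) x + ennreal M * heat_avg s (avg_int (T - s)) x"
    unfolding heat_avg_def[of s] by (subst nn_integral_cmult[symmetric], measurable)
      (subst nn_integral_add[symmetric], auto simp: distrib_left mult_ac)
  also have "heat_avg s (avg (T - s)) x = avg T x"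
    using s Ts by (simp add: heat_avg_semigroup)
  \<comment> \<open>Writing the indicator in terms of s + r prepares the translation of the time
    variable, which leaves only times in (s,T].\<close>
  also have "heat_avg s (avg_int (T - s)) x = (\<integral>\<^sup>+r. indicator {s<..T} (s + r) * avg (s + r) x \<partial>lborel)"
    unfolding heat_avg_avg_int[OF s(1)] by (intro nn_integral_cong) (auto simp: indicator_def)
  also have "\<dots> = (\<integral>\<^sup>+r. indicator {s<..T} r * avg r x \<partial>lborel)"
    by (rule nn_integral_lborel_translate) measurable
  also have "\<dots> \<le> avg_int T x"
    unfolding avg_int_def using s by (intro nn_integral_mono) (auto simp: indicator_def)
  finally show ?thesis by (simp add: add_left_mono mult_left_mono)
qed simp

lemma solution_le_avg:
  assumes T: "0 < T" "T \<le> 1" "2 * M * T \<le> 1"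
  shows "AE x in lborel. ennreal (norm (u x)) \<le> 2 * avg T x"
  using solution_le_avg_int[OF T(1,2)] avg_int_finite[of T]
proof eventually_elim
  case (elim x)
  obtain a where a: "avg T x = ennreal a" "a \<ge> 0"
    using avg_finite[OF T(1), of x] by (cases "avg T x") auto
  \<comment> \<open>Finiteness of the time integral permits the subtraction that absorbs it
    below.\<close>
  obtain j where j: "avg_int T x = ennreal j" "j \<ge> 0"
    using elim(2) by (cases "avg_int T x") auto
  have eq: "avg T x + ennreal M * avg_int T x = ennreal (a + M * j)"
    using a j M_pos by (simp add: ennreal_mult'[symmetric] ennreal_plus[symmetric] del: ennreal_plus)
  \<comment> \<open>The bound of \<open>avg_le_avg_int\<close> is the same for all times r, so
    integrating it over (0,T] costs only the factor \<open>T\<close>.\<close>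
  have "avg_int T x \<le> (\<integral>\<^sup>+r. indicator {0<..T} r * ennreal (a + M * j) \<partial>lborel)"
    unfolding avg_int_def using avg_le_avg_int[OF T(2), of _ x] eq
    by (intro nn_integral_mono) (auto simp: indicator_def)
  also have "\<dots> = ennreal (T * (a + M * j))"
    using T a j M_pos by (simp add: nn_integral_multc ennreal_mult' del: ennreal_plus)
  finally have "j \<le> T * (a + M * j)"
    using T a j M_pos by simp
  then have "M * j \<le> M * (T * (a + M * j))" using M_pos by (intro mult_left_mono) auto
  also have "\<dots> = (M * T) * a + (M * T) * (M * j)" by (simp add: algebra_simps)
  also have "\<dots> \<le> (1 / 2) * a + (1 / 2) * (M * j)"
    using T a j M_pos by (intro add_mono mult_right_mono) auto
  finally have "a + M * j \<le> 2 * a" by simp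
  then have "ennreal (a + M * j) \<le> 2 * ennreal a"
    using a by (simp add: ennreal_leI flip: ennreal_numeral ennreal_mult')
  moreover have "ennreal (norm (u x)) \<le> ennreal (a + M * j)"
    using elim(1) unfolding eq .
  ultimately show ?case unfolding a(1) by (rule order_trans[rotated])
qed

text \<open>Once \<open>u\<close> is essentially bounded by \<open>N\<close>, all averages are at
  most \<open>N\<close> at every point and time, so the Duhamel formula gives a distance of at most
  t M N between \<open>heat_conv t u\<close> and \<open>limit_fun T\<close>, uniformly in space.
  Continuity passes to the uniform limit.\<close>

lemma continuous_representative:
  assumes T: "0 < T" "T \<le> 1" "2 * M * T \<le> 1"
  shows "continuous_on UNIV (limit_fun T)"
proof -
  obtain l where l: "(\<integral>\<^sup>+x. ennreal ((norm (u x))\<^sup>2) \<partial>lborel) = ennreal l" "l \<ge> 0"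
    using u_L2 by (cases "\<integral>\<^sup>+x. ennreal ((norm (u x))\<^sup>2) \<partial>lborel") auto
  define N where "N = 2 * (1 / sqrt (4 * pi * T) ^ CARD('n) + l)"
  have N0: "N \<ge> 0" using l T by (simp add: N_def)
  have uN: "AE y in lborel. ennreal (norm (u y)) \<le> ennreal N"
    using solution_le_avg[OF T]
  proof eventually_elim
    case (elim y)
    also have "2 * avg T y \<le> 2 * (ennreal (1 / sqrt (4 * pi * T) ^ CARD('n)) + ennreal l)"
      using avg_le[OF T(1), of y] l by (intro mult_left_mono) auto
    also have "\<dots> = ennreal N"
      using l T unfolding N_def by (subst ennreal_mult) auto
    finally show ?case .
  qed
  have avgN: "avg r x \<le> ennreal N" if "r > 0" for r x
    using heat_avg_mono_AE[OF uN, of r x] heat_avg_const[OF that, of "ennreal N" x] by simp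
  have fin: "avg_int T x < \<infinity>" for x
  proof -
    have "avg_int T x \<le> (\<integral>\<^sup>+r. indicator {0<..T} r * ennreal N \<partial>lborel)"
      unfolding avg_int_def using avgN by (intro nn_integral_mono) (auto simp: indicator_def)
    also have "\<dots> < \<infinity>" using T by (simp add: nn_integral_multc ennreal_mult_less_top)
    finally show ?thesis .
  qed
  have diff: "norm (heat_conv t u x - heat_conv s u x) \<le> t * (M * N)" if st: "0 < s" "s \<le> t" for s t x
  proof -
    have "ennreal (norm (heat_conv t u x - heat_conv s u x))
      \<le> (\<integral>\<^sup>+r. ennreal (norm (indicator {s..t} r *\<^sub>R heat_conv r Wu x)) \<partial>lborel)"
      unfolding duhamel[OF st] set_lebesgue_integral_def by (rule norm_integral_le_nn_integral)
    also have "\<dots> \<le> (\<integral>\<^sup>+r. indicator {s..t} r * ennreal (M * N) \<partial>lborel)"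
    proof (intro nn_integral_mono)
      fix r
      have "ennreal (norm (heat_conv r Wu x)) \<le> ennreal (M * N)" if "r > 0"
        using norm_heat_conv_Wu_le[OF that, of x] mult_left_mono[OF avgN[OF that, of x], of "ennreal M"] M_pos
        by (simp add: ennreal_mult')
      then show "ennreal (norm (indicator {s..t} r *\<^sub>R heat_conv r Wu x)) \<le> indicator {s..t} r * ennreal (M * N)"
        using st by (auto simp: indicator_def)
    qed
    also have "\<dots> = ennreal ((t - s) * (M * N))"
      using st M_pos N0 by (simp add: nn_integral_multc ennreal_mult'[symmetric])
    finally have "norm (heat_conv t u x - heat_conv s u x) \<le> (t - s) * (M * N)"
      using st M_pos N0 by simp
    also have "\<dots> \<le> t * (M * N)" using st M_pos N0 by (intro mult_right_mono) auto
    finally show ?thesis .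
  qed
  define s where "s k = T / real (Suc k)" for k
  have s: "s k > 0" "s k \<le> T" for k
  proof -
    show "s k > 0" using T by (simp add: s_def)
    have "T / real (Suc k) \<le> T / 1" using T by (intro divide_left_mono) auto
    then show "s k \<le> T" by (simp add: s_def)
  qed
  have s0: "s \<longlonglongrightarrow> 0" unfolding s_def by real_asymp
  have conv: "(\<lambda>k. heat_conv (s k) u x) \<longlonglongrightarrow> limit_fun T x" for x
    by (rule heat_conv_tendsto_limit_fun[OF fin T(1) s s0])
  have lim: "norm (heat_conv t u x - limit_fun T x) \<le> t * (M * N)" if "t > 0" for t x
  proof (rule tendsto_upperbound)
    show "(\<lambda>k. norm (heat_conv t u x - heat_conv (s k) u x)) \<longlonglongrightarrow> norm (heat_conv t u x - limit_fun T x)"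
      by (intro tendsto_intros conv)
    have "\<forall>\<^sub>F k in sequentially. s k < t" using s0 that by (rule order_tendstoD(2))
    then show "\<forall>\<^sub>F k in sequentially. norm (heat_conv t u x - heat_conv (s k) u x) \<le> t * (M * N)"
      by eventually_elim (use s(1) diff in auto)
  qed simp
  show ?thesis
  proof (rule uniform_limit_theorem)
    show "\<forall>\<^sub>F k in sequentially. continuous_on UNIV (heat_conv (s k) u)"
      by (intro always_eventually allI continuous_on_heat_conv u_meas s u_L2)
    show "uniform_limit UNIV (\<lambda>k. heat_conv (s k) u) (limit_fun T) sequentially"
    proof (rule uniform_limitI)
      fix e :: real assume "e > 0"
      have "(\<lambda>k. s k * (M * N)) \<longlonglongrightarrow> 0" using s0 by (rule tendsto_mult_left_zero)
      then have "\<forall>\<^sub>F k in sequentially. s k * (M * N) < e" using \<open>e > 0\<close> by (rule order_tendstoD(2))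
      then show "\<forall>\<^sub>F k in sequentially. \<forall>x\<in>UNIV. dist (heat_conv (s k) u x) (limit_fun T x) < e"
        by eventually_elim (use lim[OF s(1)] in \<open>auto simp: dist_norm intro: le_less_trans\<close>)
    qed
  qed simp
qed

end

section \<open>The weighted pointwise bound\<close>

text \<open>
  A Gaussian of twice the width absorbs the exponential loss of moving the weight from \<open>x\<close> to \<open>y\<close>.
\<close>

lemma weighted_heat_avg_bound:
  fixes u :: "real^'n \<Rightarrow> complex" and \<Phi> :: "real^'n \<Rightarrow> real"
  assumes [measurable]: "u \<in> borel_measurable borel" "\<Phi> \<in> borel_measurable borel"
    and t: "t > 0" and \<Phi>: "\<And>x. \<Phi> x \<ge> 0" "\<And>x y. \<Phi> x \<le> exp (\<Lambda> * norm (x - y)) * \<Phi> y"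
    and L2: "(\<integral>\<^sup>+x. ennreal ((\<Phi> x * norm (u x))\<^sup>2) \<partial>lborel) < \<infinity>"
  obtains C where "C > 0" "\<And>x. ennreal (\<Phi> x) * heat_avg t (\<lambda>y. ennreal (norm (u y))) x \<le> ennreal C"
proof -
  define A where "A = exp (2 * t * \<Lambda>\<^sup>2) * (sqrt (4 * pi * (2 * t)) / sqrt (4 * pi * t)) ^ CARD('n)"
  have A0: "A \<ge> 0" using t by (simp add: A_def)
  define B where "B = ennreal (1 / sqrt (4 * pi * (2 * t)) ^ CARD('n)) + (\<integral>\<^sup>+x. ennreal ((\<Phi> x * norm (u x))\<^sup>2) \<partial>lborel)"
  have "B < \<infinity>" using L2 by (simp add: B_def ennreal_add_less_top)
  then obtain b where b: "B = ennreal b" "b \<ge> 0" by (cases B) auto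
  have "ennreal (\<Phi> x) * heat_avg t (\<lambda>y. ennreal (norm (u y))) x \<le> ennreal (A * b + 1)" for x
  proof -
    have "ennreal (\<Phi> x) * heat_avg t (\<lambda>y. ennreal (norm (u y))) x
       = (\<integral>\<^sup>+y. ennreal (\<Phi> x) * (ennreal (heat t (x - y)) * ennreal (norm (u y))) \<partial>lborel)"
      unfolding heat_avg_def by (rule nn_integral_cmult[symmetric]) measurable
    also have "\<dots> \<le> (\<integral>\<^sup>+y. ennreal A * (ennreal (heat (2 * t) (x - y)) * ennreal (\<Phi> y * norm (u y))) \<partial>lborel)"
    proof (intro nn_integral_mono)
      fix y
      have h: "0 \<le> heat t (x - y)" "0 \<le> heat (2 * t) (x - y)" using t by (auto intro!: heat_nonneg)
      have "\<Phi> x * (heat t (x - y) * norm (u y)) \<le> (exp (\<Lambda> * norm (x - y)) * \<Phi> y) * (heat t (x - y) * norm (u y))"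
        by (intro mult_right_mono \<Phi>) (use h in auto)
      also have "\<dots> = (heat t (x - y) * exp (\<Lambda> * norm (x - y))) * (\<Phi> y * norm (u y))" by (simp add: mult_ac)
      also have "\<dots> \<le> (A * heat (2 * t) (x - y)) * (\<Phi> y * norm (u y))"
        unfolding A_def by (intro mult_right_mono heat_weighted_bound t) (use \<Phi> in auto)
      finally have "ennreal (\<Phi> x * (heat t (x - y) * norm (u y))) \<le> ennreal (A * (heat (2 * t) (x - y) * (\<Phi> y * norm (u y))))"
        by (intro ennreal_leI) (simp add: mult.assoc)
      then show "ennreal (\<Phi> x) * (ennreal (heat t (x - y)) * ennreal (norm (u y)))
        \<le> ennreal A * (ennreal (heat (2 * t) (x - y)) * ennreal (\<Phi> y * norm (u y)))"
        using A0 h \<Phi>(1) by (simp add: ennreal_mult)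
    qed
    also have "\<dots> = ennreal A * heat_avg (2 * t) (\<lambda>y. ennreal (\<Phi> y * norm (u y))) x"
      unfolding heat_avg_def by (rule nn_integral_cmult) measurable
    also have "\<dots> \<le> ennreal A * B"
      unfolding B_def using t \<Phi>(1) by (intro mult_left_mono heat_avg_L2_bound) auto
    also have "\<dots> \<le> ennreal (A * b + 1)"
      using A0 b by (simp add: ennreal_mult'[symmetric] ennreal_leI)
    finally show ?thesis .
  qed
  moreover have "A * b + 1 > 0" using A0 b(2) by (simp add: add_nonneg_pos)
  ultimately show ?thesis using that by blast
qed

section \<open>From the operator equation to the weak equation\<close>

lemma lebesgue_complex_borel_representative:
  fixes f :: "real^'n \<Rightarrow> complex"
  assumes "f \<in> borel_measurable lebesgue"
  obtains g where "g \<in> borel_measurable borel" "AE x in lebesgue. f x = g x"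
proof -
  have "(\<lambda>x. Re (f x)) \<in> borel_measurable (completion lborel)" "(\<lambda>x. Im (f x)) \<in> borel_measurable (completion lborel)"
    using assms by (auto intro: borel_measurable_Re borel_measurable_Im)
  from this[THEN completion_ex_borel_measurable_real] obtain a b where
    [measurable]: "a \<in> borel_measurable lborel" "b \<in> borel_measurable lborel"
    and ae: "AE x in lborel. Re (f x) = a x" "AE x in lborel. Im (f x) = b x" by blast
  have "AE x in lborel. f x = Complex (a x) (b x)"
    using ae by eventually_elim (auto simp: complex_eq_iff)
  then have "AE x in lebesgue. f x = Complex (a x) (b x)" by (rule AE_completion)
  moreover have "(\<lambda>x. Complex (a x) (b x)) \<in> borel_measurable borel"
    unfolding Complex_eq by measurable
  ultimately show ?thesis by (intro that)
qed

lemma test_functionD: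
  fixes \<eta> :: "real^'n \<Rightarrow> real"
  assumes "\<eta> \<in> test_functions"
  shows "(\<lambda>t. iter_partial \<beta> \<eta> (x + t *\<^sub>R axis i 1)) field_differentiable at 0"
    and "continuous_on UNIV (iter_partial \<beta> \<eta>)"
proof -
  have "\<eta> \<in> C_k (Suc (length \<beta>))" using assms by (simp add: test_functions_def)
  then show "(\<lambda>t. iter_partial \<beta> \<eta> (x + t *\<^sub>R axis i 1)) field_differentiable at 0"
    and "continuous_on UNIV (iter_partial \<beta> \<eta>)"
    unfolding C_k_def by (blast, simp)
qed

text \<open>Square-integrable functions are locally integrable: with B a bound for \<eta> on its
  compact support K, the product is at most B^2 on K plus |g|^2.\<close>

lemma test_function_integrable:
  fixes \<eta> :: "real^'n \<Rightarrow> real"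
  assumes \<eta>: "\<eta> \<in> test_functions" and g: "g \<in> L2"
  shows "integrable lebesgue (\<lambda>x. \<eta> x *\<^sub>R g x)"
proof -
  have cont: "continuous_on UNIV \<eta>"
    using test_functionD(2)[OF \<eta>, of "[]"] by simp
  let ?K = "closure {x. \<eta> x \<noteq> 0}"
  have K: "compact ?K" using \<eta> by (simp add: test_functions_def)
  have "bounded (\<eta> ` ?K)"
    by (intro compact_imp_bounded compact_continuous_image K continuous_on_subset[OF cont]) auto
  then obtain B where B: "\<And>x. x \<in> ?K \<Longrightarrow> \<bar>\<eta> x\<bar> \<le> B" by (auto simp: bounded_iff)
  have K_fin: "emeasure lborel ?K < \<infinity>" using K by (rule emeasure_compact_finite)
  have [measurable]: "g \<in> borel_measurable lebesgue" and gi: "integrable lebesgue (\<lambda>x. (norm (g x))\<^sup>2)"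
    using g by (auto simp: L2_def)
  have [measurable]: "\<eta> \<in> borel_measurable lebesgue"
    using cont by (intro measurable_completion) (auto intro: borel_measurable_continuous_onI)
  show ?thesis
  proof (rule Bochner_Integration.integrable_bound)
    have "?K \<in> sets lborel" by simp
    then have "integrable lborel (indicator ?K :: _ \<Rightarrow> real)" using K_fin by (intro integrable_real_indicator) auto
    then have "integrable lebesgue (indicator ?K :: _ \<Rightarrow> real)" by (subst integrable_completion) auto
    then show "integrable lebesgue (\<lambda>x. (max B 0)\<^sup>2 * indicator ?K x + (norm (g x))\<^sup>2)"
      using gi by auto
    show "AE x in lebesgue. norm (\<eta> x *\<^sub>R g x) \<le> norm ((max B 0)\<^sup>2 * indicator ?K x + (norm (g x))\<^sup>2)"
    proof (intro AE_I2)
      fix x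
      show "norm (\<eta> x *\<^sub>R g x) \<le> norm ((max B 0)\<^sup>2 * indicator ?K x + (norm (g x))\<^sup>2)"
      proof (cases "x \<in> ?K")
        case True
        have "norm (\<eta> x *\<^sub>R g x) \<le> max B 0 * norm (g x)"
          using B[OF True] by (simp add: mult_right_mono le_max_iff_disj)
        also have "\<dots> \<le> (max B 0)\<^sup>2 + (norm (g x))\<^sup>2"
        proof -
          have "0 \<le> max B 0 * norm (g x)" by simp
          moreover have "2 * (max B 0 * norm (g x)) \<le> (max B 0)\<^sup>2 + (norm (g x))\<^sup>2"
            using sum_squares_bound[of "max B 0" "norm (g x)"] by (simp only: mult.assoc)
          ultimately show ?thesis by linarith
        qed
        finally show ?thesis using True by simp
      next
        case False
        then have "\<eta> x = 0" using closure_subset[of "{x. \<eta> x \<noteq> 0}"] by auto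
        then show ?thesis using False by simp
      qed
    qed
  qed measurable
qed

text \<open>Makes each second derivative of \<eta> integrable against an \<open>L2\<close> function,
  so that the integral of the Laplacian splits into a sum. The complement of the support is open, so
  near any of its points \<eta> vanishes along coordinate lines, and this is inherited by every
  partial derivative.\<close>

lemma test_function_iter_partial:
  fixes \<eta> :: "real^'n \<Rightarrow> real"
  assumes \<eta>: "\<eta> \<in> test_functions"
  shows "iter_partial \<alpha> \<eta> \<in> test_functions"
proof -
  have app: "iter_partial \<beta> (iter_partial \<alpha> \<eta>) = iter_partial (\<beta> @ \<alpha>) \<eta>" for \<beta>
    by (induction \<beta>) auto
  have smooth: "(\<lambda>t. iter_partial \<beta> \<eta> (x + t *\<^sub>R axis i 1)) field_differentiable at 0"
    "continuous_on UNIV (iter_partial \<beta> \<eta>)" for \<beta> i x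
    using test_functionD[OF \<eta>] by auto
  have "iter_partial \<alpha> \<eta> x = 0" if "x \<notin> closure {x. \<eta> x \<noteq> 0}" for x
    using that
  proof (induction \<alpha> arbitrary: x)
    case Nil
    then show ?case using closure_subset[of "{x. \<eta> x \<noteq> 0}"] by auto
  next
    case (Cons i \<alpha>)
    let ?U = "- closure {x. \<eta> x \<noteq> 0}"
    let ?l = "\<lambda>t. x + t *\<^sub>R axis i (1::real)"
    have "((\<lambda>t. iter_partial \<alpha> \<eta> (?l t)) has_real_derivative 0) (at 0)"
    proof (rule has_field_derivative_transform_within_open)
      show "((\<lambda>_. 0) has_real_derivative 0) (at 0)" by simp
      show "open (?l -` ?U)" by (intro open_vimage open_Compl closed_closure continuous_intros)
      show "0 \<in> ?l -` ?U" using Cons.prems by simp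
      show "0 = iter_partial \<alpha> \<eta> (?l t)" if "t \<in> ?l -` ?U" for t
        using Cons.IH[of "?l t"] that by simp
    qed
    then show ?case by (simp add: partial_deriv_def DERIV_imp_deriv)
  qed
  then have "{x. iter_partial \<alpha> \<eta> x \<noteq> 0} \<subseteq> closure {x. \<eta> x \<noteq> 0}" by blast
  then have "closure {x. iter_partial \<alpha> \<eta> x \<noteq> 0} \<subseteq> closure {x. \<eta> x \<noteq> 0}"
    by (rule closure_minimal) simp
  then have "closure {x. iter_partial \<alpha> \<eta> x \<noteq> 0} = closure {x. \<eta> x \<noteq> 0} \<inter> closure {x. iter_partial \<alpha> \<eta> x \<noteq> 0}"
    by blast
  also have "compact \<dots>"
    using \<eta> by (intro compact_Int_closed) (auto simp: test_functions_def)
  finally have "compact (closure {x. iter_partial \<alpha> \<eta> x \<noteq> 0})" .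
  then show ?thesis by (simp add: test_functions_def C_k_def app smooth)
qed

text \<open>The weak second derivatives of \<psi> sum to the negative of its image under
  \<open>neg_laplacian\<close>, and the eigenvalue equation identifies this sum with (V - E)\<psi>
  almost everywhere.\<close>

lemma eigenfunction_weak_equation:
  fixes V :: "real^'n \<Rightarrow> real" and \<psi> u :: "real^'n \<Rightarrow> complex"
  assumes eigen: "eigenfunction (schroedinger_op V) E \<psi>"
    and V [measurable]: "V \<in> borel_measurable borel"
    and u [measurable]: "u \<in> borel_measurable borel" and ae: "AE x in lebesgue. \<psi> x = u x"
    and \<eta>: "\<eta> \<in> test_functions"
  shows "(LINT y|lborel. (\<Sum>i\<in>UNIV. iter_partial [i, i] \<eta> y) *\<^sub>R u y)
    = (LINT y|lborel. \<eta> y *\<^sub>R ((V y - E) *\<^sub>R u y))"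
proof -
  from eigen obtain p v where pv: "(\<psi>, p) \<in> neg_laplacian" "(\<psi>, v) \<in> mult_op V"
    "AE x in lebesgue. of_real E * \<psi> x = p x + v x"
    unfolding eigenfunction_def schroedinger_op_def op_sum_def by blast
  from pv(1) obtain d where d: "\<And>i. d i \<in> L2" "\<And>i. weak_partial [i, i] \<psi> (d i)"
    "AE x in lebesgue. p x = - (\<Sum>i\<in>UNIV. d i x)"
    unfolding neg_laplacian_def by blast
  from pv(2) have \<psi>: "\<psi> \<in> L2" and v: "AE x in lebesgue. v x = of_real (V x) * \<psi> x"
    unfolding mult_op_def by auto
  have \<psi>_meas [measurable]: "\<psi> \<in> borel_measurable lebesgue" and d_meas [measurable]: "d i \<in> borel_measurable lebesgue" for i
    using \<psi> d(1) by (auto simp: L2_def)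
  have [measurable]: "iter_partial \<alpha> \<eta> \<in> borel_measurable borel" for \<alpha>
    using test_functionD(2)[OF \<eta>] by (rule borel_measurable_continuous_onI)
  have [measurable]: "\<eta> \<in> borel_measurable borel"
    using test_functionD(2)[OF \<eta>, of "[]"] by (auto intro: borel_measurable_continuous_onI)
  have leb: "g \<in> borel_measurable lebesgue" if "g \<in> borel_measurable borel" for g :: "real^'n \<Rightarrow> 'b::topological_space"
    using that by (intro measurable_completion) simp
  let ?L = "\<lambda>y. \<Sum>i\<in>UNIV. iter_partial [i, i] \<eta> y"
  have "(LINT y|lborel. ?L y *\<^sub>R u y) = (LINT y|lebesgue. ?L y *\<^sub>R u y)"
    by (rule integral_completion[symmetric]) measurable
  also have "\<dots> = (LINT y|lebesgue. ?L y *\<^sub>R \<psi> y)"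
  proof (rule integral_cong_AE)
    show "AE y in lebesgue. ?L y *\<^sub>R u y = ?L y *\<^sub>R \<psi> y" using ae by eventually_elim simp
    show "(\<lambda>y. ?L y *\<^sub>R u y) \<in> borel_measurable lebesgue" by (rule leb) measurable
    show "(\<lambda>y. ?L y *\<^sub>R \<psi> y) \<in> borel_measurable lebesgue"
      by (intro borel_measurable_scaleR \<psi>_meas leb) measurable
  qed
  also have "\<dots> = (\<Sum>i\<in>UNIV. LINT y|lebesgue. iter_partial [i, i] \<eta> y *\<^sub>R \<psi> y)"
    unfolding scaleR_sum_left
    by (intro Bochner_Integration.integral_sum test_function_integrable test_function_iter_partial \<eta> \<psi>)
  also have "\<dots> = (\<Sum>i\<in>UNIV. LINT y|lebesgue. \<eta> y *\<^sub>R d i y)"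
    \<comment> \<open>The sign in \<open>weak_partial\<close> is (-1)^2 = 1 for a multi-index of
      length 2.\<close>
    using d(2) \<eta> by (intro sum.cong refl) (simp add: weak_partial_def)
  also have "\<dots> = (LINT y|lebesgue. (\<Sum>i\<in>UNIV. \<eta> y *\<^sub>R d i y))"
    by (intro Bochner_Integration.integral_sum[symmetric] test_function_integrable \<eta> d)
  also have "\<dots> = (LINT y|lebesgue. \<eta> y *\<^sub>R ((V y - E) *\<^sub>R u y))"
  proof (rule integral_cong_AE)
    show "AE y in lebesgue. (\<Sum>i\<in>UNIV. \<eta> y *\<^sub>R d i y) = \<eta> y *\<^sub>R ((V y - E) *\<^sub>R u y)"
      using ae pv(3) d(3) v
    proof eventually_elim
      case (elim y)
      have "(\<Sum>i\<in>UNIV. d i y) = - p y" using elim(3) by simp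
      also have "\<dots> = of_real (V y) * \<psi> y - of_real E * \<psi> y" using elim(2,4) by (simp add: algebra_simps)
      also have "\<dots> = (V y - E) *\<^sub>R u y" using elim(1) by (simp add: scaleR_conv_of_real algebra_simps)
      finally show ?case by (simp add: scaleR_sum_right[symmetric])
    qed
    show "(\<lambda>y. \<Sum>i\<in>UNIV. \<eta> y *\<^sub>R d i y) \<in> borel_measurable lebesgue"
      by (intro borel_measurable_sum borel_measurable_scaleR d_meas leb) measurable
    show "(\<lambda>y. \<eta> y *\<^sub>R ((V y - E) *\<^sub>R u y)) \<in> borel_measurable lebesgue" by (rule leb) measurable
  qed
  also have "\<dots> = (LINT y|lborel. \<eta> y *\<^sub>R ((V y - E) *\<^sub>R u y))"
    by (rule integral_completion) measurable
  finally show ?thesis .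
qed

lemma L2_nn_integral_representative:
  fixes f :: "real^'n \<Rightarrow> complex" and g :: "real^'n \<Rightarrow> real"
  assumes f: "f \<in> L2" and [measurable]: "g \<in> borel_measurable borel"
    and ae: "AE x in lebesgue. norm (f x) = g x"
  shows "(\<integral>\<^sup>+x. ennreal ((g x)\<^sup>2) \<partial>lborel) < \<infinity>"
proof -
  have "(\<integral>\<^sup>+x. ennreal ((g x)\<^sup>2) \<partial>lborel) = (\<integral>\<^sup>+x. ennreal ((g x)\<^sup>2) \<partial>lebesgue)"
    by (rule nn_integral_completion[symmetric])
  also have "\<dots> = (\<integral>\<^sup>+x. ennreal (norm ((norm (f x))\<^sup>2)) \<partial>lebesgue)"
    by (rule nn_integral_cong_AE) (use ae in \<open>eventually_elim, simp\<close>)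
  also have "\<dots> < \<infinity>" using f unfolding L2_def integrable_iff_bounded by blast
  finally show ?thesis .
qed

theorem theorem4p2:
  fixes V :: "real^'n \<Rightarrow> real"
    and k :: nat
    and \<psi> :: "real^'n \<Rightarrow> complex"
    and E \<epsilon> :: real
    and \<phi> \<phi>' :: "real \<Rightarrow> real"
  assumes V_cont: "continuous_on UNIV V"
    and V_below: "bdd_below (range V)"
    and V_rel_bounded: "relatively_bounded (mult_op V) neg_laplacian"
    and V_rel_bound: "relative_bound (mult_op V) neg_laplacian < 1"
    and k_pos: "k \<ge> 1"
    and k_large: "real k > (real CARD('n) - 4) / 2"
    and V_Cb: "V \<in> C_b k"
    and eigen: "eigenfunction (schroedinger_op V) E \<psi>"
    and phi_deriv: "\<And>t. t \<ge> 0 \<Longrightarrow> (\<phi> has_real_derivative \<phi>' t) (at t within {0..})"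
    and phi_C1: "continuous_on {0..} \<phi>'"
    and phi_ge1: "\<And>t. t \<ge> 0 \<Longrightarrow> \<phi> t \<ge> 1"
    and phi_sup_finite: "bdd_above ((\<lambda>t. \<bar>\<phi>' t / \<phi> t\<bar>) ` {0..})"
    and phi_sup_pos: "0 < (SUP t\<in>{0..}. \<bar>\<phi>' t / \<phi> t\<bar>)"
    and eps: "0 < \<epsilon>" "\<epsilon> < 1"
    and weighted_L2: "(\<lambda>x. of_real (\<phi> ((1 - \<epsilon>) * agmon_dist V E x)) * \<psi> x) \<in> L2"
  shows "\<exists>\<psi>c. continuous_on UNIV \<psi>c \<and> (AE x in lebesgue. \<psi>c x = \<psi> x) \<and>
           (\<exists>C>0. \<forall>x. norm (\<psi>c x) \<le> C / \<phi> ((1 - \<epsilon>) * agmon_dist V E x))"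
proof -
  have V_meas [measurable]: "V \<in> borel_measurable borel"
    using V_cont by (rule borel_measurable_continuous_onI)
  have "\<forall>\<alpha>. length \<alpha> \<le> k \<longrightarrow> bounded (range (iter_partial \<alpha> V))" using V_Cb by (simp add: C_b_def)
  \<comment> \<open>The empty multi-index is the order zero clause of \<open>C_b k\<close>:
    \<open>V\<close> itself is bounded.\<close>
  from this[rule_format, of "[]"] have "bounded (range V)" by simp
  then obtain K where K: "\<And>x. \<bar>V x\<bar> \<le> K" by (auto simp: bounded_iff)
  \<comment> \<open>The summand 1 makes \<open>M\<close> positive even when \<open>V\<close> and
    \<open>E\<close> vanish, as the locale requires.\<close>
  define M where "M = K + \<bar>E\<bar> + 1"
  have M: "\<bar>V x - E\<bar> \<le> M" "M > 0" for x using K[of x] K[of 0] by (auto simp: M_def)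
  define \<rho> where "\<rho> = agmon_dist V E"
  define \<Phi> where "\<Phi> x = \<phi> ((1 - \<epsilon>) * \<rho> x)" for x
  define L where "L = sqrt M"
  have L: "sqrt (max (V x - E) 0) \<le> L" for x
    unfolding L_def using M(1)[of x] by (intro real_sqrt_le_mono) auto
  have L0: "L \<ge> 0" using M(2) by (simp add: L_def)
  have \<rho>0: "0 \<le> (1 - \<epsilon>) * \<rho> x" for x
    using eps by (simp add: \<rho>_def agmon_dist_nonneg)
  have \<rho>_lip: "\<bar>\<rho> x - \<rho> y\<bar> \<le> L * norm (x - y)" for x y
    using agmon_dist_le[where V=V and x=x and y=y, OF L] agmon_dist_le[where V=V and x=y and y=x, OF L]
    by (simp add: \<rho>_def abs_le_iff norm_minus_commute)
  have \<Phi>1: "\<Phi> x \<ge> 1" for x unfolding \<Phi>_def by (intro phi_ge1 \<rho>0)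
  have phi_pos: "\<phi> t > 0" if "t \<ge> 0" for t using phi_ge1[OF that] by linarith
  have \<Phi>0: "\<Phi> x > 0" "\<Phi> x \<ge> 0" for x using \<Phi>1[of x] by linarith+
  from phi_sup_finite obtain B where B: "\<And>t. t \<ge> 0 \<Longrightarrow> \<bar>\<phi>' t / \<phi> t\<bar> \<le> B"
    by (auto simp: bdd_above_def)
  have B0: "B \<ge> 0" using B[of 0] by linarith
  have \<Phi>_lip: "\<Phi> x \<le> exp ((B * L) * norm (x - y)) * \<Phi> y" for x y
  proof -
    have "\<Phi> x \<le> exp (B * \<bar>(1 - \<epsilon>) * \<rho> x - (1 - \<epsilon>) * \<rho> y\<bar>) * \<Phi> y"
      unfolding \<Phi>_def by (rule log_lipschitz_weight[of \<phi> \<phi>', OF phi_deriv phi_pos B \<rho>0 \<rho>0])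
    moreover have "B * \<bar>(1 - \<epsilon>) * \<rho> x - (1 - \<epsilon>) * \<rho> y\<bar> \<le> B * L * norm (x - y)"
    proof -
      have "\<bar>(1 - \<epsilon>) * \<rho> x - (1 - \<epsilon>) * \<rho> y\<bar> = (1 - \<epsilon>) * \<bar>\<rho> x - \<rho> y\<bar>"
        using eps by (simp add: right_diff_distrib[symmetric] abs_mult)
      also have "\<dots> \<le> 1 * (L * norm (x - y))"
        using eps by (intro mult_mono \<rho>_lip) auto
      finally show ?thesis using B0 by (simp add: mult_left_mono mult.assoc)
    qed
    then have "exp (B * \<bar>(1 - \<epsilon>) * \<rho> x - (1 - \<epsilon>) * \<rho> y\<bar>) * \<Phi> y \<le> exp (B * L * norm (x - y)) * \<Phi> y"
      using \<Phi>0(2)[of y] by (intro mult_right_mono) auto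
    ultimately show ?thesis by (rule order_trans)
  qed
  have "L-lipschitz_on UNIV \<rho>" using \<rho>_lip L0 by (intro lipschitz_onI) (auto simp: dist_norm)
  then have "continuous_on UNIV \<rho>" by (rule lipschitz_on_continuous_on)
  then have \<rho>_cont: "continuous_on UNIV (\<lambda>x. (1 - \<epsilon>) * \<rho> x)" by (rule continuous_on_mult_left)
  have "continuous_on {0..} \<phi>"
    by (rule DERIV_continuous_on[of _ _ \<phi>']) (simp add: phi_deriv)
  then have "continuous_on UNIV (\<lambda>x. \<phi> ((1 - \<epsilon>) * \<rho> x))"
    by (rule continuous_on_compose2[OF _ \<rho>_cont]) (use \<rho>0 in auto)
  then have \<Phi>_cont: "continuous_on UNIV \<Phi>"
    by (simp only: \<Phi>_def[abs_def])
  then have \<Phi>_meas [measurable]: "\<Phi> \<in> borel_measurable borel" by (rule borel_measurable_continuous_onI)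

  have \<psi>: "\<psi> \<in> L2"
    using eigen by (auto simp: eigenfunction_def schroedinger_op_def op_sum_def mult_op_def)
  then obtain u where u [measurable]: "u \<in> borel_measurable borel" and ae: "AE x in lebesgue. \<psi> x = u x"
    using lebesgue_complex_borel_representative[of \<psi>] by (auto simp: L2_def)
  have u_L2: "(\<integral>\<^sup>+x. ennreal ((norm (u x))\<^sup>2) \<partial>lborel) < \<infinity>"
    by (rule L2_nn_integral_representative[OF \<psi>]) (measurable, use ae in \<open>eventually_elim, simp\<close>)
  have \<Phi>u_L2: "(\<integral>\<^sup>+x. ennreal ((\<Phi> x * norm (u x))\<^sup>2) \<partial>lborel) < \<infinity>"
  proof (rule L2_nn_integral_representative[OF weighted_L2])
    show "AE x in lebesgue. norm (of_real (\<phi> ((1 - \<epsilon>) * agmon_dist V E x)) * \<psi> x) = \<Phi> x * norm (u x)"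
      using ae by eventually_elim (use \<Phi>0(2) in \<open>simp add: norm_mult \<Phi>_def \<rho>_def\<close>)
  qed measurable
  interpret bounded_potential u "\<lambda>x. V x - E" M
  proof
    show "(LINT y|lborel. (\<Sum>i\<in>UNIV. iter_partial [i, i] \<eta> y) *\<^sub>R u y)
       = (LINT y|lborel. \<eta> y *\<^sub>R ((V y - E) *\<^sub>R u y))" if "\<eta> \<in> test_functions" for \<eta>
      by (rule eigenfunction_weak_equation[OF eigen V_meas u ae that])
  qed (use u u_L2 M in auto)

  \<comment> \<open>\<open>T \<le> 1\<close> serves the limit of vanishing time,
    \<open>2 * M * T \<le> 1\<close> the absorption.\<close>
  define T where "T = min 1 (1 / (2 * M))"
  have T: "0 < T" "T \<le> 1" "2 * M * T \<le> 1"
  proof -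
    have "2 * M * T \<le> 2 * M * (1 / (2 * M))" using M(2) by (intro mult_left_mono) (auto simp: T_def)
    then show "2 * M * T \<le> 1" using M(2) by simp
  qed (use M(2) in \<open>auto simp: T_def\<close>)
  obtain C where C: "C > 0" "\<And>x. ennreal (\<Phi> x) * heat_avg T (\<lambda>y. ennreal (norm (u y))) x \<le> ennreal C"
    using weighted_heat_avg_bound[OF u \<Phi>_meas T(1) \<Phi>0(2) \<Phi>_lip \<Phi>u_L2] by blast
  have cont: "continuous_on UNIV (limit_fun T)" by (rule continuous_representative[OF T])
  have eq: "AE x in lborel. u x = limit_fun T x" by (rule solution_eq_limit_fun[OF T(1,2)])
  have "AE x in lborel. norm (limit_fun T x) * \<Phi> x \<le> 2 * C"
    using eq solution_le_avg[OF T]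
  proof eventually_elim
    case (elim x)
    have "ennreal (\<Phi> x) * ennreal (norm (u x)) \<le> ennreal (\<Phi> x) * (2 * heat_avg T (\<lambda>y. ennreal (norm (u y))) x)"
      by (intro mult_left_mono elim) simp
    also have "\<dots> = 2 * (ennreal (\<Phi> x) * heat_avg T (\<lambda>y. ennreal (norm (u y))) x)" by (simp add: mult_ac)
    also have "\<dots> \<le> 2 * ennreal C" by (intro mult_left_mono C) simp
    also have "\<dots> = ennreal (2 * C)" using C(1) by (subst ennreal_mult) auto
    finally have "ennreal (\<Phi> x * norm (u x)) \<le> ennreal (2 * C)"
      using \<Phi>0(2)[of x] by (simp add: ennreal_mult)
    then show ?case using elim(1) C(1) by (simp add: mult.commute)
  qed
  then have ae_bound: "AE x\<in>UNIV in lebesgue. x \<in> {x. norm (limit_fun T x) * \<Phi> x \<le> 2 * C}"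
    by (intro AE_completion) simp
  \<comment> \<open>A closed set of full measure is the whole space; this turns the almost
    everywhere bound into one at every point.\<close>
  have closed: "closed {x. norm (limit_fun T x) * \<Phi> x \<le> 2 * C}"
    by (intro closed_Collect_le continuous_intros cont \<Phi>_cont)
  have bound: "norm (limit_fun T x) * \<Phi> x \<le> 2 * C" for x
    using mem_closed_if_AE_lebesgue_open[OF open_UNIV closed ae_bound, of x] by simp
  show ?thesis
  proof (intro exI[of _ "limit_fun T"] conjI exI[of _ "2 * C"] allI)
    show "continuous_on UNIV (limit_fun T)" by (rule cont)
    show "AE x in lebesgue. limit_fun T x = \<psi> x"
      using AE_completion[OF eq] ae by eventually_elim simp
    show "norm (limit_fun T x) \<le> 2 * C / \<phi> ((1 - \<epsilon>) * agmon_dist V E x)" for x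
      using bound[of x] \<Phi>0(1)[of x] by (simp add: \<Phi>_def \<rho>_def pos_le_divide_eq)
  qed (use C(1) in simp)
qed

end
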